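(* Let $k$ be a field. For every commutative Hopf co-brace $(H,\Delta_\bullet,\Delta_\circ)$ over $k$, there exists a commutative Hopf co-brace $(H\otimes H,\widetilde{\Delta}_\bullet,\widetilde{\Delta}_\circ)$ on the tensor product algebra $H\otimes H$, arising from a co-Rota--Baxter Hopf algebra, such that the map $$(H\otimes H,\widetilde{\Delta}_\bullet,\widetilde{\Delta}_\circ)\longrightarrow(H,\Delta_\bullet,\Delta_\circ),\qquad x\otimes y\longmapsto \varepsilon_H(x)\,y,$$ is a homomorphism of Hopf co-braces.
   Context: A Hopf co-brace structure on a $k$-algebra $(A,\mu,\eta)$ consists of two Hopf algebra structures $(A,\mu,\eta,\Delta_\bullet,\epsilon_\bullet,S_\bullet)$ and $(A,\mu,\eta,\Delta_\circ,\epsilon_\circ,S_\circ)$ such that for all $a\in A$ $$a_{1_\circ}\otimes(a_{2_\circ})_{1_\bullet}\otimes(a_{2_\circ})_{2_\bullet}=(a_{1_\bullet})_{1_\circ}S_\bullet(a_{2_\bullet})(a_{3_\bullet})_{1_\circ}\otimes(a_{1_\bullet})_{2_\circ}\otimes(a_{3_\bullet})_{2_\circ},$$ in Sweedler notation $\Delta_\circ(a)=a_{1_\circ}\otimes a_{2_\circ}$, $\Delta_\bullet(a)=a_{1_\bullet}\otimes a_{2_\bullet}$, $\Delta_\bullet^{(2)}(a)=a_{1_\bullet}\otimes a_{2_\bullet}\otimes a_{3_\bullet}$. It is commutative if the algebra $A$ is commutative. For a commutative Hopf co-brace $H$ the two counits coincide, and $\varepsilon_H$ denotes this common counit. A homomorphism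 of Hopf co-braces is a linear map that is a Hopf algebra homomorphism both for the $\Delta_\bullet$-structures and for the $\Delta_\circ$-structures. A co-Rota--Baxter Hopf algebra is a commutative Hopf algebra $(K,\mu,\eta,\Delta,\varepsilon,S)$ with an algebra map $\mathcal{B}:K\to K$ such that for all $x\in K$ $$\mathcal{B}(x_1)\otimes\mathcal{B}(x_2)=\mathcal{B}(x)_1\,\mathcal{B}\big(\mathcal{B}(x)_2S(\mathcal{B}(x)_4)\big)\otimes\mathcal{B}(x)_3 .$$ Its descendant Hopf algebra is $(K,\mu,\eta,\Delta_{\mathcal{B}},\varepsilon,S_{\mathcal{B}})$ with $$\Delta_{\mathcal{B}}(x)=x_1\mathcal{B}(x_2)\mathcal{B}(S(x_4))\otimes x_3,\qquad S_{\mathcal{B}}(x)=\mathcal{B}(S(x_1))S(x_2)\mathcal{B}(x_3).$$ A Hopf co-brace arises from a co-Rota--Baxter Hopf algebra $(K,\Delta,\mathcal{B})$ if it equals $(K,\Delta,\Delta_{\mathcal{B}})$ (which is a commutative Hopf co-brace). *)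

theory Defs
  imports "HOL-Algebra.Module" "HOL-Algebra.AbelCoset"
begin

section \<open>Algebras over a field\<close>

text \<open>The library locale \<open>algebra\<close> is restricted to commutative algebras.\<close>

locale assoc_algebra = module K A + K?: field K + A?: ring A
  for K (structure) and A (structure) +
  assumes smult_mult_left:
      "\<lbrakk>c \<in> carrier K; x \<in> carrier A; y \<in> carrier A\<rbrakk> \<Longrightarrow>
        (c \<odot>\<^bsub>A\<^esub> x) \<otimes>\<^bsub>A\<^esub> y = c \<odot>\<^bsub>A\<^esub> (x \<otimes>\<^bsub>A\<^esub> y)"
    and smult_mult_right:
      "\<lbrakk>c \<in> carrier K; x \<in> carrier A; y \<in> carrier A\<rbrakk> \<Longrightarrow>
        x \<otimes>\<^bsub>A\<^esub> (c \<odot>\<^bsub>A\<^esub> y) = c \<odot>\<^bsub>A\<^esub> (x \<otimes>\<^bsub>A\<^esub> y)"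

definition linear_map ::
  "('k, 'm) ring_scheme \<Rightarrow> ('k, 'a, 'n) module_scheme \<Rightarrow> ('k, 'b, 'p) module_scheme \<Rightarrow> ('a \<Rightarrow> 'b) \<Rightarrow> bool"
  where "linear_map K A B f \<longleftrightarrow>
    f \<in> carrier A \<rightarrow> carrier B \<and>
    (\<forall>x\<in>carrier A. \<forall>y\<in>carrier A. f (x \<oplus>\<^bsub>A\<^esub> y) = f x \<oplus>\<^bsub>B\<^esub> f y) \<and>
    (\<forall>c\<in>carrier K. \<forall>x\<in>carrier A. f (c \<odot>\<^bsub>A\<^esub> x) = c \<odot>\<^bsub>B\<^esub> f x)"

definition algebra_hom ::
  "('k, 'm) ring_scheme \<Rightarrow> ('k, 'a, 'n) module_scheme \<Rightarrow> ('k, 'b, 'p) module_scheme \<Rightarrow> ('a \<Rightarrow> 'b) \<Rightarrow> bool"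
  where "algebra_hom K A B f \<longleftrightarrow> linear_map K A B f \<and> f \<in> ring_hom A B"

text \<open>Algebra homomorphisms to the ground field, which is only a ring record.\<close>

definition algebra_character ::
  "('k, 'm) ring_scheme \<Rightarrow> ('k, 'a, 'n) module_scheme \<Rightarrow> ('a \<Rightarrow> 'k) \<Rightarrow> bool"
  where "algebra_character K A f \<longleftrightarrow> f \<in> ring_hom A K \<and>
    (\<forall>c\<in>carrier K. \<forall>x\<in>carrier A. f (c \<odot>\<^bsub>A\<^esub> x) = c \<otimes>\<^bsub>K\<^esub> f x)"

section \<open>Tensor products\<close>

text \<open>
  \<open>A \<otimes> B\<close> is the free module on \<open>carrier A \<times> carrier B\<close> modulo the submodule
  generated by the bilinearity relations; its elements are cosets.
\<close>

type_synonym ('a, 'b, 'k) tensor = "('a \<times> 'b \<Rightarrow> 'k) set"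

text \<open>
  In the records \<open>free_module\<close> and \<open>tensor_module\<close> only the module part is meaningful;
  the fields for multiplication and unit are left unspecified.
\<close>

definition free_module :: "('k, 'm) ring_scheme \<Rightarrow> 's set \<Rightarrow> ('k, 's \<Rightarrow> 'k) module"
  where "free_module K S =
    \<lparr>carrier = {f. (\<forall>s\<in>S. f s \<in> carrier K) \<and> (\<forall>s. s \<notin> S \<longrightarrow> f s = \<zero>\<^bsub>K\<^esub>) \<and> finite {s. f s \<noteq> \<zero>\<^bsub>K\<^esub>}},
     monoid.mult = undefined, one = undefined,
     zero = (\<lambda>s. \<zero>\<^bsub>K\<^esub>), add = (\<lambda>f g s. f s \<oplus>\<^bsub>K\<^esub> g s),
     smult = (\<lambda>c f s. c \<otimes>\<^bsub>K\<^esub> f s)\<rparr>"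

definition free_gen :: "('k, 'm) ring_scheme \<Rightarrow> 's \<Rightarrow> 's \<Rightarrow> 'k"
  where "free_gen K s = (\<lambda>t. if t = s then \<one>\<^bsub>K\<^esub> else \<zero>\<^bsub>K\<^esub>)"

context
  fixes K :: "('k, 'm) ring_scheme"
    and A :: "('k, 'a, 'n) module_scheme"
    and B :: "('k, 'b, 'p) module_scheme"
begin

definition tensor_free :: "('k, 'a \<times> 'b \<Rightarrow> 'k) module"
  where "tensor_free = free_module K (carrier A \<times> carrier B)"

definition tensor_relators :: "('a \<times> 'b \<Rightarrow> 'k) set"
  where "tensor_relators =
    {free_gen K (x \<oplus>\<^bsub>A\<^esub> x', y) \<ominus>\<^bsub>tensor_free\<^esub> (free_gen K (x, y) \<oplus>\<^bsub>tensor_free\<^esub> free_gen K (x', y))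
      | x x' y. x \<in> carrier A \<and> x' \<in> carrier A \<and> y \<in> carrier B} \<union>
    {free_gen K (x, y \<oplus>\<^bsub>B\<^esub> y') \<ominus>\<^bsub>tensor_free\<^esub> (free_gen K (x, y) \<oplus>\<^bsub>tensor_free\<^esub> free_gen K (x, y'))
      | x y y'. x \<in> carrier A \<and> y \<in> carrier B \<and> y' \<in> carrier B} \<union>
    {free_gen K (c \<odot>\<^bsub>A\<^esub> x, y) \<ominus>\<^bsub>tensor_free\<^esub> (c \<odot>\<^bsub>tensor_free\<^esub> free_gen K (x, y))
      | c x y. c \<in> carrier K \<and> x \<in> carrier A \<and> y \<in> carrier B} \<union>
    {free_gen K (x, c \<odot>\<^bsub>B\<^esub> y) \<ominus>\<^bsub>tensor_free\<^esub> (c \<odot>\<^bsub>tensor_free\<^esub> free_gen K (x, y))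
      | c x y. c \<in> carrier K \<and> x \<in> carrier A \<and> y \<in> carrier B}"

definition tensor_null :: "('a \<times> 'b \<Rightarrow> 'k) set"
  where "tensor_null = \<Inter>{N. submodule N K tensor_free \<and> tensor_relators \<subseteq> N}"

definition tensor_class :: "('a \<times> 'b \<Rightarrow> 'k) \<Rightarrow> ('a, 'b, 'k) tensor"
  where "tensor_class f = tensor_null +>\<^bsub>tensor_free\<^esub> f"

definition tensor_module :: "('k, ('a, 'b, 'k) tensor) module"
  where "tensor_module =
    \<lparr>carrier = a_rcosets\<^bsub>tensor_free\<^esub> tensor_null,
     monoid.mult = undefined, one = undefined,
     zero = tensor_null, add = (\<lambda>X Y. X <+>\<^bsub>tensor_free\<^esub> Y),
     smult = (\<lambda>c X. \<Union>f\<in>X. tensor_class (c \<odot>\<^bsub>tensor_free\<^esub> f))\<rparr>"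

definition tensor :: "'a \<Rightarrow> 'b \<Rightarrow> ('a, 'b, 'k) tensor"
  where "tensor x y = tensor_class (free_gen K (x, y))"

text \<open>
  The map \<open>A \<otimes> B \<rightarrow> M\<close> induced by \<open>\<beta>\<close>, sending \<open>x \<otimes> y\<close> to \<open>\<beta> x y\<close>. For bilinear \<open>\<beta>\<close>
  the value does not depend on the representative chosen.
\<close>

definition tensor_lift :: "('k, 'c, 'q) module_scheme \<Rightarrow> ('a \<Rightarrow> 'b \<Rightarrow> 'c) \<Rightarrow> ('a, 'b, 'k) tensor \<Rightarrow> 'c"
  where "tensor_lift M \<beta> X =
    (let f = (SOME f. f \<in> X)
     in \<Oplus>\<^bsub>M\<^esub>s\<in>{s. f s \<noteq> \<zero>\<^bsub>K\<^esub>}. f s \<odot>\<^bsub>M\<^esub> \<beta> (fst s) (snd s))"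

definition tensor_algebra :: "('k, ('a, 'b, 'k) tensor) module"
  where "tensor_algebra = tensor_module
    \<lparr>monoid.mult := (\<lambda>X Y.
        tensor_lift tensor_module (\<lambda>x y.
          tensor_lift tensor_module (\<lambda>x' y'. tensor (x \<otimes>\<^bsub>A\<^esub> x') (y \<otimes>\<^bsub>B\<^esub> y')) Y) X),
     one := tensor \<one>\<^bsub>A\<^esub> \<one>\<^bsub>B\<^esub>\<rparr>"

end

section \<open>Hopf algebras\<close>

record ('k, 'a) hopf =
  comult :: "'a \<Rightarrow> ('a, 'a, 'k) tensor"
  counit :: "'a \<Rightarrow> 'k"
  antipode :: "'a \<Rightarrow> 'a"

text \<open>
  Sweedler notation: \<open>sweedler2 K h M x \<beta>\<close> is \<open>\<beta> x\<^sub>1 x\<^sub>2\<close>, understood as the image of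
  \<open>x\<^sub>1 \<otimes> x\<^sub>2\<close> under the linear map into \<open>M\<close> induced by \<open>\<beta>\<close>; similarly for the iterated
  coproducts \<open>x\<^sub>1 \<otimes> (x\<^sub>2 \<otimes> x\<^sub>3)\<close> and \<open>x\<^sub>1 \<otimes> (x\<^sub>2 \<otimes> (x\<^sub>3 \<otimes> x\<^sub>4))\<close>. The functions \<open>\<beta>\<close> used
  below are multilinear.
\<close>

context
  fixes K :: "('k, 'm) ring_scheme"
    and h :: "('k, 'a, 'r) hopf_scheme"
    and M :: "('k, 'c, 'q) module_scheme"
begin

definition sweedler2 :: "'a \<Rightarrow> ('a \<Rightarrow> 'a \<Rightarrow> 'c) \<Rightarrow> 'c"
  where "sweedler2 x \<beta> = tensor_lift K M \<beta> (comult h x)"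

definition sweedler3 :: "'a \<Rightarrow> ('a \<Rightarrow> 'a \<Rightarrow> 'a \<Rightarrow> 'c) \<Rightarrow> 'c"
  where "sweedler3 x \<beta> = sweedler2 x (\<lambda>x1 y. sweedler2 y (\<lambda>x2 x3. \<beta> x1 x2 x3))"

definition sweedler4 :: "'a \<Rightarrow> ('a \<Rightarrow> 'a \<Rightarrow> 'a \<Rightarrow> 'a \<Rightarrow> 'c) \<Rightarrow> 'c"
  where "sweedler4 x \<beta> = sweedler2 x (\<lambda>x1 y. sweedler3 y (\<lambda>x2 x3 x4. \<beta> x1 x2 x3 x4))"

end

text \<open>Triple tensors are right-nested, \<open>A \<otimes> (A \<otimes> A)\<close>.\<close>

definition tensor_algebra3 ::
  "('k, 'm) ring_scheme \<Rightarrow> ('k, 'a, 'n) module_scheme \<Rightarrow> ('k, ('a, ('a, 'a, 'k) tensor, 'k) tensor) module"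
  where "tensor_algebra3 K A = tensor_algebra K A (tensor_algebra K A A)"

definition tensor3 ::
  "('k, 'm) ring_scheme \<Rightarrow> ('k, 'a, 'n) module_scheme \<Rightarrow> 'a \<Rightarrow> 'a \<Rightarrow> 'a \<Rightarrow> ('a, ('a, 'a, 'k) tensor, 'k) tensor"
  where "tensor3 K A x y z = tensor K A (tensor_algebra K A A) x (tensor K A A y z)"

locale hopf_algebra = assoc_algebra K A
  for K :: "('k, 'm) ring_scheme" (structure)
    and A :: "('k, 'a, 'n) module_scheme" (structure) +
  fixes h :: "('k, 'a, 'r) hopf_scheme" (structure)
  assumes comult_hom: "algebra_hom K A (tensor_algebra K A A) (comult h)"
    and counit_hom: "algebra_character K A (counit h)"
    and antipode_linear: "linear_map K A A (antipode h)"
    and coassoc: "x \<in> carrier A \<Longrightarrow>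
      sweedler2 K h (tensor_algebra3 K A) x
        (\<lambda>y x3. sweedler2 K h (tensor_algebra3 K A) y (\<lambda>x1 x2. tensor3 K A x1 x2 x3)) =
      sweedler2 K h (tensor_algebra3 K A) x
        (\<lambda>x1 y. sweedler2 K h (tensor_algebra3 K A) y (\<lambda>x2 x3. tensor3 K A x1 x2 x3))"
    and counit_left: "x \<in> carrier A \<Longrightarrow>
      sweedler2 K h A x (\<lambda>x1 x2. counit h x1 \<odot>\<^bsub>A\<^esub> x2) = x"
    and counit_right: "x \<in> carrier A \<Longrightarrow>
      sweedler2 K h A x (\<lambda>x1 x2. counit h x2 \<odot>\<^bsub>A\<^esub> x1) = x"
    and antipode_left: "x \<in> carrier A \<Longrightarrow>
      sweedler2 K h A x (\<lambda>x1 x2. antipode h x1 \<otimes>\<^bsub>A\<^esub> x2) = counit h x \<odot>\<^bsub>A\<^esub> \<one>\<^bsub>A\<^esub>"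
    and antipode_right: "x \<in> carrier A \<Longrightarrow>
      sweedler2 K h A x (\<lambda>x1 x2. x1 \<otimes>\<^bsub>A\<^esub> antipode h x2) = counit h x \<odot>\<^bsub>A\<^esub> \<one>\<^bsub>A\<^esub>"

definition hopf_hom ::
  "('k, 'm) ring_scheme \<Rightarrow>
   ('k, 'a, 'n) module_scheme \<Rightarrow> ('k, 'a, 'r) hopf_scheme \<Rightarrow>
   ('k, 'b, 'p) module_scheme \<Rightarrow> ('k, 'b, 's) hopf_scheme \<Rightarrow> ('a \<Rightarrow> 'b) \<Rightarrow> bool"
  where "hopf_hom K A h B g f \<longleftrightarrow> algebra_hom K A B f \<and>
    (\<forall>x\<in>carrier A.
      comult g (f x) = sweedler2 K h (tensor_algebra K B B) x (\<lambda>x1 x2. tensor K B B (f x1) (f x2)) \<and>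
      counit g (f x) = counit h x \<and>
      antipode g (f x) = f (antipode h x))"

section \<open>Hopf co-braces\<close>

locale hopf_cobrace = bullet: hopf_algebra K A b + circ: hopf_algebra K A c
  for K :: "('k, 'm) ring_scheme" (structure)
    and A :: "('k, 'a, 'n) module_scheme" (structure)
    and b :: "('k, 'a, 'r) hopf_scheme"
    and c :: "('k, 'a, 's) hopf_scheme" +
  assumes cobrace: "x \<in> carrier A \<Longrightarrow>
      sweedler2 K c (tensor_algebra3 K A) x (\<lambda>u v.
        sweedler2 K b (tensor_algebra3 K A) v (\<lambda>v1 v2. tensor3 K A u v1 v2)) =
      sweedler3 K b (tensor_algebra3 K A) x (\<lambda>x1 x2 x3.
        sweedler2 K c (tensor_algebra3 K A) x1 (\<lambda>y1 y2.
          sweedler2 K c (tensor_algebra3 K A) x3 (\<lambda>z1 z2.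
            tensor3 K A (y1 \<otimes>\<^bsub>A\<^esub> antipode b x2 \<otimes>\<^bsub>A\<^esub> z1) y2 z2)))"

text \<open>
  In a commutative Hopf co-brace \<open>counit b\<close> and \<open>counit c\<close> agree on the carrier; \<open>counit b\<close>
  serves as the common counit.
\<close>

locale comm_hopf_cobrace = hopf_cobrace K A b c + cring A
  for K :: "('k, 'm) ring_scheme" (structure)
    and A :: "('k, 'a, 'n) module_scheme" (structure)
    and b :: "('k, 'a, 'r) hopf_scheme"
    and c :: "('k, 'a, 's) hopf_scheme"

definition hopf_cobrace_hom ::
  "('k, 'm) ring_scheme \<Rightarrow>
   ('k, 'a, 'n) module_scheme \<Rightarrow> ('k, 'a, 'r) hopf_scheme \<Rightarrow> ('k, 'a, 's) hopf_scheme \<Rightarrow>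
   ('k, 'b, 'p) module_scheme \<Rightarrow> ('k, 'b, 't) hopf_scheme \<Rightarrow> ('k, 'b, 'u) hopf_scheme \<Rightarrow>
   ('a \<Rightarrow> 'b) \<Rightarrow> bool"
  where "hopf_cobrace_hom K A b c A' b' c' f \<longleftrightarrow>
    hopf_hom K A b A' b' f \<and> hopf_hom K A c A' c' f"

section \<open>Co-Rota--Baxter Hopf algebras\<close>

locale co_rota_baxter = hopf_algebra K A h + cring A
  for K :: "('k, 'm) ring_scheme" (structure)
    and A :: "('k, 'a, 'n) module_scheme" (structure)
    and h :: "('k, 'a, 'r) hopf_scheme" (structure) +
  fixes B :: "'a \<Rightarrow> 'a"
  assumes B_hom: "algebra_hom K A A B"
    and co_rota_baxter: "x \<in> carrier A \<Longrightarrow>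
      sweedler2 K h (tensor_algebra K A A) x (\<lambda>x1 x2. tensor K A A (B x1) (B x2)) =
      sweedler4 K h (tensor_algebra K A A) (B x) (\<lambda>y1 y2 y3 y4.
        tensor K A A (y1 \<otimes>\<^bsub>A\<^esub> B (y2 \<otimes>\<^bsub>A\<^esub> antipode h y4)) y3)"

definition descendant ::
  "('k, 'm) ring_scheme \<Rightarrow> ('k, 'a, 'n) module_scheme \<Rightarrow> ('k, 'a, 'r) hopf_scheme \<Rightarrow>
   ('a \<Rightarrow> 'a) \<Rightarrow> ('k, 'a) hopf"
  where "descendant K A h B =
    \<lparr>comult = (\<lambda>x. sweedler4 K h (tensor_algebra K A A) x (\<lambda>x1 x2 x3 x4.
        tensor K A A (x1 \<otimes>\<^bsub>A\<^esub> B x2 \<otimes>\<^bsub>A\<^esub> B (antipode h x4)) x3)),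
     counit = counit h,
     antipode = (\<lambda>x. sweedler3 K h A x (\<lambda>x1 x2 x3.
        B (antipode h x1) \<otimes>\<^bsub>A\<^esub> antipode h x2 \<otimes>\<^bsub>A\<^esub> B x3))\<rparr>"

text \<open>Equality of Hopf structures; values outside the carrier are irrelevant.\<close>

definition hopf_eq ::
  "('k, 'a, 'n) module_scheme \<Rightarrow> ('k, 'a, 'r) hopf_scheme \<Rightarrow> ('k, 'a, 's) hopf_scheme \<Rightarrow> bool"
  where "hopf_eq A h g \<longleftrightarrow> (\<forall>x\<in>carrier A.
    comult h x = comult g x \<and> counit h x = counit g x \<and> antipode h x = antipode g x)"

definition arises_from_co_rota_baxter ::
  "('k, 'm) ring_scheme \<Rightarrow> ('k, 'a, 'n) module_scheme \<Rightarrow>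
   ('k, 'a) hopf \<Rightarrow> ('k, 'a) hopf \<Rightarrow> bool"
  where "arises_from_co_rota_baxter K A b c \<longleftrightarrow>
    (\<exists>(h :: ('k, 'a) hopf) B.
      co_rota_baxter K A h B \<and> hopf_eq A b h \<and> hopf_eq A c (descendant K A h B))"

end

theory Submission
  imports Defs
begin

text \<open>
  A commutative Hopf algebra is a group-valued functor: its points, the algebra homomorphisms
  into a commutative algebra \<open>R\<close>, form a group under convolution, and the points of a commutative
  Hopf co-brace form a skew brace \<open>(G, \<bullet>, \<circ>)\<close>, naturally in \<open>R\<close>. For a skew brace, \<open>(G, \<circ>)\<close>
  acts on \<open>(G, \<bullet>)\<close> by \<open>\<lambda>\<^sub>a(x) = a\<^sup>-\<^sup>1 \<bullet> (a \<circ> x)\<close>. The semidirect product on \<open>G \<times> G\<close>, with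
  \<open>(a, x)(b, y) = (a \<circ> b, x \<bullet> \<lambda>\<^sub>a(y))\<close>, is the exact product of the diagonal and of \<open>G \<times> {1}\<close>;
  sending \<open>(a, x) = (x, x)(x' \<circ> a, 1)\<close> to the inverse \<open>(a' \<circ> x, 1)\<close> of its second factor (primes
  denote inverses for \<open>\<circ>\<close>) is a Rota--Baxter operator, and \<open>x \<mapsto> (1, x)\<close> embeds \<open>G\<close> into the skew
  brace of this Rota--Baxter group. Since \<open>H \<otimes> H\<close> represents \<open>G \<times> G\<close>, the construction transfers
  to \<open>H \<otimes> H\<close> by evaluation at universal points; the embedding becomes the map
  \<open>x \<otimes> y \<mapsto> \<epsilon>(x) y\<close>.
\<close>

section \<open>Linear maps and tensor products\<close>

text \<open>The operator comes from a general fact. In an exact factorization \<open>S = L M\<close>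
  put \<open>B (l m) = inv m\<close>. For \<open>x = l m\<close> and \<open>y = l' m'\<close> one
  has \<open>x B(x) = l\<close>, so \<open>x B(x) y (inv B(x)) = l y m = l l' m' m\<close>, and
  \<open>B\<close> sends this to \<open>inv m inv m' = B(x) B(y)\<close>. The descendant product of
  \<open>x\<close> and \<open>y\<close> is therefore \<open>l y m\<close>. With \<open>L\<close> the
  diagonal, \<open>(1, x) = (x, x)(x', 1)\<close> and \<open>(1, y)\<close> have descendant product
  \<open>(x, x)(1, y)(x', 1) = (1, x \<circ> y)\<close>; this is how the second operation is
  recovered. The main obstacle is the antipode: it is only assumed linear, whereas inverses of
  points must be algebra homomorphisms, so its multiplicativity has to be proved before points form
  groups. In the other direction, the Hopf axioms for the new coproducts are never verified by
  Sweedler calculations: each is a group law at a generic point, with values in the algebra itself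
  or in its tensor square or cube.\<close>

lemma linear_mapI:
  assumes "\<And>x. x \<in> carrier A \<Longrightarrow> f x \<in> carrier B"
    and "\<And>x y. \<lbrakk>x \<in> carrier A; y \<in> carrier A\<rbrakk> \<Longrightarrow> f (x \<oplus>\<^bsub>A\<^esub> y) = f x \<oplus>\<^bsub>B\<^esub> f y"
    and "\<And>c x. \<lbrakk>c \<in> carrier K; x \<in> carrier A\<rbrakk> \<Longrightarrow> f (c \<odot>\<^bsub>A\<^esub> x) = c \<odot>\<^bsub>B\<^esub> f x"
  shows "linear_map K A B f"
  using assms unfolding linear_map_def by blast

lemma
  assumes "linear_map K A B f"
  shows linear_map_closed: "x \<in> carrier A \<Longrightarrow> f x \<in> carrier B"
    and linear_map_add: "\<lbrakk>x \<in> carrier A; y \<in> carrier A\<rbrakk> \<Longrightarrow> f (x \<oplus>\<^bsub>A\<^esub> y) = f x \<oplus>\<^bsub>B\<^esub> f y"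
    and linear_map_smult: "\<lbrakk>c \<in> carrier K; x \<in> carrier A\<rbrakk> \<Longrightarrow> f (c \<odot>\<^bsub>A\<^esub> x) = c \<odot>\<^bsub>B\<^esub> f x"
  using assms unfolding linear_map_def by blast+

lemma linear_map_zero:
  assumes "module K A" "module K B" "linear_map K A B f"
  shows "f \<zero>\<^bsub>A\<^esub> = \<zero>\<^bsub>B\<^esub>"
proof -
  interpret A: module K A by fact
  interpret B: module K B by fact
  have "f \<zero>\<^bsub>A\<^esub> = f (\<zero>\<^bsub>K\<^esub> \<odot>\<^bsub>A\<^esub> \<zero>\<^bsub>A\<^esub>)" by simp
  also have "\<dots> = \<zero>\<^bsub>K\<^esub> \<odot>\<^bsub>B\<^esub> f \<zero>\<^bsub>A\<^esub>"
    by (rule linear_map_smult[OF assms(3)]) auto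
  also have "\<dots> = \<zero>\<^bsub>B\<^esub>" using linear_map_closed[OF assms(3)] by simp
  finally show ?thesis .
qed

lemma linear_map_minus:
  assumes "module K A" "module K B" "linear_map K A B f" "x \<in> carrier A" "y \<in> carrier A"
  shows "f (x \<ominus>\<^bsub>A\<^esub> y) = f x \<ominus>\<^bsub>B\<^esub> f y"
proof -
  interpret A: module K A by fact
  interpret B: module K B by fact
  note c = linear_map_closed[OF assms(3)]
  have "f (\<ominus>\<^bsub>A\<^esub> y) \<oplus>\<^bsub>B\<^esub> f y = \<zero>\<^bsub>B\<^esub>"
    using linear_map_add[OF assms(3), of "\<ominus>\<^bsub>A\<^esub> y" y] linear_map_zero[OF assms(1-3)] assms(5)
    by (simp add: A.M.l_neg)
  then have "f (\<ominus>\<^bsub>A\<^esub> y) = \<ominus>\<^bsub>B\<^esub> f y"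
    using c assms(5) by (metis A.M.a_inv_closed B.M.minus_equality)
  then show ?thesis
    using linear_map_add[OF assms(3), of x "\<ominus>\<^bsub>A\<^esub> y"] assms(4,5) by (simp add: a_minus_def)
qed

lemma linear_map_cong:
  assumes "\<And>x. x \<in> carrier A \<Longrightarrow> f x = g x" "module K A" "linear_map K A B g"
  shows "linear_map K A B f"
proof -
  interpret A: module K A by fact
  show ?thesis using assms(1,3) unfolding linear_map_def by auto
qed

lemma linear_map_comp:
  assumes "linear_map K B C g" "linear_map K A B f"
  shows "linear_map K A C (\<lambda>x. g (f x))"
  using assms unfolding linear_map_def by (auto simp: Pi_iff)

definition bilinear_map ::
  "('k, 'm) ring_scheme \<Rightarrow> ('k, 'a, 'n) module_scheme \<Rightarrow> ('k, 'b, 'p) module_scheme \<Rightarrow>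
   ('k, 'c, 'q) module_scheme \<Rightarrow> ('a \<Rightarrow> 'b \<Rightarrow> 'c) \<Rightarrow> bool"
  where "bilinear_map K A B M \<beta> \<longleftrightarrow>
    (\<forall>x\<in>carrier A. linear_map K B M (\<beta> x)) \<and> (\<forall>y\<in>carrier B. linear_map K A M (\<lambda>x. \<beta> x y))"

lemma bilinear_mapI:
  assumes "\<And>x. x \<in> carrier A \<Longrightarrow> linear_map K B M (\<beta> x)"
    and "\<And>y. y \<in> carrier B \<Longrightarrow> linear_map K A M (\<lambda>x. \<beta> x y)"
  shows "bilinear_map K A B M \<beta>"
  using assms unfolding bilinear_map_def by blast

lemma
  assumes "bilinear_map K A B M \<beta>"
  shows bilinear_map_right: "x \<in> carrier A \<Longrightarrow> linear_map K B M (\<beta> x)"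
    and bilinear_map_left: "y \<in> carrier B \<Longrightarrow> linear_map K A M (\<lambda>x. \<beta> x y)"
  using assms unfolding bilinear_map_def by blast+

lemma bilinear_map_closed:
  "\<lbrakk>bilinear_map K A B M \<beta>; x \<in> carrier A; y \<in> carrier B\<rbrakk> \<Longrightarrow> \<beta> x y \<in> carrier M"
  by (rule linear_map_closed[OF bilinear_map_right])

subsection \<open>Free modules\<close>

lemma mem_free_module:
  assumes "cring K"
  shows "f \<in> carrier (free_module K S) \<longleftrightarrow>
    (\<forall>s. f s \<in> carrier K) \<and> (\<forall>s. s \<notin> S \<longrightarrow> f s = \<zero>\<^bsub>K\<^esub>) \<and> finite {s. f s \<noteq> \<zero>\<^bsub>K\<^esub>}"
proof -
  interpret cring K by fact
  show ?thesis by (simp add: free_module_def) (metis zero_closed)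
qed

lemma free_module_simps:
  "\<zero>\<^bsub>free_module K S\<^esub> = (\<lambda>s. \<zero>\<^bsub>K\<^esub>)"
  "f \<oplus>\<^bsub>free_module K S\<^esub> g = (\<lambda>s. f s \<oplus>\<^bsub>K\<^esub> g s)"
  "c \<odot>\<^bsub>free_module K S\<^esub> f = (\<lambda>s. c \<otimes>\<^bsub>K\<^esub> f s)"
  by (simp_all add: free_module_def)

lemma module_free_module:
  assumes "cring K"
  shows "module K (free_module K S)"
proof -
  interpret cring K by fact
  note [simp] = mem_free_module[OF assms] free_module_simps
  have fin: "finite {s. f s \<oplus>\<^bsub>K\<^esub> g s \<noteq> \<zero>\<^bsub>K\<^esub>}"
    if "finite {s. f s \<noteq> \<zero>\<^bsub>K\<^esub>}" "finite {s. g s \<noteq> \<zero>\<^bsub>K\<^esub>}" for f g :: "'c \<Rightarrow> 'a"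
    by (rule finite_subset[OF _ finite_UnI[OF that]]) auto
  have fin': "finite {s. c \<otimes>\<^bsub>K\<^esub> f s \<noteq> \<zero>\<^bsub>K\<^esub>}"
    if "finite {s. f s \<noteq> \<zero>\<^bsub>K\<^esub>}" "c \<in> carrier K" for f :: "'c \<Rightarrow> 'a" and c
    by (rule finite_subset[OF _ that(1)]) (use that(2) in auto)
  show ?thesis
  proof (rule moduleI)
    show "abelian_group (free_module K S)"
    proof (rule abelian_groupI)
      fix f assume f: "f \<in> carrier (free_module K S)"
      have "finite {s. \<ominus>\<^bsub>K\<^esub> f s \<noteq> \<zero>\<^bsub>K\<^esub>}"
        by (rule finite_subset[of _ "{s. f s \<noteq> \<zero>\<^bsub>K\<^esub>}"]) (use f in auto)
      then show "\<exists>g\<in>carrier (free_module K S). g \<oplus>\<^bsub>free_module K S\<^esub> f = \<zero>\<^bsub>free_module K S\<^esub>"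
        using f by (intro bexI[of _ "\<lambda>s. \<ominus>\<^bsub>K\<^esub> f s"]) (auto simp: l_neg)
    qed (use fin in \<open>simp_all add: a_ac\<close>)
  qed (use fin' assms in \<open>simp_all add: l_distr r_distr m_assoc\<close>)
qed

lemma free_gen_closed:
  assumes "cring K" "s \<in> S"
  shows "free_gen K s \<in> carrier (free_module K S)"
proof -
  interpret cring K by fact
  have "finite {t. free_gen K s t \<noteq> \<zero>\<^bsub>K\<^esub>}"
    by (rule finite_subset[of _ "{s}"]) (auto simp: free_gen_def)
  then show ?thesis
    using assms(2) unfolding free_module_def by (auto simp: free_gen_def)
qed

text \<open>Induction on the finite support: the term at one support point \<open>s\<close> is split
  off, and setting \<open>f\<close> to zero at \<open>s\<close> shrinks the support.\<close>

lemma free_module_induct [consumes 2, case_names zero step]: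
  assumes "cring K" "f \<in> carrier (free_module K S)"
    and "P \<zero>\<^bsub>free_module K S\<^esub>"
    and "\<And>c s f. \<lbrakk>c \<in> carrier K; s \<in> S; f \<in> carrier (free_module K S); P f\<rbrakk> \<Longrightarrow>
      P (c \<odot>\<^bsub>free_module K S\<^esub> free_gen K s \<oplus>\<^bsub>free_module K S\<^esub> f)"
  shows "P f"
proof -
  let ?F = "free_module K S"
  interpret cring K by fact
  have "\<forall>f\<in>carrier ?F. {s. f s \<noteq> \<zero>\<^bsub>K\<^esub>} = T \<longrightarrow> P f" if "finite T" for T
    using that
  proof (induction T)
    case empty
    then show ?case
      using assms(3) by (auto simp: free_module_def fun_eq_iff elim!: back_subst[of P])
  next
    case (insert s T)
    show ?case
    proof (intro ballI impI)
      fix f assume f: "f \<in> carrier ?F" and T: "{s. f s \<noteq> \<zero>\<^bsub>K\<^esub>} = insert s T"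
      let ?g = "f(s := \<zero>\<^bsub>K\<^esub>)"
      have s: "s \<in> S" "f s \<in> carrier K" using f T by (auto simp: free_module_def)
      have T': "{s. ?g s \<noteq> \<zero>\<^bsub>K\<^esub>} = T" using T insert(2) by auto
      have g: "?g \<in> carrier ?F"
        using f insert(1) unfolding free_module_def by (auto simp: T'[simplified])
      have val: "f t \<in> carrier K" for t
        using f by (cases "t \<in> S") (auto simp: free_module_def)
      have "f = f s \<odot>\<^bsub>?F\<^esub> free_gen K s \<oplus>\<^bsub>?F\<^esub> ?g"
        using val by (auto simp: free_module_def free_gen_def fun_eq_iff)
      moreover have "P ?g" using insert(3) g T' by blast
      ultimately show "P f" using assms(4)[OF s(2) s(1) g] by simp
    qed
  qed
  moreover have "finite {s. f s \<noteq> \<zero>\<^bsub>K\<^esub>}" using assms(2) by (simp add: free_module_def)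
  ultimately show ?thesis using assms(2) by blast
qed

text \<open>The sum inside \<open>tensor_lift\<close> as a function of the chosen representative; on
  the free module it is the linear extension of \<phi>.\<close>

definition free_eval ::
  "('k, 'm) ring_scheme \<Rightarrow> ('k, 'c, 'q) module_scheme \<Rightarrow> ('s \<Rightarrow> 'c) \<Rightarrow> ('s \<Rightarrow> 'k) \<Rightarrow> 'c"
  where "free_eval K M \<phi> f = (\<Oplus>\<^bsub>M\<^esub>s\<in>{s. f s \<noteq> \<zero>\<^bsub>K\<^esub>}. f s \<odot>\<^bsub>M\<^esub> \<phi> s)"

context
  fixes K :: "('k, 'm) ring_scheme" and M :: "('k, 'c, 'q) module_scheme"
    and S :: "'s set" and \<phi> :: "'s \<Rightarrow> 'c"
  assumes M: "module K M" and \<phi>: "\<And>s. s \<in> S \<Longrightarrow> \<phi> s \<in> carrier M"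
begin

interpretation M: module K M by (rule M)

text \<open>The support of a sum may be smaller than the union of the supports, so additivity is
  proved with sums over a common finite set, where the extra terms vanish.\<close>

lemma free_eval_superset:
  assumes "f \<in> carrier (free_module K S)" "finite T" "{s. f s \<noteq> \<zero>\<^bsub>K\<^esub>} \<subseteq> T" "T \<subseteq> S"
  shows "free_eval K M \<phi> f = (\<Oplus>\<^bsub>M\<^esub>s\<in>T. f s \<odot>\<^bsub>M\<^esub> \<phi> s)"
  unfolding free_eval_def
proof (rule M.add.finprod_mono_neutral_cong_left)
  have val: "f s \<in> carrier K" for s
    using assms(1) unfolding mem_free_module[OF M.R.cring_axioms] by simp
  show "f s \<odot>\<^bsub>M\<^esub> \<phi> s = \<zero>\<^bsub>M\<^esub>" if "s \<in> T - {s. f s \<noteq> \<zero>\<^bsub>K\<^esub>}" for s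
    using that assms(4) \<phi>[of s] by auto
  show "(\<lambda>s. f s \<odot>\<^bsub>M\<^esub> \<phi> s) \<in> T \<rightarrow> carrier M"
    using val \<phi> assms(4) by blast
qed (use assms(2,3) in simp_all)

lemma free_eval_gen:
  assumes "s \<in> S"
  shows "free_eval K M \<phi> (free_gen K s) = \<phi> s"
proof -
  have "free_eval K M \<phi> (free_gen K s) = (\<Oplus>\<^bsub>M\<^esub>t\<in>{s}. free_gen K s t \<odot>\<^bsub>M\<^esub> \<phi> t)"
    by (rule free_eval_superset[OF free_gen_closed[OF M.R.cring_axioms assms]])
      (use assms in \<open>auto simp: free_gen_def\<close>)
  also have "\<dots> = \<phi> s"
    using \<phi>[OF assms] by (simp add: free_gen_def)
  finally show ?thesis .
qed

lemma linear_free_eval: "linear_map K (free_module K S) M (free_eval K M \<phi>)"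
proof -
  let ?F = "free_module K S"
  interpret F: module K "?F" by (rule module_free_module[OF M.R.cring_axioms])
  have sub: "finite {s. f s \<noteq> \<zero>\<^bsub>K\<^esub>}" "{s. f s \<noteq> \<zero>\<^bsub>K\<^esub>} \<subseteq> S" "\<And>s. f s \<in> carrier K"
    if "f \<in> carrier ?F" for f
    using that unfolding mem_free_module[OF M.R.cring_axioms] by (simp_all, blast)
  show ?thesis
  proof (rule linear_mapI)
    fix f assume f: "f \<in> carrier ?F"
    note sf = sub[OF f]
    show "free_eval K M \<phi> f \<in> carrier M"
      unfolding free_eval_def by (rule M.finsum_closed) (use sf \<phi> in auto)
    fix g assume g: "g \<in> carrier ?F"
    note sg = sub[OF g]
    let ?T = "{s. f s \<noteq> \<zero>\<^bsub>K\<^esub>} \<union> {s. g s \<noteq> \<zero>\<^bsub>K\<^esub>}"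
    have T: "finite ?T" "?T \<subseteq> S" using sf sg by auto
    have fg: "(f \<oplus>\<^bsub>?F\<^esub> g) s = f s \<oplus>\<^bsub>K\<^esub> g s" for s by (simp add: free_module_def)
    have "free_eval K M \<phi> (f \<oplus>\<^bsub>?F\<^esub> g) =
        (\<Oplus>\<^bsub>M\<^esub>s\<in>?T. (f \<oplus>\<^bsub>?F\<^esub> g) s \<odot>\<^bsub>M\<^esub> \<phi> s)"
      by (rule free_eval_superset) (use f g T fg in auto)
    also have "\<dots> = (\<Oplus>\<^bsub>M\<^esub>s\<in>?T. f s \<odot>\<^bsub>M\<^esub> \<phi> s \<oplus>\<^bsub>M\<^esub> g s \<odot>\<^bsub>M\<^esub> \<phi> s)"
    proof (rule M.finsum_cong')
      fix s assume "s \<in> ?T"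
      then have "s \<in> S" using T by blast
      then show "(f \<oplus>\<^bsub>?F\<^esub> g) s \<odot>\<^bsub>M\<^esub> \<phi> s = f s \<odot>\<^bsub>M\<^esub> \<phi> s \<oplus>\<^bsub>M\<^esub> g s \<odot>\<^bsub>M\<^esub> \<phi> s"
        using \<phi> sf sg by (simp add: fg M.smult_l_distr)
    qed (use T \<phi> sf sg in auto)
    also have "\<dots> = (\<Oplus>\<^bsub>M\<^esub>s\<in>?T. f s \<odot>\<^bsub>M\<^esub> \<phi> s) \<oplus>\<^bsub>M\<^esub> (\<Oplus>\<^bsub>M\<^esub>s\<in>?T. g s \<odot>\<^bsub>M\<^esub> \<phi> s)"
      by (rule M.finsum_addf) (use T \<phi> sf sg in auto)
    also have "\<dots> = free_eval K M \<phi> f \<oplus>\<^bsub>M\<^esub> free_eval K M \<phi> g"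
      using free_eval_superset[OF f T(1) _ T(2)] free_eval_superset[OF g T(1) _ T(2)] by auto
    finally show "free_eval K M \<phi> (f \<oplus>\<^bsub>?F\<^esub> g) = free_eval K M \<phi> f \<oplus>\<^bsub>M\<^esub> free_eval K M \<phi> g" .
  next
    fix c f assume c: "c \<in> carrier K" and f: "f \<in> carrier ?F"
    note sf = sub[OF f]
    have cf: "(c \<odot>\<^bsub>?F\<^esub> f) s = c \<otimes>\<^bsub>K\<^esub> f s" for s by (simp add: free_module_def)
    have "free_eval K M \<phi> (c \<odot>\<^bsub>?F\<^esub> f) =
        (\<Oplus>\<^bsub>M\<^esub>s\<in>{s. f s \<noteq> \<zero>\<^bsub>K\<^esub>}. (c \<odot>\<^bsub>?F\<^esub> f) s \<odot>\<^bsub>M\<^esub> \<phi> s)"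
      by (rule free_eval_superset) (use f c sf cf in auto)
    also have "\<dots> = (\<Oplus>\<^bsub>M\<^esub>s\<in>{s. f s \<noteq> \<zero>\<^bsub>K\<^esub>}. c \<odot>\<^bsub>M\<^esub> (f s \<odot>\<^bsub>M\<^esub> \<phi> s))"
    proof (rule M.finsum_cong')
      fix s assume "s \<in> {s. f s \<noteq> \<zero>\<^bsub>K\<^esub>}"
      then have "s \<in> S" using sf by blast
      then show "(c \<odot>\<^bsub>?F\<^esub> f) s \<odot>\<^bsub>M\<^esub> \<phi> s = c \<odot>\<^bsub>M\<^esub> (f s \<odot>\<^bsub>M\<^esub> \<phi> s)"
        using \<phi> sf c by (simp add: cf M.smult_assoc1)
    qed (use \<phi> sf c in auto)
    also have "\<dots> = c \<odot>\<^bsub>M\<^esub> free_eval K M \<phi> f"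
      unfolding free_eval_def by (rule M.finsum_smult_ldistr[symmetric]) (use c sf \<phi> in auto)
    finally show "free_eval K M \<phi> (c \<odot>\<^bsub>?F\<^esub> f) = c \<odot>\<^bsub>M\<^esub> free_eval K M \<phi> f" .
  qed
qed

end

subsection \<open>The tensor product of modules\<close>

context
  fixes K :: "('k, 'm) ring_scheme"
    and A :: "('k, 'a, 'n) module_scheme"
    and B :: "('k, 'b, 'p) module_scheme"
  assumes A: "module K A" and B: "module K B"
begin

interpretation A: module K A by (rule A)
interpretation B: module K B by (rule B)

lemma module_tensor_free: "module K (tensor_free K A B)"
  unfolding tensor_free_def by (rule module_free_module[OF A.R.cring_axioms])

interpretation F: module K "tensor_free K A B" by (rule module_tensor_free)

lemma tensor_gen_closed:
  "\<lbrakk>x \<in> carrier A; y \<in> carrier B\<rbrakk> \<Longrightarrow> free_gen K (x, y) \<in> carrier (tensor_free K A B)"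
  unfolding tensor_free_def by (rule free_gen_closed[OF A.R.cring_axioms]) simp

lemma tensor_relators_closed: "tensor_relators K A B \<subseteq> carrier (tensor_free K A B)"
  unfolding tensor_relators_def by (auto intro!: tensor_gen_closed F.M.minus_closed F.M.a_closed)

lemma tensor_relators_intros:
  "\<lbrakk>x \<in> carrier A; x' \<in> carrier A; y \<in> carrier B\<rbrakk> \<Longrightarrow>
    free_gen K (x \<oplus>\<^bsub>A\<^esub> x', y) \<ominus>\<^bsub>tensor_free K A B\<^esub>
      (free_gen K (x, y) \<oplus>\<^bsub>tensor_free K A B\<^esub> free_gen K (x', y)) \<in> tensor_relators K A B"
  "\<lbrakk>x \<in> carrier A; y \<in> carrier B; y' \<in> carrier B\<rbrakk> \<Longrightarrow>
    free_gen K (x, y \<oplus>\<^bsub>B\<^esub> y') \<ominus>\<^bsub>tensor_free K A B\<^esub>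
      (free_gen K (x, y) \<oplus>\<^bsub>tensor_free K A B\<^esub> free_gen K (x, y')) \<in> tensor_relators K A B"
  "\<lbrakk>c \<in> carrier K; x \<in> carrier A; y \<in> carrier B\<rbrakk> \<Longrightarrow>
    free_gen K (c \<odot>\<^bsub>A\<^esub> x, y) \<ominus>\<^bsub>tensor_free K A B\<^esub>
      (c \<odot>\<^bsub>tensor_free K A B\<^esub> free_gen K (x, y)) \<in> tensor_relators K A B"
  "\<lbrakk>c \<in> carrier K; x \<in> carrier A; y \<in> carrier B\<rbrakk> \<Longrightarrow>
    free_gen K (x, c \<odot>\<^bsub>B\<^esub> y) \<ominus>\<^bsub>tensor_free K A B\<^esub>
      (c \<odot>\<^bsub>tensor_free K A B\<^esub> free_gen K (x, y)) \<in> tensor_relators K A B"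
  unfolding tensor_relators_def
  by (rule UnI1, rule UnI1, rule UnI1, blast) (rule UnI1, rule UnI1, rule UnI2, blast,
    rule UnI1, rule UnI2, blast, rule UnI2, blast)

lemma submodule_tensor_null: "submodule (tensor_null K A B) K (tensor_free K A B)"
proof -
  let ?F = "tensor_free K A B"
  let ?N = "{N. submodule N K ?F \<and> tensor_relators K A B \<subseteq> N}"
  have ne: "carrier ?F \<in> ?N"
    using F.carrier_is_submodule tensor_relators_closed by simp
  show ?thesis
    unfolding tensor_null_def
  proof (rule F.submoduleI)
    show "\<Inter>?N \<subseteq> carrier ?F" using ne by blast
    show "\<zero>\<^bsub>?F\<^esub> \<in> \<Inter>?N"
    proof
      fix N assume N: "N \<in> ?N"
      \<comment> \<open>The closure rules for submodules provide nonemptiness rather than zero, so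
        zero is produced as the zero multiple of some element.\<close>
      then obtain x where x: "x \<in> N" "N \<subseteq> carrier ?F"
        using F.submoduleE(1,2) by blast
      then have "\<zero>\<^bsub>K\<^esub> \<odot>\<^bsub>?F\<^esub> x \<in> N"
        using N F.submoduleE(4)[of N "\<zero>\<^bsub>K\<^esub>" x] by auto
      then show "\<zero>\<^bsub>?F\<^esub> \<in> N" using x F.smult_l_null by auto
    qed
  qed (use F.submoduleE in auto)
qed

lemma tensor_relators_null: "tensor_relators K A B \<subseteq> tensor_null K A B"
  unfolding tensor_null_def by auto

lemma abelian_subgroup_tensor_null: "abelian_subgroup (tensor_null K A B) (tensor_free K A B)"
proof (rule abelian_subgroupI3)
  show "additive_subgroup (tensor_null K A B) (tensor_free K A B)"
    using submodule.axioms(1)[OF submodule_tensor_null] by (rule additive_subgroupI)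
qed (rule F.M.abelian_group_axioms)

interpretation N: abelian_subgroup "tensor_null K A B" "tensor_free K A B"
  by (rule abelian_subgroup_tensor_null)

lemma tensor_class_closed:
  "f \<in> carrier (tensor_free K A B) \<Longrightarrow> tensor_class K A B f \<in> carrier (tensor_module K A B)"
  unfolding tensor_class_def tensor_module_def
  by (simp add: F.M.a_rcosetsI N.a_subset)

lemma tensor_class_surj:
  assumes "X \<in> carrier (tensor_module K A B)"
  obtains f where "f \<in> carrier (tensor_free K A B)" "X = tensor_class K A B f"
  using assms unfolding tensor_class_def tensor_module_def by (auto simp: A_RCOSETS_def')

lemma tensor_class_self: "f \<in> carrier (tensor_free K A B) \<Longrightarrow> f \<in> tensor_class K A B f"
  unfolding tensor_class_def by (rule N.a_rcos_self)

lemma tensor_class_subset: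
  "f \<in> carrier (tensor_free K A B) \<Longrightarrow> tensor_class K A B f \<subseteq> carrier (tensor_free K A B)"
  unfolding tensor_class_def by (rule F.M.a_r_coset_subset_G) (rule N.a_subset)

lemma mem_tensor_class_iff:
  "\<lbrakk>f \<in> carrier (tensor_free K A B); g \<in> carrier (tensor_free K A B)\<rbrakk> \<Longrightarrow>
    g \<in> tensor_class K A B f \<longleftrightarrow> g \<ominus>\<^bsub>tensor_free K A B\<^esub> f \<in> tensor_null K A B"
  unfolding tensor_class_def a_minus_def by (rule N.a_rcos_module)

lemma tensor_class_eqI:
  assumes "f \<in> carrier (tensor_free K A B)" "g \<in> carrier (tensor_free K A B)"
    and "g \<ominus>\<^bsub>tensor_free K A B\<^esub> f \<in> tensor_null K A B"
  shows "tensor_class K A B g = tensor_class K A B f"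
proof -
  have "g \<in> tensor_class K A B f" using assms(3) mem_tensor_class_iff[OF assms(1,2)] by simp
  then show ?thesis
    unfolding tensor_class_def
    by (metis F.M.a_repr_independence N.a_subgroup assms(1))
qed

lemma tensor_class_add:
  "\<lbrakk>f \<in> carrier (tensor_free K A B); g \<in> carrier (tensor_free K A B)\<rbrakk> \<Longrightarrow>
    tensor_class K A B f \<oplus>\<^bsub>tensor_module K A B\<^esub> tensor_class K A B g =
    tensor_class K A B (f \<oplus>\<^bsub>tensor_free K A B\<^esub> g)"
  unfolding tensor_class_def tensor_module_def by (simp add: N.a_rcos_sum)

text \<open>The coset operation is a union of classes over all representatives. Two representatives
  differ by an element of the null submodule, which is closed under scalars, so all these classes
  coincide and the union is one of them.\<close>

lemma tensor_class_smult:
  assumes "c \<in> carrier K" "f \<in> carrier (tensor_free K A B)"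
  shows "c \<odot>\<^bsub>tensor_module K A B\<^esub> tensor_class K A B f =
    tensor_class K A B (c \<odot>\<^bsub>tensor_free K A B\<^esub> f)"
proof -
  let ?F = "tensor_free K A B" and ?cl = "tensor_class K A B" and ?N = "tensor_null K A B"
  have eq: "?cl (c \<odot>\<^bsub>?F\<^esub> g) = ?cl (c \<odot>\<^bsub>?F\<^esub> f)"
    if g: "g \<in> ?cl f" for g
  proof (rule tensor_class_eqI)
    have g': "g \<in> carrier ?F" using g tensor_class_subset assms by blast
    then have "g \<ominus>\<^bsub>?F\<^esub> f \<in> ?N"
      using g mem_tensor_class_iff[OF assms(2) g'] by simp
    then have "c \<odot>\<^bsub>?F\<^esub> (g \<ominus>\<^bsub>?F\<^esub> f) \<in> ?N"
      using assms F.submoduleE(4)[OF submodule_tensor_null] by blast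
    moreover have "c \<odot>\<^bsub>?F\<^esub> (g \<ominus>\<^bsub>?F\<^esub> f) =
      c \<odot>\<^bsub>?F\<^esub> g \<ominus>\<^bsub>?F\<^esub> c \<odot>\<^bsub>?F\<^esub> f"
      using assms g' by (simp add: a_minus_def F.smult_r_distr F.smult_r_minus)
    ultimately show "c \<odot>\<^bsub>?F\<^esub> g \<ominus>\<^bsub>?F\<^esub> c \<odot>\<^bsub>?F\<^esub> f \<in> ?N"
      by simp
    show "c \<odot>\<^bsub>?F\<^esub> g \<in> carrier ?F" using g' assms by simp
  qed (use assms in simp)
  have "(\<Union>g\<in>?cl f. ?cl (c \<odot>\<^bsub>?F\<^esub> g)) =
      ?cl (c \<odot>\<^bsub>?F\<^esub> f)"
    by (rule UN_constant_eq[OF tensor_class_self[OF assms(2)]], rule ballI) (rule eq)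
  then show ?thesis unfolding tensor_module_def by simp
qed

lemma tensor_class_zero: "\<zero>\<^bsub>tensor_module K A B\<^esub> = tensor_class K A B \<zero>\<^bsub>tensor_free K A B\<^esub>"
proof -
  have "tensor_null K A B +>\<^bsub>tensor_free K A B\<^esub> \<zero>\<^bsub>tensor_free K A B\<^esub> = tensor_null K A B"
    by (rule F.M.a_coset_add_zero) (rule N.a_subset)
  then show ?thesis unfolding tensor_class_def by (simp add: tensor_module_def)
qed

lemma module_tensor_module: "module K (tensor_module K A B)"
proof -
  note [simp] = tensor_class_add tensor_class_smult tensor_class_zero tensor_class_closed
  let ?T = "tensor_module K A B"
  show ?thesis
  proof (rule moduleI)
    show "abelian_group ?T"
    proof (rule abelian_groupI)
      fix X assume X: "X \<in> carrier ?T"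
      then obtain f where f: "f \<in> carrier (tensor_free K A B)" "X = tensor_class K A B f"
        by (rule tensor_class_surj)
      show "\<exists>Y\<in>carrier ?T. Y \<oplus>\<^bsub>?T\<^esub> X = \<zero>\<^bsub>?T\<^esub>"
        by (rule bexI[of _ "tensor_class K A B (\<ominus>\<^bsub>tensor_free K A B\<^esub> f)"])
          (use f in \<open>simp_all add: F.M.l_neg\<close>)
      show "\<zero>\<^bsub>?T\<^esub> \<oplus>\<^bsub>?T\<^esub> X = X" using f by simp
      fix Y assume Y: "Y \<in> carrier ?T"
      then obtain g where g: "g \<in> carrier (tensor_free K A B)" "Y = tensor_class K A B g"
        by (rule tensor_class_surj)
      show "X \<oplus>\<^bsub>?T\<^esub> Y \<in> carrier ?T" "X \<oplus>\<^bsub>?T\<^esub> Y = Y \<oplus>\<^bsub>?T\<^esub> X"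
        using f g by (simp_all add: F.M.a_comm)
      fix Z assume Z: "Z \<in> carrier ?T"
      then obtain h where h: "h \<in> carrier (tensor_free K A B)" "Z = tensor_class K A B h"
        by (rule tensor_class_surj)
      show "X \<oplus>\<^bsub>?T\<^esub> Y \<oplus>\<^bsub>?T\<^esub> Z = X \<oplus>\<^bsub>?T\<^esub> (Y \<oplus>\<^bsub>?T\<^esub> Z)"
        using f g h by (simp add: F.M.a_assoc)
    qed simp
  next
    fix a b X assume ab: "a \<in> carrier K" "b \<in> carrier K" and X: "X \<in> carrier ?T"
    then obtain f where f: "f \<in> carrier (tensor_free K A B)" "X = tensor_class K A B f"
      using tensor_class_surj by blast
    show "(a \<oplus>\<^bsub>K\<^esub> b) \<odot>\<^bsub>?T\<^esub> X = a \<odot>\<^bsub>?T\<^esub> X \<oplus>\<^bsub>?T\<^esub> b \<odot>\<^bsub>?T\<^esub> X"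
      "a \<otimes>\<^bsub>K\<^esub> b \<odot>\<^bsub>?T\<^esub> X = a \<odot>\<^bsub>?T\<^esub> (b \<odot>\<^bsub>?T\<^esub> X)"
      using ab f by (simp_all add: F.smult_l_distr F.smult_assoc1)
  next
    fix a X assume a: "a \<in> carrier K" and X: "X \<in> carrier ?T"
    then obtain f where f: "f \<in> carrier (tensor_free K A B)" "X = tensor_class K A B f"
      using tensor_class_surj by blast
    show "a \<odot>\<^bsub>?T\<^esub> X \<in> carrier ?T" using a f by simp
    fix Y assume "Y \<in> carrier ?T"
    then obtain g where g: "g \<in> carrier (tensor_free K A B)" "Y = tensor_class K A B g"
      by (rule tensor_class_surj)
    show "a \<odot>\<^bsub>?T\<^esub> (X \<oplus>\<^bsub>?T\<^esub> Y) = a \<odot>\<^bsub>?T\<^esub> X \<oplus>\<^bsub>?T\<^esub> a \<odot>\<^bsub>?T\<^esub> Y"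
      using a f g by (simp add: F.smult_r_distr)
  next
    fix X assume "X \<in> carrier ?T"
    then obtain f where f: "f \<in> carrier (tensor_free K A B)" "X = tensor_class K A B f"
      by (rule tensor_class_surj)
    show "\<one>\<^bsub>K\<^esub> \<odot>\<^bsub>?T\<^esub> X = X" using f by simp
  qed (rule A.R.cring_axioms)
qed

interpretation T: module K "tensor_module K A B" by (rule module_tensor_module)

lemma bilinear_tensor_module: "bilinear_map K A B (tensor_module K A B) (tensor K A B)"
proof -
  let ?F = "tensor_free K A B" and ?T = "tensor_module K A B" and ?cl = "tensor_class K A B"
  note cl = tensor_gen_closed
  have rel: "?cl f = ?cl g"
    if "f \<ominus>\<^bsub>?F\<^esub> g \<in> tensor_relators K A B"
      "f \<in> carrier ?F" "g \<in> carrier ?F" for f g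
    using that tensor_relators_null by (intro tensor_class_eqI) auto
  show ?thesis
  proof (intro bilinear_mapI linear_mapI; unfold tensor_def)
    fix x y y' assume xy: "x \<in> carrier A" "y \<in> carrier B" "y' \<in> carrier B"
    have "?cl (free_gen K (x, y \<oplus>\<^bsub>B\<^esub> y')) =
        ?cl (free_gen K (x, y) \<oplus>\<^bsub>?F\<^esub> free_gen K (x, y'))"
      by (rule rel) (use xy in \<open>simp_all add: tensor_relators_intros cl\<close>)
    then show "?cl (free_gen K (x, y \<oplus>\<^bsub>B\<^esub> y')) =
        ?cl (free_gen K (x, y)) \<oplus>\<^bsub>?T\<^esub> ?cl (free_gen K (x, y'))"
      using xy by (simp add: tensor_class_add cl)
  next
    fix x y c assume xy: "x \<in> carrier A" "y \<in> carrier B" "c \<in> carrier K"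
    have "?cl (free_gen K (x, c \<odot>\<^bsub>B\<^esub> y)) =
        ?cl (c \<odot>\<^bsub>?F\<^esub> free_gen K (x, y))"
      by (rule rel) (use xy in \<open>simp_all add: tensor_relators_intros cl\<close>)
    then show "?cl (free_gen K (x, c \<odot>\<^bsub>B\<^esub> y)) =
        c \<odot>\<^bsub>?T\<^esub> ?cl (free_gen K (x, y))"
      using xy by (simp add: tensor_class_smult cl)
    have "?cl (free_gen K (c \<odot>\<^bsub>A\<^esub> x, y)) =
        ?cl (c \<odot>\<^bsub>?F\<^esub> free_gen K (x, y))"
      by (rule rel) (use xy in \<open>simp_all add: tensor_relators_intros cl\<close>)
    then show "?cl (free_gen K (c \<odot>\<^bsub>A\<^esub> x, y)) =
        c \<odot>\<^bsub>?T\<^esub> ?cl (free_gen K (x, y))"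
      using xy by (simp add: tensor_class_smult cl)
  next
    fix y x x' assume xy: "x \<in> carrier A" "x' \<in> carrier A" "y \<in> carrier B"
    have "?cl (free_gen K (x \<oplus>\<^bsub>A\<^esub> x', y)) =
        ?cl (free_gen K (x, y) \<oplus>\<^bsub>?F\<^esub> free_gen K (x', y))"
      by (rule rel) (use xy in \<open>simp_all add: tensor_relators_intros cl\<close>)
    then show "?cl (free_gen K (x \<oplus>\<^bsub>A\<^esub> x', y)) =
        ?cl (free_gen K (x, y)) \<oplus>\<^bsub>?T\<^esub> ?cl (free_gen K (x', y))"
      using xy by (simp add: tensor_class_add cl)
  qed (simp_all add: tensor_class_closed cl)
qed

text \<open>A scalar coefficient can be absorbed into the left factor and zero is itself a pure
  tensor, so pure tensors and addition exhaust the module.\<close>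

lemma tensor_module_induct [consumes 1, case_names tensor add]:
  assumes "X \<in> carrier (tensor_module K A B)"
    and tensor: "\<And>x y. \<lbrakk>x \<in> carrier A; y \<in> carrier B\<rbrakk> \<Longrightarrow> P (tensor K A B x y)"
    and add: "\<And>X Y. \<lbrakk>X \<in> carrier (tensor_module K A B); Y \<in> carrier (tensor_module K A B); P X; P Y\<rbrakk> \<Longrightarrow>
      P (X \<oplus>\<^bsub>tensor_module K A B\<^esub> Y)"
  shows "P X"
proof -
  let ?F = "tensor_free K A B" and ?T = "tensor_module K A B" and ?cl = "tensor_class K A B"
  have t: "tensor K A B (c \<odot>\<^bsub>A\<^esub> x) y = c \<odot>\<^bsub>?T\<^esub> tensor K A B x y"
    if "c \<in> carrier K" "x \<in> carrier A" "y \<in> carrier B" for c x y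
    using linear_map_smult[OF bilinear_map_left[OF bilinear_tensor_module]] that by blast
  obtain f where f: "f \<in> carrier ?F" "X = ?cl f"
    using tensor_class_surj assms(1) by blast
  have "P (?cl f)"
    using A.R.cring_axioms f(1)[unfolded tensor_free_def]
  proof (induction f rule: free_module_induct)
    case zero
    have "tensor K A B (\<zero>\<^bsub>K\<^esub> \<odot>\<^bsub>A\<^esub> \<zero>\<^bsub>A\<^esub>) \<zero>\<^bsub>B\<^esub> = \<zero>\<^bsub>?T\<^esub>"
      using bilinear_map_closed[OF bilinear_tensor_module] by (subst t) auto
    then show ?case
      using tensor[of "\<zero>\<^bsub>K\<^esub> \<odot>\<^bsub>A\<^esub> \<zero>\<^bsub>A\<^esub>" "\<zero>\<^bsub>B\<^esub>"] by (simp add: tensor_class_zero tensor_free_def)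
  next
    case (step c s f)
    obtain x y where s: "s = (x, y)" "x \<in> carrier A" "y \<in> carrier B" using step(2) by auto
    have "?cl (c \<odot>\<^bsub>?F\<^esub> free_gen K s \<oplus>\<^bsub>?F\<^esub> f) =
        tensor K A B (c \<odot>\<^bsub>A\<^esub> x) y \<oplus>\<^bsub>?T\<^esub> ?cl f"
      using step(1,3) s tensor_gen_closed[OF s(2,3)]
      by (simp add: t tensor_free_def[symmetric])
        (simp add: tensor_def tensor_class_add tensor_class_smult)
    moreover have "P \<dots>"
      by (rule add) (use step s tensor bilinear_map_closed[OF bilinear_tensor_module] in
          \<open>auto simp: tensor_free_def intro!: tensor_class_closed\<close>)
    ultimately show ?case by (simp add: tensor_free_def)
  qed
  then show ?thesis using f by simp
qed

text \<open>The kernel of \<phi> is a submodule containing the relators, and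
  \<open>tensor_null\<close> is the smallest such submodule.\<close>

lemma tensor_null_zero:
  assumes M: "module K M" and lin: "linear_map K (tensor_free K A B) M \<phi>"
    and rel: "\<And>f. f \<in> tensor_relators K A B \<Longrightarrow> \<phi> f = \<zero>\<^bsub>M\<^esub>"
    and f: "f \<in> tensor_null K A B"
  shows "\<phi> f = \<zero>\<^bsub>M\<^esub>"
proof -
  let ?F = "tensor_free K A B"
  interpret M: module K M by (rule M)
  have minus: "\<phi> (\<ominus>\<^bsub>?F\<^esub> f) = \<zero>\<^bsub>M\<^esub>"
    if "f \<in> carrier ?F" "\<phi> f = \<zero>\<^bsub>M\<^esub>" for f
    using linear_map_minus[OF module_tensor_free M lin, of "\<zero>\<^bsub>?F\<^esub>" f]
      linear_map_zero[OF module_tensor_free M lin] that by (simp add: a_minus_def)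
  have "submodule {f \<in> carrier ?F. \<phi> f = \<zero>\<^bsub>M\<^esub>} K ?F"
    by (rule F.submoduleI)
      (auto simp: linear_map_add[OF lin] linear_map_smult[OF lin] minus
        linear_map_zero[OF module_tensor_free M lin])
  then show ?thesis
    using f rel tensor_relators_closed unfolding tensor_null_def by blast
qed

context
  fixes M :: "('k, 'c, 'q) module_scheme" and \<beta> :: "'a \<Rightarrow> 'b \<Rightarrow> 'c"
  assumes M: "module K M" and \<beta>: "bilinear_map K A B M \<beta>"
begin

interpretation M: module K M by (rule M)

text \<open>\<open>tensor_lift\<close> evaluates a representative picked by \<open>SOME\<close>.
  Representatives differ by a null element, and for bilinear \<beta> the evaluation kills every
  relator, so the choice does not affect the value.\<close>

lemma tensor_lift_class:
  assumes "f \<in> carrier (tensor_free K A B)"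
  shows "tensor_lift K M \<beta> (tensor_class K A B f) = free_eval K M (\<lambda>s. \<beta> (fst s) (snd s)) f"
proof -
  let ?F = "tensor_free K A B" and ?cl = "tensor_class K A B"
  let ?e = "free_eval K M (\<lambda>s. \<beta> (fst s) (snd s))"
  have lin: "linear_map K ?F M ?e"
    unfolding tensor_free_def
    by (rule linear_free_eval[OF M]) (auto simp: bilinear_map_closed[OF \<beta>])
  have gen: "?e (free_gen K (x, y)) = \<beta> x y" if "x \<in> carrier A" "y \<in> carrier B" for x y
  proof -
    have "?e (free_gen K (x, y)) = \<beta> (fst (x, y)) (snd (x, y))"
      by (rule free_eval_gen[OF M, where S = "carrier A \<times> carrier B" and s = "(x, y)"
            and \<phi> = "\<lambda>s. \<beta> (fst s) (snd s)"])
        (auto simp: that bilinear_map_closed[OF \<beta>])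
    then show ?thesis by simp
  qed
  note sm = linear_map_minus[OF module_tensor_free M lin] linear_map_add[OF lin] linear_map_smult[OF lin]
  note bs = linear_map_add[OF bilinear_map_left[OF \<beta>]] linear_map_add[OF bilinear_map_right[OF \<beta>]]
    linear_map_smult[OF bilinear_map_left[OF \<beta>]] linear_map_smult[OF bilinear_map_right[OF \<beta>]]
  have rel: "?e g = \<zero>\<^bsub>M\<^esub>" if "g \<in> tensor_relators K A B" for g
    using that unfolding tensor_relators_def
    by (elim UnE CollectE exE conjE)
      (simp_all add: bilinear_map_closed[OF \<beta>] tensor_gen_closed sm gen bs M.M.r_neg a_minus_def[of M])
  define g where "g = (SOME g. g \<in> ?cl f)"
  have g: "g \<in> ?cl f"
    unfolding g_def by (rule someI[of "\<lambda>g. g \<in> ?cl f"]) (rule tensor_class_self[OF assms])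
  then have gF: "g \<in> carrier ?F" using tensor_class_subset[OF assms] by blast
  have "?e (g \<ominus>\<^bsub>?F\<^esub> f) = \<zero>\<^bsub>M\<^esub>"
    using tensor_null_zero[OF M lin rel] g mem_tensor_class_iff[OF assms gF] by simp
  then have "?e g = ?e f"
    using linear_map_closed[OF lin gF] linear_map_closed[OF lin assms] gF assms
      M.M.minus_equality[of "?e g" "\<ominus>\<^bsub>M\<^esub> ?e f"]
    by (simp add: sm a_minus_def[of M])
  moreover have "tensor_lift K M \<beta> (?cl f) = ?e g"
    unfolding tensor_lift_def free_eval_def g_def Let_def ..
  ultimately show ?thesis by simp
qed

lemma linear_tensor_lift_module: "linear_map K (tensor_module K A B) M (tensor_lift K M \<beta>)"
proof -
  let ?F = "tensor_free K A B" and ?T = "tensor_module K A B" and ?cl = "tensor_class K A B"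
  let ?e = "free_eval K M (\<lambda>s. \<beta> (fst s) (snd s))"
  have lin: "linear_map K ?F M ?e"
    unfolding tensor_free_def
    by (rule linear_free_eval[OF M]) (use bilinear_map_closed[OF \<beta>] in auto)
  show ?thesis
  proof (rule linear_mapI)
    fix X assume "X \<in> carrier ?T"
    then obtain f where f: "f \<in> carrier ?F" "X = ?cl f"
      by (rule tensor_class_surj)
    show "tensor_lift K M \<beta> X \<in> carrier M"
      using f linear_map_closed[OF lin] by (simp add: tensor_lift_class)
    fix Y assume "Y \<in> carrier ?T"
    then obtain g where g: "g \<in> carrier ?F" "Y = ?cl g"
      by (rule tensor_class_surj)
    show "tensor_lift K M \<beta> (X \<oplus>\<^bsub>?T\<^esub> Y) =
        tensor_lift K M \<beta> X \<oplus>\<^bsub>M\<^esub> tensor_lift K M \<beta> Y"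
      using f g linear_map_add[OF lin] by (simp add: tensor_lift_class tensor_class_add)
  next
    fix c X assume c: "c \<in> carrier K" and "X \<in> carrier ?T"
    then obtain f where f: "f \<in> carrier ?F" "X = ?cl f"
      using tensor_class_surj by blast
    show "tensor_lift K M \<beta> (c \<odot>\<^bsub>?T\<^esub> X) = c \<odot>\<^bsub>M\<^esub> tensor_lift K M \<beta> X"
      using c f linear_map_smult[OF lin] by (simp add: tensor_lift_class tensor_class_smult)
  qed
qed

lemma tensor_lift_tensor:
  assumes "x \<in> carrier A" "y \<in> carrier B"
  shows "tensor_lift K M \<beta> (tensor K A B x y) = \<beta> x y"
proof -
  have "free_eval K M (\<lambda>s. \<beta> (fst s) (snd s)) (free_gen K (x, y)) = \<beta> (fst (x, y)) (snd (x, y))"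
    by (rule free_eval_gen[OF M, where S = "carrier A \<times> carrier B" and s = "(x, y)"
          and \<phi> = "\<lambda>s. \<beta> (fst s) (snd s)"])
      (auto simp: assms bilinear_map_closed[OF \<beta>])
  then show ?thesis
    unfolding tensor_def using assms by (simp add: tensor_lift_class tensor_gen_closed)
qed

end

end

section \<open>Tensor products with their multiplication: linear structure and maps out of
  them\<close>

lemma tensor_algebra_simps:
  "carrier (tensor_algebra K A B) = carrier (tensor_module K A B)"
  "\<zero>\<^bsub>tensor_algebra K A B\<^esub> = \<zero>\<^bsub>tensor_module K A B\<^esub>"
  "X \<oplus>\<^bsub>tensor_algebra K A B\<^esub> Y = X \<oplus>\<^bsub>tensor_module K A B\<^esub> Y"
  "c \<odot>\<^bsub>tensor_algebra K A B\<^esub> X = c \<odot>\<^bsub>tensor_module K A B\<^esub> X"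
  "\<one>\<^bsub>tensor_algebra K A B\<^esub> = tensor K A B \<one>\<^bsub>A\<^esub> \<one>\<^bsub>B\<^esub>"
  by (simp_all add: tensor_algebra_def)

lemma linear_map_tensor_algebra_simps:
  "linear_map K (tensor_algebra K A B) M f \<longleftrightarrow> linear_map K (tensor_module K A B) M f"
  "linear_map K M (tensor_algebra K A B) g \<longleftrightarrow> linear_map K M (tensor_module K A B) g"
  by (simp_all add: linear_map_def tensor_algebra_simps)

lemma module_tensor_algebra:
  assumes "module K A" "module K B"
  shows "module K (tensor_algebra K A B)"
proof -
  let ?T = "tensor_algebra K A B" and ?M = "tensor_module K A B"
  interpret T: module K "?M" by (rule module_tensor_module[OF assms])
  show ?thesis
  proof (rule moduleI)
    show "abelian_group ?T"
    proof (rule abelian_groupI)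
      fix X assume "X \<in> carrier ?T"
      then show "\<exists>Y\<in>carrier ?T. Y \<oplus>\<^bsub>?T\<^esub> X = \<zero>\<^bsub>?T\<^esub>"
        by (intro bexI[of _ "\<ominus>\<^bsub>?M\<^esub> X"]) (simp_all add: tensor_algebra_simps T.M.l_neg)
    qed (simp_all add: tensor_algebra_simps T.M.a_ac)
  qed (simp_all add: tensor_algebra_simps T.smult_l_distr T.smult_r_distr T.smult_assoc1 T.R.cring_axioms)
qed

context
  fixes K :: "('k, 'm) ring_scheme"
    and A :: "('k, 'a, 'n) module_scheme"
    and B :: "('k, 'b, 'p) module_scheme"
  assumes A: "module K A" and B: "module K B"
begin

interpretation A: module K A by (rule A)
interpretation B: module K B by (rule B)
interpretation T: module K "tensor_algebra K A B" by (rule module_tensor_algebra[OF A B])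

lemma tensor_induct [consumes 1, case_names tensor add]:
  assumes "X \<in> carrier (tensor_algebra K A B)"
    and "\<And>x y. \<lbrakk>x \<in> carrier A; y \<in> carrier B\<rbrakk> \<Longrightarrow> P (tensor K A B x y)"
    and "\<And>X Y. \<lbrakk>X \<in> carrier (tensor_algebra K A B); Y \<in> carrier (tensor_algebra K A B); P X; P Y\<rbrakk> \<Longrightarrow>
      P (X \<oplus>\<^bsub>tensor_algebra K A B\<^esub> Y)"
  shows "P X"
  using tensor_module_induct[OF A B, of X P] assms by (simp add: tensor_algebra_simps)

lemma bilinear_map_tensor: "bilinear_map K A B (tensor_algebra K A B) (tensor K A B)"
  using bilinear_tensor_module[OF A B] by (simp add: bilinear_map_def linear_map_tensor_algebra_simps)

lemma tensor_closed:
  "\<lbrakk>x \<in> carrier A; y \<in> carrier B\<rbrakk> \<Longrightarrow> tensor K A B x y \<in> carrier (tensor_algebra K A B)"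
  by (rule bilinear_map_closed[OF bilinear_map_tensor])

lemma linear_map_tensor_left:
  "\<lbrakk>linear_map K C A f; y \<in> carrier B\<rbrakk> \<Longrightarrow> linear_map K C (tensor_algebra K A B) (\<lambda>x. tensor K A B (f x) y)"
  by (rule linear_map_comp[OF bilinear_map_left[OF bilinear_map_tensor]])

lemma linear_map_tensor_right:
  "\<lbrakk>linear_map K C B f; x \<in> carrier A\<rbrakk> \<Longrightarrow> linear_map K C (tensor_algebra K A B) (\<lambda>y. tensor K A B x (f y))"
  by (rule linear_map_comp[OF bilinear_map_right[OF bilinear_map_tensor]])

lemma linear_map_tensor_eqI:
  assumes "linear_map K (tensor_algebra K A B) M f" "linear_map K (tensor_algebra K A B) M g"
    and "\<And>x y. \<lbrakk>x \<in> carrier A; y \<in> carrier B\<rbrakk> \<Longrightarrow> f (tensor K A B x y) = g (tensor K A B x y)"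
    and "X \<in> carrier (tensor_algebra K A B)"
  shows "f X = g X"
  using assms(4)
  by (induction X rule: tensor_induct)
    (simp_all add: assms(3) linear_map_add[OF assms(1)] linear_map_add[OF assms(2)])

context
  fixes M :: "('k, 'c, 'q) module_scheme" and \<beta> :: "'a \<Rightarrow> 'b \<Rightarrow> 'c"
  assumes M: "module K M" and \<beta>: "bilinear_map K A B M \<beta>"
begin

lemma linear_tensor_lift: "linear_map K (tensor_algebra K A B) M (tensor_lift K M \<beta>)"
  unfolding linear_map_tensor_algebra_simps by (rule linear_tensor_lift_module[OF A B M \<beta>])

text \<open>Agreement on the carriers makes \<open>\<beta>'\<close> bilinear as well, so both lifts
  are linear and can be compared on pure tensors. This is what permits rewriting under a Sweedler
  sum.\<close>

lemma tensor_lift_cong: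
  assumes "X \<in> carrier (tensor_algebra K A B)"
    and eq: "\<And>x y. \<lbrakk>x \<in> carrier A; y \<in> carrier B\<rbrakk> \<Longrightarrow> \<beta>' x y = \<beta> x y"
  shows "tensor_lift K M \<beta>' X = tensor_lift K M \<beta> X"
proof -
  have \<beta>': "bilinear_map K A B M \<beta>'"
    using \<beta> eq A B unfolding bilinear_map_def by (auto intro: linear_map_cong)
  show ?thesis
    by (rule linear_map_tensor_eqI[OF _ linear_tensor_lift _ assms(1)])
      (simp_all add: linear_map_tensor_algebra_simps linear_tensor_lift_module[OF A B M \<beta>']
        tensor_lift_tensor[OF A B M \<beta>'] tensor_lift_tensor[OF A B M \<beta>] eq)
qed

text \<open>The rule by which linear maps, such as multiplication by a constant or an algebra
  homomorphism, pass inside Sweedler sums.\<close>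

lemma linear_map_tensor_lift:
  assumes "module K N" and \<phi>: "linear_map K M N \<phi>" and "X \<in> carrier (tensor_algebra K A B)"
  shows "\<phi> (tensor_lift K M \<beta> X) = tensor_lift K N (\<lambda>x y. \<phi> (\<beta> x y)) X"
proof -
  have b: "bilinear_map K A B N (\<lambda>x y. \<phi> (\<beta> x y))"
    using linear_map_comp[OF \<phi> bilinear_map_left[OF \<beta>]] linear_map_comp[OF \<phi> bilinear_map_right[OF \<beta>]]
    by (rule bilinear_mapI[rotated])
  show ?thesis
    by (rule linear_map_tensor_eqI[OF linear_map_comp[OF \<phi> linear_tensor_lift] _ _ assms(3)])
      (simp_all add: linear_map_tensor_algebra_simps linear_tensor_lift_module[OF A B assms(1) b]
        tensor_lift_tensor[OF A B assms(1) b] tensor_lift_tensor[OF A B M \<beta>])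
qed

end

lemma linear_map_sum:
  assumes "module K M" "module K C" and f: "linear_map K C M f" and g: "linear_map K C M g"
  shows "linear_map K C M (\<lambda>x. f x \<oplus>\<^bsub>M\<^esub> g x)"
proof -
  interpret M: module K M by fact
  interpret C: module K C by fact
  show ?thesis
    by (rule linear_mapI) (simp_all add: linear_map_closed[OF f] linear_map_closed[OF g]
        linear_map_add[OF f] linear_map_add[OF g] linear_map_smult[OF f] linear_map_smult[OF g]
        M.smult_r_distr M.M.a_ac)
qed

text \<open>Linear dependence on a parameter, the source of bilinearity for nested lifts. By
  induction on \<open>X\<close>: at a pure tensor the lift is a value of the form, and at a sum it
  is a sum of linear maps.\<close>

lemma linear_tensor_lift_param:
  assumes M: "module K M" and C: "module K C"
    and \<beta>: "\<And>z. z \<in> carrier C \<Longrightarrow> bilinear_map K A B M (\<beta> z)"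
    and lin: "\<And>x y. \<lbrakk>x \<in> carrier A; y \<in> carrier B\<rbrakk> \<Longrightarrow> linear_map K C M (\<lambda>z. \<beta> z x y)"
    and X: "X \<in> carrier (tensor_algebra K A B)"
  shows "linear_map K C M (\<lambda>z. tensor_lift K M (\<beta> z) X)"
  using X
proof (induction X rule: tensor_induct)
  case (tensor x y)
  show ?case
    by (rule linear_map_cong[OF _ C lin[OF tensor]]) (rule tensor_lift_tensor[OF A B M \<beta> tensor])
next
  case (add X Y)
  show ?case
    by (rule linear_map_cong[OF _ C linear_map_sum[OF M C add(3,4)]])
      (rule linear_map_add[OF linear_tensor_lift[OF M \<beta>] add(1,2)])
qed

end

section \<open>The tensor product of commutative algebras\<close>

lemma (in algebra) smult_assoc_right:
  "\<lbrakk>a \<in> carrier R; x \<in> carrier M; y \<in> carrier M\<rbrakk> \<Longrightarrow> x \<otimes>\<^bsub>M\<^esub> (a \<odot>\<^bsub>M\<^esub> y) = a \<odot>\<^bsub>M\<^esub> (x \<otimes>\<^bsub>M\<^esub> y)"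
  using smult_assoc2[of a y x] by (simp add: m_comm)

lemma linear_map_mult_left:
  assumes "algebra K R" and f: "linear_map K C R f" and y: "y \<in> carrier R"
  shows "linear_map K C R (\<lambda>x. f x \<otimes>\<^bsub>R\<^esub> y)"
proof -
  interpret R: algebra K R by fact
  show ?thesis
    by (rule linear_mapI) (simp_all add: linear_map_closed[OF f] linear_map_add[OF f]
        linear_map_smult[OF f] y R.l_distr R.smult_assoc2)
qed

lemma linear_map_mult_right:
  assumes "algebra K R" and f: "linear_map K C R f" and y: "y \<in> carrier R"
  shows "linear_map K C R (\<lambda>x. y \<otimes>\<^bsub>R\<^esub> f x)"
proof -
  interpret R: algebra K R by fact
  show ?thesis
    by (rule linear_mapI) (simp_all add: linear_map_closed[OF f] linear_map_add[OF f]
        linear_map_smult[OF f] y R.r_distr R.smult_assoc_right)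
qed

lemma linear_map_id: "linear_map K A A (\<lambda>x. x)"
  by (rule linear_mapI) simp_all

lemma bilinear_map_mult:
  assumes "algebra K R" "linear_map K A R f" "linear_map K B R g"
  shows "bilinear_map K A B R (\<lambda>x y. f x \<otimes>\<^bsub>R\<^esub> g y)"
  using linear_map_mult_left[OF assms(1,2)] linear_map_mult_right[OF assms(1,3)]
    linear_map_closed[OF assms(2)] linear_map_closed[OF assms(3)]
  by (intro bilinear_mapI) auto

context
  fixes K :: "('k, 'm) ring_scheme"
    and A :: "('k, 'a, 'n) module_scheme"
    and B :: "('k, 'b, 'p) module_scheme"
  assumes A: "algebra K A" and B: "algebra K B"
begin

interpretation A: algebra K A by (rule A)
interpretation B: algebra K B by (rule B)
interpretation T: module K "tensor_algebra K A B"
  by (rule module_tensor_algebra[OF A.module_axioms B.module_axioms])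

lemma bilinear_mult_tensor:
  assumes "x \<in> carrier A" "y \<in> carrier B"
  shows "bilinear_map K A B (tensor_algebra K A B)
    (\<lambda>x' y'. tensor K A B (x \<otimes>\<^bsub>A\<^esub> x') (y \<otimes>\<^bsub>B\<^esub> y'))"
  using assms
  by (intro bilinear_mapI linear_map_tensor_right[OF A.module_axioms B.module_axioms]
      linear_map_tensor_left[OF A.module_axioms B.module_axioms]
      linear_map_mult_right[OF A] linear_map_mult_right[OF B] linear_map_id) auto

text \<open>The product of \<open>tensor_algebra\<close> is defined by lifting into
  \<open>tensor_module\<close>, because the algebra record does not exist yet at that point. Finite
  sums see only carrier, addition and zero, which the two records share.\<close>

lemma tensor_lift_tensor_module:
  fixes \<beta> :: "'c \<Rightarrow> 'd \<Rightarrow> _"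
  shows "tensor_lift K (tensor_module K A B) \<beta> X = tensor_lift K (tensor_algebra K A B) \<beta> X"
proof -
  have "finsum (tensor_module K A B) f S = finsum (tensor_algebra K A B) f S"
    for f :: "'c \<times> 'd \<Rightarrow> _" and S
    by (simp add: finsum_def tensor_algebra_def finprod_def)
  then show ?thesis
    unfolding tensor_lift_def by (simp add: tensor_algebra_simps)
qed

lemma tensor_algebra_mult:
  "X \<otimes>\<^bsub>tensor_algebra K A B\<^esub> Y =
    tensor_lift K (tensor_algebra K A B) (\<lambda>x y.
      tensor_lift K (tensor_algebra K A B) (\<lambda>x' y'. tensor K A B (x \<otimes>\<^bsub>A\<^esub> x') (y \<otimes>\<^bsub>B\<^esub> y')) Y) X"
  unfolding tensor_lift_tensor_module[symmetric] by (simp add: tensor_algebra_def)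

lemma bilinear_lift_mult_tensor:
  assumes Y: "Y \<in> carrier (tensor_algebra K A B)"
  shows "bilinear_map K A B (tensor_algebra K A B) (\<lambda>x y.
    tensor_lift K (tensor_algebra K A B) (\<lambda>x' y'. tensor K A B (x \<otimes>\<^bsub>A\<^esub> x') (y \<otimes>\<^bsub>B\<^esub> y')) Y)"
proof (rule bilinear_mapI)
  fix x assume x: "x \<in> carrier A"
  show "linear_map K B (tensor_algebra K A B) (\<lambda>y.
    tensor_lift K (tensor_algebra K A B) (\<lambda>x' y'. tensor K A B (x \<otimes>\<^bsub>A\<^esub> x') (y \<otimes>\<^bsub>B\<^esub> y')) Y)"
    using x by (intro linear_tensor_lift_param[OF A.module_axioms B.module_axioms T.module_axioms B.module_axioms _ _ Y]
        bilinear_mult_tensor linear_map_tensor_right[OF A.module_axioms B.module_axioms]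
        linear_map_mult_left[OF B] linear_map_id) auto
next
  fix y assume y: "y \<in> carrier B"
  show "linear_map K A (tensor_algebra K A B) (\<lambda>x.
    tensor_lift K (tensor_algebra K A B) (\<lambda>x' y'. tensor K A B (x \<otimes>\<^bsub>A\<^esub> x') (y \<otimes>\<^bsub>B\<^esub> y')) Y)"
    using y by (intro linear_tensor_lift_param[OF A.module_axioms B.module_axioms T.module_axioms A.module_axioms _ _ Y]
        bilinear_mult_tensor linear_map_tensor_left[OF A.module_axioms B.module_axioms]
        linear_map_mult_left[OF A] linear_map_id) auto
qed

lemma bilinear_tensor_mult:
  "bilinear_map K (tensor_algebra K A B) (tensor_algebra K A B) (tensor_algebra K A B)
    (\<lambda>X Y. X \<otimes>\<^bsub>tensor_algebra K A B\<^esub> Y)"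
proof (rule bilinear_mapI)
  fix Y assume Y: "Y \<in> carrier (tensor_algebra K A B)"
  show "linear_map K (tensor_algebra K A B) (tensor_algebra K A B) (\<lambda>X. X \<otimes>\<^bsub>tensor_algebra K A B\<^esub> Y)"
    unfolding tensor_algebra_mult
    by (rule linear_tensor_lift[OF A.module_axioms B.module_axioms T.module_axioms bilinear_lift_mult_tensor[OF Y]])
next
  fix X assume X: "X \<in> carrier (tensor_algebra K A B)"
  show "linear_map K (tensor_algebra K A B) (tensor_algebra K A B) (\<lambda>Y. X \<otimes>\<^bsub>tensor_algebra K A B\<^esub> Y)"
    unfolding tensor_algebra_mult
    by (intro linear_tensor_lift_param[OF A.module_axioms B.module_axioms T.module_axioms T.module_axioms _ _ X]
        bilinear_lift_mult_tensor linear_tensor_lift[OF A.module_axioms B.module_axioms T.module_axioms]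
        bilinear_mult_tensor)
qed

lemma tensor_mult:
  "\<lbrakk>x \<in> carrier A; y \<in> carrier B; x' \<in> carrier A; y' \<in> carrier B\<rbrakk> \<Longrightarrow>
    tensor K A B x y \<otimes>\<^bsub>tensor_algebra K A B\<^esub> tensor K A B x' y' = tensor K A B (x \<otimes>\<^bsub>A\<^esub> x') (y \<otimes>\<^bsub>B\<^esub> y')"
  unfolding tensor_algebra_mult
  by (simp add: tensor_lift_tensor[OF A.module_axioms B.module_axioms T.module_axioms]
      bilinear_lift_mult_tensor bilinear_mult_tensor
      tensor_closed[OF A.module_axioms B.module_axioms])

text \<open>The product is bilinear, so every identity is additive in each variable; nested
  induction reduces it to pure tensors, where it holds factor by factor.\<close>

lemma algebra_tensor_algebra: "algebra K (tensor_algebra K A B)"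
proof -
  let ?T = "tensor_algebra K A B"
  note ind = tensor_induct[OF A.module_axioms B.module_axioms, consumes 1, case_names tensor add]
  note lin = bilinear_map_left[OF bilinear_tensor_mult] bilinear_map_right[OF bilinear_tensor_mult]
  note cl = bilinear_map_closed[OF bilinear_tensor_mult]
  note tcl = tensor_closed[OF A.module_axioms B.module_axioms]
  have ldist: "(X \<oplus>\<^bsub>?T\<^esub> Y) \<otimes>\<^bsub>?T\<^esub> Z = X \<otimes>\<^bsub>?T\<^esub> Z \<oplus>\<^bsub>?T\<^esub> Y \<otimes>\<^bsub>?T\<^esub> Z"
    if "X \<in> carrier ?T" "Y \<in> carrier ?T" "Z \<in> carrier ?T" for X Y Z
    using linear_map_add[OF lin(1)] that by blast
  have rdist: "Z \<otimes>\<^bsub>?T\<^esub> (X \<oplus>\<^bsub>?T\<^esub> Y) = Z \<otimes>\<^bsub>?T\<^esub> X \<oplus>\<^bsub>?T\<^esub> Z \<otimes>\<^bsub>?T\<^esub> Y"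
    if "X \<in> carrier ?T" "Y \<in> carrier ?T" "Z \<in> carrier ?T" for X Y Z
    using linear_map_add[OF lin(2)] that by blast
  have assoc: "X \<otimes>\<^bsub>?T\<^esub> Y \<otimes>\<^bsub>?T\<^esub> Z = X \<otimes>\<^bsub>?T\<^esub> (Y \<otimes>\<^bsub>?T\<^esub> Z)"
    if "X \<in> carrier ?T" "Y \<in> carrier ?T" "Z \<in> carrier ?T" for X Y Z
    using that(1)
  proof (induction X rule: ind)
    case (tensor x y)
    show ?case using that(2)
    proof (induction Y rule: ind)
      case (tensor x' y')
      show ?case using that(3)
      proof (induction Z rule: ind)
        case (tensor x'' y'')
        then show ?case
          using \<open>x \<in> _\<close> \<open>y \<in> _\<close> \<open>x' \<in> _\<close> \<open>y' \<in> _\<close> by (simp add: tensor_mult A.m_assoc B.m_assoc)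
      next
        case (add Z Z')
        then show ?case
          using \<open>x \<in> _\<close> \<open>y \<in> _\<close> \<open>x' \<in> _\<close> \<open>y' \<in> _\<close> by (simp add: rdist cl tcl)
      qed
    next
      case (add Y Y')
      then show ?case
        using tensor that(3) by (simp add: rdist ldist cl tcl)
    qed
  next
    case (add X X')
    then show ?case using that(2,3) by (simp add: ldist cl)
  qed
  have comm: "X \<otimes>\<^bsub>?T\<^esub> Y = Y \<otimes>\<^bsub>?T\<^esub> X"
    if "X \<in> carrier ?T" "Y \<in> carrier ?T" for X Y
    using that(1)
  proof (induction X rule: ind)
    case (tensor x y)
    show ?case using that(2)
    proof (induction Y rule: ind)
      case (tensor x' y')
      then show ?case
        using \<open>x \<in> _\<close> \<open>y \<in> _\<close> by (simp add: tensor_mult A.m_comm B.m_comm)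
    next
      case (add Y Y')
      then show ?case using tensor by (simp add: rdist ldist tcl)
    qed
  next
    case (add X X')
    then show ?case using that(2) by (simp add: ldist rdist)
  qed
  have one: "\<one>\<^bsub>?T\<^esub> \<otimes>\<^bsub>?T\<^esub> X = X" if "X \<in> carrier ?T" for X
    using that
    by (induction X rule: ind) (simp_all add: tensor_algebra_simps(5) tensor_mult rdist tcl)
  have onecl: "\<one>\<^bsub>?T\<^esub> \<in> carrier ?T" by (simp add: tensor_algebra_simps(5) tcl)
  show ?thesis
  proof (rule algebraI)
    show "cring ?T"
      by (rule cringI[OF T.M.abelian_group_axioms comm_monoidI])
        (assumption | rule cl onecl assoc one comm ldist)+
    fix a X Y assume "a \<in> carrier K" "X \<in> carrier ?T" "Y \<in> carrier ?T"
    then show "a \<odot>\<^bsub>?T\<^esub> X \<otimes>\<^bsub>?T\<^esub> Y = a \<odot>\<^bsub>?T\<^esub> (X \<otimes>\<^bsub>?T\<^esub> Y)"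
      using linear_map_smult[OF lin(1)] by blast
  qed (simp_all add: T.smult_l_distr T.smult_r_distr T.smult_assoc1 A.R_cring)
qed

end

subsection \<open>Algebra homomorphisms\<close>

lemma algebra_homI:
  assumes "linear_map K A B f"
    and "\<And>x y. \<lbrakk>x \<in> carrier A; y \<in> carrier A\<rbrakk> \<Longrightarrow> f (x \<otimes>\<^bsub>A\<^esub> y) = f x \<otimes>\<^bsub>B\<^esub> f y"
    and "f \<one>\<^bsub>A\<^esub> = \<one>\<^bsub>B\<^esub>"
  shows "algebra_hom K A B f"
  using assms linear_map_closed[OF assms(1)] linear_map_add[OF assms(1)]
  unfolding algebra_hom_def by (auto intro!: ring_hom_memI)

lemma
  assumes "algebra_hom K A B f"
  shows algebra_hom_linear: "linear_map K A B f"
    and algebra_hom_closed: "x \<in> carrier A \<Longrightarrow> f x \<in> carrier B"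
    and algebra_hom_mult: "\<lbrakk>x \<in> carrier A; y \<in> carrier A\<rbrakk> \<Longrightarrow> f (x \<otimes>\<^bsub>A\<^esub> y) = f x \<otimes>\<^bsub>B\<^esub> f y"
    and algebra_hom_one: "f \<one>\<^bsub>A\<^esub> = \<one>\<^bsub>B\<^esub>"
    and algebra_hom_add: "\<lbrakk>x \<in> carrier A; y \<in> carrier A\<rbrakk> \<Longrightarrow> f (x \<oplus>\<^bsub>A\<^esub> y) = f x \<oplus>\<^bsub>B\<^esub> f y"
    and algebra_hom_smult: "\<lbrakk>c \<in> carrier K; x \<in> carrier A\<rbrakk> \<Longrightarrow> f (c \<odot>\<^bsub>A\<^esub> x) = c \<odot>\<^bsub>B\<^esub> f x"
  using assms unfolding algebra_hom_def
  by (auto dest: linear_map_closed linear_map_add linear_map_smult ring_hom_mult ring_hom_one)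

lemma algebra_hom_comp:
  assumes "algebra_hom K B C g" "algebra_hom K A B f"
  shows "algebra_hom K A C (\<lambda>x. g (f x))"
  by (rule algebra_homI)
    (simp_all add: linear_map_comp[OF algebra_hom_linear[OF assms(1)] algebra_hom_linear[OF assms(2)]]
      algebra_hom_mult[OF assms(1)] algebra_hom_mult[OF assms(2)] algebra_hom_closed[OF assms(2)]
      algebra_hom_one[OF assms(1)] algebra_hom_one[OF assms(2)])

lemma algebra_hom_id: "algebra_hom K A A (\<lambda>x. x)"
  by (rule algebra_homI[OF linear_map_id]) simp_all

lemma algebra_hom_cong:
  assumes "\<And>x. x \<in> carrier A \<Longrightarrow> f x = g x" "algebra K A" "algebra_hom K A B g"
  shows "algebra_hom K A B f"
proof -
  interpret A: algebra K A by fact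
  show ?thesis
    using assms(3) by (intro algebra_homI linear_map_cong[OF assms(1) A.module_axioms])
      (simp_all add: assms(1) algebra_hom_linear algebra_hom_mult algebra_hom_one)
qed

section \<open>Skew braces and Rota--Baxter groups\<close>

text \<open>Injectivity of \<open>\<Psi>\<close> pulls the equational laws back from
  \<open>S\<close>, and surjectivity supplies the inverses. It serves for records of points whose
  product comes from a coproduct formula.\<close>

lemma group_transport:
  assumes "group S" and inj: "inj_on \<Psi> (carrier M)" and im: "\<Psi> ` carrier M = carrier S"
    and m: "\<And>x y. \<lbrakk>x \<in> carrier M; y \<in> carrier M\<rbrakk> \<Longrightarrow> x \<otimes>\<^bsub>M\<^esub> y \<in> carrier M"
    and \<Psi>m: "\<And>x y. \<lbrakk>x \<in> carrier M; y \<in> carrier M\<rbrakk> \<Longrightarrow> \<Psi> (x \<otimes>\<^bsub>M\<^esub> y) = \<Psi> x \<otimes>\<^bsub>S\<^esub> \<Psi> y"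
    and o: "\<one>\<^bsub>M\<^esub> \<in> carrier M" and \<Psi>o: "\<Psi> \<one>\<^bsub>M\<^esub> = \<one>\<^bsub>S\<^esub>"
  shows "group M"
proof -
  interpret S: group S by fact
  have cl: "\<Psi> x \<in> carrier S" if "x \<in> carrier M" for x using im that by blast
  show ?thesis
  proof (rule groupI)
    fix x y z assume "x \<in> carrier M" "y \<in> carrier M" "z \<in> carrier M"
    then show "x \<otimes>\<^bsub>M\<^esub> y \<otimes>\<^bsub>M\<^esub> z = x \<otimes>\<^bsub>M\<^esub> (y \<otimes>\<^bsub>M\<^esub> z)"
      by (intro inj_onD[OF inj]) (simp_all add: m \<Psi>m cl S.m_assoc)
  next
    fix x assume x: "x \<in> carrier M"
    then show "\<one>\<^bsub>M\<^esub> \<otimes>\<^bsub>M\<^esub> x = x"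
      by (intro inj_onD[OF inj]) (simp_all add: m o \<Psi>m \<Psi>o cl)
    have "inv\<^bsub>S\<^esub> (\<Psi> x) \<in> \<Psi> ` carrier M" using im cl[OF x] by simp
    then obtain y where y: "y \<in> carrier M" "\<Psi> y = inv\<^bsub>S\<^esub> (\<Psi> x)" by (metis imageE)
    have "y \<otimes>\<^bsub>M\<^esub> x = \<one>\<^bsub>M\<^esub>"
      by (rule inj_onD[OF inj]) (simp_all add: m o \<Psi>m \<Psi>o cl x y)
    then show "\<exists>y\<in>carrier M. y \<otimes>\<^bsub>M\<^esub> x = \<one>\<^bsub>M\<^esub>" using y by blast
  qed (use m o in auto)
qed

section \<open>Skew braces and their semidirect products\<close>

locale skew_brace = G: group G + C: group C
  for G :: "('a, 'm) monoid_scheme" and C :: "('a, 'n) monoid_scheme" +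
  assumes carrier_eq: "carrier C = carrier G"
    and brace: "\<lbrakk>a \<in> carrier G; x \<in> carrier G; y \<in> carrier G\<rbrakk> \<Longrightarrow>
      a \<otimes>\<^bsub>C\<^esub> (x \<otimes>\<^bsub>G\<^esub> y) = (a \<otimes>\<^bsub>C\<^esub> x) \<otimes>\<^bsub>G\<^esub> (inv\<^bsub>G\<^esub> a \<otimes>\<^bsub>G\<^esub> (a \<otimes>\<^bsub>C\<^esub> y))"

definition brace_lambda :: "('a, 'm) monoid_scheme \<Rightarrow> ('a, 'n) monoid_scheme \<Rightarrow> 'a \<Rightarrow> 'a \<Rightarrow> 'a"
  where "brace_lambda G C a x = inv\<^bsub>G\<^esub> a \<otimes>\<^bsub>G\<^esub> (a \<otimes>\<^bsub>C\<^esub> x)"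

definition brace_semidirect ::
  "('a, 'm) monoid_scheme \<Rightarrow> ('a, 'n) monoid_scheme \<Rightarrow> ('a \<times> 'a) monoid"
  where "brace_semidirect G C =
    \<lparr>carrier = carrier G \<times> carrier G,
     mult = (\<lambda>u v. (fst u \<otimes>\<^bsub>C\<^esub> fst v, snd u \<otimes>\<^bsub>G\<^esub> brace_lambda G C (fst u) (snd v))),
     one = (\<one>\<^bsub>C\<^esub>, \<one>\<^bsub>G\<^esub>)\<rparr>"

definition brace_rota_baxter ::
  "('a, 'm) monoid_scheme \<Rightarrow> ('a, 'n) monoid_scheme \<Rightarrow> 'a \<times> 'a \<Rightarrow> 'a \<times> 'a"
  where "brace_rota_baxter G C u = (inv\<^bsub>C\<^esub> (fst u) \<otimes>\<^bsub>C\<^esub> snd u, \<one>\<^bsub>G\<^esub>)"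

context skew_brace
begin

lemma C_closed [simp]:
  "\<lbrakk>x \<in> carrier G; y \<in> carrier G\<rbrakk> \<Longrightarrow> x \<otimes>\<^bsub>C\<^esub> y \<in> carrier G"
  "x \<in> carrier G \<Longrightarrow> inv\<^bsub>C\<^esub> x \<in> carrier G"
  "\<one>\<^bsub>C\<^esub> \<in> carrier G"
  using C.m_closed C.inv_closed C.one_closed unfolding carrier_eq by auto

lemmas C_assoc = C.m_assoc[unfolded carrier_eq]
lemmas C_inv = C.l_inv[unfolded carrier_eq] C.r_inv[unfolded carrier_eq]
lemmas C_one = C.l_one[unfolded carrier_eq] C.r_one[unfolded carrier_eq]

text \<open>Taking \<open>a\<close> to be the unit of \<open>C\<close> and \<open>x\<close>,
  \<open>y\<close> the unit of \<open>G\<close>, the brace identity says that the unit of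
  \<open>G\<close> is the \<open>G\<close>-inverse of the unit of \<open>C\<close>.\<close>

lemma one_eq: "\<one>\<^bsub>C\<^esub> = \<one>\<^bsub>G\<^esub>"
proof -
  have "\<one>\<^bsub>G\<^esub> = \<one>\<^bsub>C\<^esub> \<otimes>\<^bsub>C\<^esub> (\<one>\<^bsub>G\<^esub> \<otimes>\<^bsub>G\<^esub> \<one>\<^bsub>G\<^esub>)" by (simp add: C_one)
  also have "\<dots> = inv\<^bsub>G\<^esub> \<one>\<^bsub>C\<^esub>"
    by (subst brace) (simp_all add: C_one)
  finally show ?thesis by (metis C_closed(3) G.inv_inv G.inv_one)
qed

declare one_eq [simp] C_one [unfolded one_eq, simp] C_inv [unfolded one_eq, simp]

abbreviation lam :: "'a \<Rightarrow> 'a \<Rightarrow> 'a" where "lam \<equiv> brace_lambda G C"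

lemma lam_closed [simp]: "\<lbrakk>a \<in> carrier G; x \<in> carrier G\<rbrakk> \<Longrightarrow> lam a x \<in> carrier G"
  by (simp add: brace_lambda_def)

lemma mult_lam: "\<lbrakk>a \<in> carrier G; x \<in> carrier G\<rbrakk> \<Longrightarrow> a \<otimes>\<^bsub>G\<^esub> lam a x = a \<otimes>\<^bsub>C\<^esub> x"
  by (simp add: brace_lambda_def G.m_assoc[symmetric])

lemma lam_mult:
  "\<lbrakk>a \<in> carrier G; x \<in> carrier G; y \<in> carrier G\<rbrakk> \<Longrightarrow>
    lam a (x \<otimes>\<^bsub>G\<^esub> y) = lam a x \<otimes>\<^bsub>G\<^esub> lam a y"
  by (simp add: brace_lambda_def brace G.m_assoc)

text \<open>After multiplication by \<open>a \<circ> b\<close> on the left both sides are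
  \<open>a \<circ> (b \<circ> x)\<close>: here \<open>b \<circ> x\<close> is
  \<open>b \<bullet> lam b x\<close>, and the brace identity expands the outer product.\<close>

lemma lam_lam:
  assumes "a \<in> carrier G" "b \<in> carrier G" "x \<in> carrier G"
  shows "lam (a \<otimes>\<^bsub>C\<^esub> b) x = lam a (lam b x)"
proof -
  have "(a \<otimes>\<^bsub>C\<^esub> b) \<otimes>\<^bsub>G\<^esub> lam (a \<otimes>\<^bsub>C\<^esub> b) x = a \<otimes>\<^bsub>C\<^esub> (b \<otimes>\<^bsub>G\<^esub> lam b x)"
    using assms by (simp add: mult_lam C_assoc)
  also have "\<dots> = (a \<otimes>\<^bsub>C\<^esub> b) \<otimes>\<^bsub>G\<^esub> lam a (lam b x)"
    using assms by (subst brace) (simp_all add: brace_lambda_def[of G C a])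
  finally show ?thesis using assms by simp
qed

lemma lam_one [simp]: "a \<in> carrier G \<Longrightarrow> lam a \<one>\<^bsub>G\<^esub> = \<one>\<^bsub>G\<^esub>"
  "x \<in> carrier G \<Longrightarrow> lam \<one>\<^bsub>G\<^esub> x = x"
  by (simp_all add: brace_lambda_def)

lemma group_semidirect: "group (brace_semidirect G C)"
proof (rule groupI)
  let ?S = "brace_semidirect G C"
  fix u assume "u \<in> carrier ?S"
  then obtain a x where u: "u = (a, x)" "a \<in> carrier G" "x \<in> carrier G"
    by (auto simp: brace_semidirect_def)
  \<comment> \<open>The second component of the witness has to cancel \<open>lam (inv a) x\<close>,
    which is what a left factor with first component \<open>inv a\<close> makes of
    \<open>x\<close>.\<close>
  show "\<exists>v\<in>carrier ?S. v \<otimes>\<^bsub>?S\<^esub> u = \<one>\<^bsub>?S\<^esub>"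
    by (rule bexI[of _ "(inv\<^bsub>C\<^esub> a, inv\<^bsub>G\<^esub> (lam (inv\<^bsub>C\<^esub> a) x))"])
      (use u in \<open>simp_all add: brace_semidirect_def\<close>)
qed (auto simp: brace_semidirect_def C_assoc G.m_assoc lam_mult lam_lam)

lemma rota_baxter_closed:
  "u \<in> carrier (brace_semidirect G C) \<Longrightarrow> brace_rota_baxter G C u \<in> carrier (brace_semidirect G C)"
  by (auto simp: brace_rota_baxter_def brace_semidirect_def)

lemma inv_semidirect_left:
  assumes "a \<in> carrier G"
  shows "inv\<^bsub>brace_semidirect G C\<^esub> (a, \<one>\<^bsub>G\<^esub>) = (inv\<^bsub>C\<^esub> a, \<one>\<^bsub>G\<^esub>)"
proof -
  interpret S: group "brace_semidirect G C" by (rule group_semidirect)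
  show ?thesis
    by (rule S.inv_equality) (use assms in \<open>simp_all add: brace_semidirect_def\<close>)
qed

lemma C_inv_mult: "\<lbrakk>a \<in> carrier G; b \<in> carrier G\<rbrakk> \<Longrightarrow> inv\<^bsub>C\<^esub> (a \<otimes>\<^bsub>C\<^esub> b) = inv\<^bsub>C\<^esub> b \<otimes>\<^bsub>C\<^esub> inv\<^bsub>C\<^esub> a"
  using C.inv_mult_group unfolding carrier_eq by blast

lemma C_inv_inv: "a \<in> carrier G \<Longrightarrow> inv\<^bsub>C\<^esub> (inv\<^bsub>C\<^esub> a) = a"
  using C.inv_inv unfolding carrier_eq by blast

lemma C_cancel [simp]:
  assumes "a \<in> carrier G" "x \<in> carrier G"
  shows "inv\<^bsub>C\<^esub> a \<otimes>\<^bsub>C\<^esub> (a \<otimes>\<^bsub>C\<^esub> x) = x" "a \<otimes>\<^bsub>C\<^esub> (inv\<^bsub>C\<^esub> a \<otimes>\<^bsub>C\<^esub> x) = x"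
  using assms by (simp_all add: C_assoc[symmetric])

end

text \<open>The product dual to \<open>\<Delta>_B\<close>. It is bracketed to the right like
  \<open>sweedler4\<close>, whose four legs correspond to the four factors in this order.\<close>

definition descendant_group :: "('a, 'm) monoid_scheme \<Rightarrow> ('a \<Rightarrow> 'a) \<Rightarrow> 'a monoid"
  where "descendant_group S B =
    \<lparr>carrier = carrier S,
     mult = (\<lambda>x y. x \<otimes>\<^bsub>S\<^esub> (B x \<otimes>\<^bsub>S\<^esub> (y \<otimes>\<^bsub>S\<^esub> inv\<^bsub>S\<^esub> (B x)))),
     one = \<one>\<^bsub>S\<^esub>\<rparr>"

locale rota_baxter_group = group S for S :: "('a, 'm) monoid_scheme" +
  fixes B :: "'a \<Rightarrow> 'a"
  assumes B_closed [simp]: "x \<in> carrier S \<Longrightarrow> B x \<in> carrier S"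
    and rota_baxter: "\<lbrakk>x \<in> carrier S; y \<in> carrier S\<rbrakk> \<Longrightarrow>
      B x \<otimes>\<^bsub>S\<^esub> B y = B (x \<otimes>\<^bsub>S\<^esub> (B x \<otimes>\<^bsub>S\<^esub> (y \<otimes>\<^bsub>S\<^esub> inv\<^bsub>S\<^esub> (B x))))"
begin

lemma B_one: "B \<one>\<^bsub>S\<^esub> = \<one>\<^bsub>S\<^esub>"
proof -
  have "B \<one>\<^bsub>S\<^esub> \<otimes>\<^bsub>S\<^esub> B \<one>\<^bsub>S\<^esub> = B \<one>\<^bsub>S\<^esub>"
    using rota_baxter[of "\<one>\<^bsub>S\<^esub>" "\<one>\<^bsub>S\<^esub>"] by simp
  then show ?thesis by simp
qed

lemma inv_cancel:
  "\<lbrakk>a \<in> carrier S; x \<in> carrier S\<rbrakk> \<Longrightarrow> inv\<^bsub>S\<^esub> a \<otimes>\<^bsub>S\<^esub> (a \<otimes>\<^bsub>S\<^esub> x) = x"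
  "\<lbrakk>a \<in> carrier S; x \<in> carrier S\<rbrakk> \<Longrightarrow> a \<otimes>\<^bsub>S\<^esub> (inv\<^bsub>S\<^esub> a \<otimes>\<^bsub>S\<^esub> x) = x"
  by (simp_all add: m_assoc[symmetric])

text \<open>Let \<open>y\<close> be the element to which \<open>B\<close> is applied on the left.
  Then \<open>x B(x) y (inv B(x))\<close> collapses to the unit, so \<open>y\<close> is the
  descendant inverse of \<open>x\<close>, and the Rota--Baxter identity reads
  \<open>B(x) B(y) = 1\<close>.\<close>

lemma B_inv:
  assumes "x \<in> carrier S"
  shows "B (inv\<^bsub>S\<^esub> (B x) \<otimes>\<^bsub>S\<^esub> (inv\<^bsub>S\<^esub> x \<otimes>\<^bsub>S\<^esub> B x)) = inv\<^bsub>S\<^esub> (B x)"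
proof -
  have "B x \<otimes>\<^bsub>S\<^esub> B (inv\<^bsub>S\<^esub> (B x) \<otimes>\<^bsub>S\<^esub> (inv\<^bsub>S\<^esub> x \<otimes>\<^bsub>S\<^esub> B x)) = \<one>\<^bsub>S\<^esub>"
    using assms by (subst rota_baxter) (simp_all add: m_assoc inv_cancel B_one)
  then show ?thesis using assms by (metis B_closed inv_closed inv_comm inv_equality m_closed)
qed

lemma group_descendant: "group (descendant_group S B)"
proof (rule groupI)
  fix x y z
  assume "x \<in> carrier (descendant_group S B)" "y \<in> carrier (descendant_group S B)"
    "z \<in> carrier (descendant_group S B)"
  then show "x \<otimes>\<^bsub>descendant_group S B\<^esub> y \<otimes>\<^bsub>descendant_group S B\<^esub> z =
    x \<otimes>\<^bsub>descendant_group S B\<^esub> (y \<otimes>\<^bsub>descendant_group S B\<^esub> z)"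
    by (simp add: descendant_group_def rota_baxter[symmetric] inv_mult_group m_assoc inv_cancel)
next
  fix x assume x: "x \<in> carrier (descendant_group S B)"
  then have x': "x \<in> carrier S" by (simp add: descendant_group_def)
  show "\<exists>y\<in>carrier (descendant_group S B). y \<otimes>\<^bsub>descendant_group S B\<^esub> x = \<one>\<^bsub>descendant_group S B\<^esub>"
    by (rule bexI[of _ "inv\<^bsub>S\<^esub> (B x) \<otimes>\<^bsub>S\<^esub> (inv\<^bsub>S\<^esub> x \<otimes>\<^bsub>S\<^esub> B x)"])
      (use x' in \<open>simp_all add: descendant_group_def B_inv m_assoc inv_cancel\<close>)
qed (simp_all add: descendant_group_def B_one)

text \<open>The group form of the formula for \<open>S_B\<close>, with the factors in the order of
  its three legs.\<close>

lemma inv_descendant: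
  assumes "x \<in> carrier S"
  shows "inv\<^bsub>descendant_group S B\<^esub> x = inv\<^bsub>S\<^esub> (B x) \<otimes>\<^bsub>S\<^esub> (inv\<^bsub>S\<^esub> x \<otimes>\<^bsub>S\<^esub> B x)"
proof -
  interpret D: group "descendant_group S B" by (rule group_descendant)
  show ?thesis
    by (rule D.inv_equality)
      (use assms in \<open>simp_all add: descendant_group_def B_inv m_assoc inv_cancel\<close>)
qed

text \<open>Here \<open>inv a \<bullet> (a \<circ> z)\<close> is the conjugate of \<open>z\<close>
  by \<open>B a\<close>, and the brace identity expresses that conjugation is
  multiplicative.\<close>

lemma skew_brace_descendant: "skew_brace S (descendant_group S B)"
proof (intro skew_brace.intro group_descendant skew_brace_axioms.intro)
  let ?D = "descendant_group S B"
  show "group S" by (rule group_axioms)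
  fix a x y assume "a \<in> carrier S" "x \<in> carrier S" "y \<in> carrier S"
  then show "a \<otimes>\<^bsub>?D\<^esub> (x \<otimes>\<^bsub>S\<^esub> y) =
      (a \<otimes>\<^bsub>?D\<^esub> x) \<otimes>\<^bsub>S\<^esub> (inv\<^bsub>S\<^esub> a \<otimes>\<^bsub>S\<^esub> (a \<otimes>\<^bsub>?D\<^esub> y))"
    by (simp add: descendant_group_def m_assoc inv_cancel)
qed (simp add: descendant_group_def)

end

section \<open>The Rota--Baxter operator of a skew brace\<close>

context skew_brace
begin

text \<open>By the factorization \<open>(a, x) = (x, x)(x' \<circ> a, 1)\<close> the descendant
  product is \<open>(x, x)(b, y)(x' \<circ> a, 1)\<close>; multiplying out gives the right-hand
  side.\<close>

lemma rota_baxter_mult_eq: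
  assumes "a \<in> carrier G" "x \<in> carrier G" "b \<in> carrier G" "y \<in> carrier G"
  shows "(a, x) \<otimes>\<^bsub>brace_semidirect G C\<^esub> (brace_rota_baxter G C (a, x) \<otimes>\<^bsub>brace_semidirect G C\<^esub>
      ((b, y) \<otimes>\<^bsub>brace_semidirect G C\<^esub> inv\<^bsub>brace_semidirect G C\<^esub> (brace_rota_baxter G C (a, x)))) =
    (x \<otimes>\<^bsub>C\<^esub> (b \<otimes>\<^bsub>C\<^esub> (inv\<^bsub>C\<^esub> x \<otimes>\<^bsub>C\<^esub> a)), x \<otimes>\<^bsub>C\<^esub> y)"
  using assms
  by (simp add: brace_rota_baxter_def inv_semidirect_left C_inv_mult C_inv_inv)
    (simp add: brace_semidirect_def C_assoc lam_lam[symmetric] mult_lam)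

text \<open>Both sides are \<open>(a' \<circ> x \<circ> b' \<circ> y, 1)\<close>: inverting the
  first component of the descendant product puts \<open>x'\<close> next to the \<open>x\<close> of
  its second component, and they cancel.\<close>

lemma rota_baxter_semidirect:
  "rota_baxter_group (brace_semidirect G C) (brace_rota_baxter G C)"
proof (intro rota_baxter_group.intro group_semidirect rota_baxter_group_axioms.intro rota_baxter_closed)
  let ?S = "brace_semidirect G C" and ?B = "brace_rota_baxter G C"
  fix u v assume "u \<in> carrier ?S" "v \<in> carrier ?S"
  then obtain a x b y where uv: "u = (a, x)" "v = (b, y)"
    "a \<in> carrier G" "x \<in> carrier G" "b \<in> carrier G" "y \<in> carrier G"
    by (auto simp: brace_semidirect_def)
  show "?B u \<otimes>\<^bsub>?S\<^esub> ?B v =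
    ?B (u \<otimes>\<^bsub>?S\<^esub> (?B u \<otimes>\<^bsub>?S\<^esub>
      (v \<otimes>\<^bsub>?S\<^esub> inv\<^bsub>?S\<^esub> (?B u))))"
    unfolding uv rota_baxter_mult_eq[OF uv(3-6)]
    using uv(3-6)
    by (simp add: brace_rota_baxter_def C_inv_mult C_inv_inv C_assoc)
      (simp add: brace_semidirect_def C_assoc)
qed

lemma embedding_semidirect:
  assumes "x \<in> carrier G" "y \<in> carrier G"
  shows "(\<one>\<^bsub>G\<^esub>, x) \<otimes>\<^bsub>brace_semidirect G C\<^esub> (\<one>\<^bsub>G\<^esub>, y) = (\<one>\<^bsub>G\<^esub>, x \<otimes>\<^bsub>G\<^esub> y)"
  using assms by (simp add: brace_semidirect_def)

lemma embedding_descendant: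
  assumes "x \<in> carrier G" "y \<in> carrier G"
  shows "(\<one>\<^bsub>G\<^esub>, x) \<otimes>\<^bsub>descendant_group (brace_semidirect G C) (brace_rota_baxter G C)\<^esub> (\<one>\<^bsub>G\<^esub>, y) =
    (\<one>\<^bsub>G\<^esub>, x \<otimes>\<^bsub>C\<^esub> y)"
  using assms
  by (simp add: descendant_group_def rota_baxter_mult_eq)

end

section \<open>The tensor product as coproduct of commutative algebras\<close>

lemma algebra_if_assoc_algebra: "\<lbrakk>assoc_algebra K A; cring A\<rbrakk> \<Longrightarrow> algebra K A"
  unfolding assoc_algebra_def assoc_algebra_axioms_def algebra_def algebra_axioms_def by blast

lemma assoc_algebra_if_algebra:
  assumes "field K" "algebra K A"
  shows "assoc_algebra K A"
proof -
  interpret A: algebra K A by fact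
  show ?thesis
    by (intro assoc_algebra.intro assoc_algebra_axioms.intro A.module_axioms assms(1) A.ring_axioms
        A.smult_assoc2 A.smult_assoc_right)
qed

definition tensor_pair ::
  "('k, 'm) ring_scheme \<Rightarrow> ('k, 'r, 'q) module_scheme \<Rightarrow> ('a \<Rightarrow> 'r) \<Rightarrow> ('b \<Rightarrow> 'r) \<Rightarrow>
   ('a, 'b, 'k) tensor \<Rightarrow> 'r"
  where "tensor_pair K R f g = tensor_lift K R (\<lambda>x y. f x \<otimes>\<^bsub>R\<^esub> g y)"

context
  fixes K :: "('k, 'm) ring_scheme"
    and A :: "('k, 'a, 'n) module_scheme"
    and B :: "('k, 'b, 'p) module_scheme"
  assumes A: "algebra K A" and B: "algebra K B"
begin

interpretation A: algebra K A by (rule A)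
interpretation B: algebra K B by (rule B)
interpretation T: algebra K "tensor_algebra K A B" by (rule algebra_tensor_algebra[OF A B])

lemma algebra_hom_tensor_left: "algebra_hom K A (tensor_algebra K A B) (\<lambda>x. tensor K A B x \<one>\<^bsub>B\<^esub>)"
  by (rule algebra_homI[OF linear_map_tensor_left[OF A.module_axioms B.module_axioms linear_map_id]])
    (simp_all add: tensor_mult[OF A B] tensor_algebra_simps(5))

lemma algebra_hom_tensor_right: "algebra_hom K B (tensor_algebra K A B) (\<lambda>y. tensor K A B \<one>\<^bsub>A\<^esub> y)"
  by (rule algebra_homI[OF linear_map_tensor_right[OF A.module_axioms B.module_axioms linear_map_id]])
    (simp_all add: tensor_mult[OF A B] tensor_algebra_simps(5))

lemma tensor_eq_mult:
  "\<lbrakk>x \<in> carrier A; y \<in> carrier B\<rbrakk> \<Longrightarrow>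
    tensor K A B x y = tensor K A B x \<one>\<^bsub>B\<^esub> \<otimes>\<^bsub>tensor_algebra K A B\<^esub> tensor K A B \<one>\<^bsub>A\<^esub> y"
  by (simp add: tensor_mult[OF A B])

text \<open>The tensor product is generated as an algebra by the images of its two factors.\<close>

lemma algebra_hom_tensor_eqI:
  assumes F: "algebra_hom K (tensor_algebra K A B) R F" and G: "algebra_hom K (tensor_algebra K A B) R G"
    and left: "\<And>x. x \<in> carrier A \<Longrightarrow> F (tensor K A B x \<one>\<^bsub>B\<^esub>) = G (tensor K A B x \<one>\<^bsub>B\<^esub>)"
    and right: "\<And>y. y \<in> carrier B \<Longrightarrow> F (tensor K A B \<one>\<^bsub>A\<^esub> y) = G (tensor K A B \<one>\<^bsub>A\<^esub> y)"
    and X: "X \<in> carrier (tensor_algebra K A B)"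
  shows "F X = G X"
proof (rule linear_map_tensor_eqI[OF A.module_axioms B.module_axioms algebra_hom_linear[OF F]
      algebra_hom_linear[OF G] _ X])
  fix x y assume xy: "x \<in> carrier A" "y \<in> carrier B"
  note cl = algebra_hom_closed[OF algebra_hom_tensor_left xy(1)]
    algebra_hom_closed[OF algebra_hom_tensor_right xy(2)]
  show "F (tensor K A B x y) = G (tensor K A B x y)"
    unfolding tensor_eq_mult[OF xy] algebra_hom_mult[OF F cl] algebra_hom_mult[OF G cl]
      left[OF xy(1)] right[OF xy(2)] ..
qed

context
  fixes R :: "('k, 'r, 'q) module_scheme" and f :: "'a \<Rightarrow> 'r" and g :: "'b \<Rightarrow> 'r"
  assumes R: "algebra K R" and f: "algebra_hom K A R f" and g: "algebra_hom K B R g"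
begin

interpretation R: algebra K R by (rule R)

lemma bilinear_pair: "bilinear_map K A B R (\<lambda>x y. f x \<otimes>\<^bsub>R\<^esub> g y)"
  by (rule bilinear_map_mult[OF R algebra_hom_linear[OF f] algebra_hom_linear[OF g]])

lemma tensor_pair_tensor:
  "\<lbrakk>x \<in> carrier A; y \<in> carrier B\<rbrakk> \<Longrightarrow> tensor_pair K R f g (tensor K A B x y) = f x \<otimes>\<^bsub>R\<^esub> g y"
  unfolding tensor_pair_def
  by (rule tensor_lift_tensor[OF A.module_axioms B.module_axioms R.module_axioms bilinear_pair])

lemma tensor_pair_left: "x \<in> carrier A \<Longrightarrow> tensor_pair K R f g (tensor K A B x \<one>\<^bsub>B\<^esub>) = f x"
  by (simp add: tensor_pair_tensor algebra_hom_one[OF g] algebra_hom_closed[OF f])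

lemma tensor_pair_right: "y \<in> carrier B \<Longrightarrow> tensor_pair K R f g (tensor K A B \<one>\<^bsub>A\<^esub> y) = g y"
  by (simp add: tensor_pair_tensor algebra_hom_one[OF f] algebra_hom_closed[OF g])

text \<open>Here commutativity of \<open>R\<close> enters: the factors of
  \<open>f x g y f x' g y'\<close> have to be reordered. It is the reason why points with values in
  commutative algebras are closed under convolution.\<close>

lemma algebra_hom_tensor_pair: "algebra_hom K (tensor_algebra K A B) R (tensor_pair K R f g)"
proof -
  let ?T = "tensor_algebra K A B"
  have lin: "linear_map K ?T R (tensor_pair K R f g)"
    unfolding tensor_pair_def
    by (rule linear_tensor_lift[OF A.module_axioms B.module_axioms R.module_axioms bilinear_pair])
  note ind = tensor_induct[OF A.module_axioms B.module_axioms, consumes 1, case_names tensor add]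
  note tcl = tensor_closed[OF A.module_axioms B.module_axioms]
  note cl = linear_map_closed[OF lin] algebra_hom_closed[OF f] algebra_hom_closed[OF g]
  show ?thesis
  proof (rule algebra_homI[OF lin])
    fix X Y assume X: "X \<in> carrier ?T" and Y: "Y \<in> carrier ?T"
    show "tensor_pair K R f g (X \<otimes>\<^bsub>?T\<^esub> Y) = tensor_pair K R f g X \<otimes>\<^bsub>R\<^esub> tensor_pair K R f g Y"
      using X
    proof (induction X rule: ind)
      case (tensor x y)
      show ?case using Y
      proof (induction Y rule: ind)
        case (tensor x' y')
        then show ?case
          using \<open>x \<in> _\<close> \<open>y \<in> _\<close>
          by (simp add: tensor_mult[OF A B] tensor_pair_tensor algebra_hom_mult[OF f]
              algebra_hom_mult[OF g] cl R.m_ac)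
      next
        case (add Y Y')
        then show ?case
          using tensor by (simp add: tcl T.r_distr R.r_distr linear_map_add[OF lin] cl)
      qed
    next
      case (add X X')
      then show ?case using Y by (simp add: T.l_distr R.l_distr linear_map_add[OF lin] cl)
    qed
  next
    show "tensor_pair K R f g \<one>\<^bsub>?T\<^esub> = \<one>\<^bsub>R\<^esub>"
      by (simp add: tensor_algebra_simps(5) tensor_pair_tensor algebra_hom_one[OF f] algebra_hom_one[OF g])
  qed
qed

end

end

section \<open>The group of points\<close>

text \<open>
  Points are made extensional so that they are equal as soon as they agree on the carrier.
\<close>

definition alg_points ::
  "('k, 'm) ring_scheme \<Rightarrow> ('k, 'a, 'n) module_scheme \<Rightarrow> ('k, 'r, 'q) module_scheme \<Rightarrow> ('a \<Rightarrow> 'r) set"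
  where "alg_points K A R = {f. algebra_hom K A R f} \<inter> extensional (carrier A)"

text \<open>The product is convolution. The record makes sense for any coproduct and counit, so its
  group laws can be established first and the Hopf axioms deduced from them.\<close>

definition points ::
  "('k, 'm) ring_scheme \<Rightarrow> ('k, 'a, 'n) module_scheme \<Rightarrow> ('k, 'a, 's) hopf_scheme \<Rightarrow>
   ('k, 'r, 'q) module_scheme \<Rightarrow> ('a \<Rightarrow> 'r) monoid"
  where "points K A h R =
    \<lparr>carrier = alg_points K A R,
     mult = (\<lambda>f g. \<lambda>x\<in>carrier A. tensor_pair K R f g (comult h x)),
     one = (\<lambda>x\<in>carrier A. counit h x \<odot>\<^bsub>R\<^esub> \<one>\<^bsub>R\<^esub>)\<rparr>"

lemma carrier_points [simp]: "carrier (points K A h R) = alg_points K A R"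
  by (simp add: points_def)

lemma alg_points_hom: "f \<in> alg_points K A R \<Longrightarrow> algebra_hom K A R f"
  by (simp add: alg_points_def)

lemma alg_points_eqI:
  assumes "f \<in> alg_points K A R" "g \<in> alg_points K A R" "\<And>x. x \<in> carrier A \<Longrightarrow> f x = g x"
  shows "f = g"
  using assms unfolding alg_points_def by (auto intro: extensionalityI)

lemma alg_points_eq_restrict: "f \<in> alg_points K A R \<Longrightarrow> (\<lambda>x\<in>carrier A. f x) = f"
  by (simp add: alg_points_def extensional_restrict)

lemma restrict_alg_points:
  assumes "algebra K A" "algebra_hom K A R f"
  shows "restrict f (carrier A) \<in> alg_points K A R"
proof -
  have "algebra_hom K A R (restrict f (carrier A))"
    by (rule algebra_hom_cong[OF _ assms]) simp
  then show ?thesis by (simp add: alg_points_def)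
qed

lemma compose_alg_points:
  assumes "algebra K A" "algebra_hom K R R' \<phi>" "f \<in> alg_points K A R"
  shows "compose (carrier A) \<phi> f \<in> alg_points K A R'"
  unfolding compose_def
  by (rule restrict_alg_points[OF assms(1) algebra_hom_comp[OF assms(2) alg_points_hom[OF assms(3)]]])

text \<open>Coassociativity, the counit laws and the antipode are left out on purpose: for a newly
  built coproduct they are consequences of the group laws of its points.\<close>

locale pre_bialgebra = algebra K A
  for K :: "('k, 'm) ring_scheme" and A :: "('k, 'a, 'n) module_scheme" +
  fixes h :: "('k, 'a, 's) hopf_scheme"
  assumes comult_algebra_hom: "algebra_hom K A (tensor_algebra K A A) (comult h)"
    and counit_character: "algebra_character K A (counit h)"
begin

lemma counit_closed: "x \<in> carrier A \<Longrightarrow> counit h x \<in> carrier K"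
  using counit_character unfolding algebra_character_def by (auto dest: ring_hom_closed)

lemma
  shows counit_one: "counit h \<one>\<^bsub>A\<^esub> = \<one>\<^bsub>K\<^esub>"
    and counit_add: "\<lbrakk>x \<in> carrier A; y \<in> carrier A\<rbrakk> \<Longrightarrow>
      counit h (x \<oplus>\<^bsub>A\<^esub> y) = counit h x \<oplus>\<^bsub>K\<^esub> counit h y"
    and counit_mult: "\<lbrakk>x \<in> carrier A; y \<in> carrier A\<rbrakk> \<Longrightarrow>
      counit h (x \<otimes>\<^bsub>A\<^esub> y) = counit h x \<otimes>\<^bsub>K\<^esub> counit h y"
    and counit_smult: "\<lbrakk>k \<in> carrier K; x \<in> carrier A\<rbrakk> \<Longrightarrow>
      counit h (k \<odot>\<^bsub>A\<^esub> x) = k \<otimes>\<^bsub>K\<^esub> counit h x"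
  using counit_character unfolding algebra_character_def
  by (auto dest: ring_hom_one ring_hom_add ring_hom_mult)

lemma algebra_hom_counit:
  assumes "algebra K R"
  shows "algebra_hom K A R (\<lambda>x. counit h x \<odot>\<^bsub>R\<^esub> \<one>\<^bsub>R\<^esub>)"
proof -
  interpret R: algebra K R by fact
  show ?thesis
    by (intro algebra_homI linear_mapI)
      (simp_all add: counit_closed counit_add counit_mult counit_one counit_smult
        R.smult_l_distr R.smult_assoc1 R.smult_assoc2)
qed

lemma comult_linear: "linear_map K A (tensor_algebra K A A) (comult h)"
  by (rule algebra_hom_linear[OF comult_algebra_hom])

lemma comult_closed: "x \<in> carrier A \<Longrightarrow> comult h x \<in> carrier (tensor_algebra K A A)"
  by (rule linear_map_closed[OF comult_linear])

subsection \<open>Sweedler notation\<close>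

lemma sweedler2_cong:
  assumes "module K M" "bilinear_map K A A M \<beta>" "x \<in> carrier A"
    and "\<And>x1 x2. \<lbrakk>x1 \<in> carrier A; x2 \<in> carrier A\<rbrakk> \<Longrightarrow> \<beta>' x1 x2 = \<beta> x1 x2"
  shows "sweedler2 K h M x \<beta>' = sweedler2 K h M x \<beta>"
  unfolding sweedler2_def
  by (rule tensor_lift_cong[OF module_axioms module_axioms assms(1,2) comult_closed[OF assms(3)] assms(4)])

lemma linear_sweedler2:
  "\<lbrakk>module K M; bilinear_map K A A M \<beta>\<rbrakk> \<Longrightarrow> linear_map K A M (\<lambda>x. sweedler2 K h M x \<beta>)"
  unfolding sweedler2_def
  by (rule linear_map_comp[OF linear_tensor_lift[OF module_axioms module_axioms] comult_linear])

lemma linear_map_sweedler2: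
  "\<lbrakk>module K M; module K N; bilinear_map K A A M \<beta>; linear_map K M N \<phi>; x \<in> carrier A\<rbrakk> \<Longrightarrow>
    \<phi> (sweedler2 K h M x \<beta>) = sweedler2 K h N x (\<lambda>x1 x2. \<phi> (\<beta> x1 x2))"
  unfolding sweedler2_def
  by (rule linear_map_tensor_lift[OF module_axioms module_axioms _ _ _ _ comult_closed])

lemma linear_sweedler2_param:
  assumes "module K M" "module K C"
    and "\<And>z. z \<in> carrier C \<Longrightarrow> bilinear_map K A A M (\<beta> z)"
    and "\<And>x y. \<lbrakk>x \<in> carrier A; y \<in> carrier A\<rbrakk> \<Longrightarrow> linear_map K C M (\<lambda>z. \<beta> z x y)"
    and "x \<in> carrier A"
  shows "linear_map K C M (\<lambda>z. sweedler2 K h M x (\<beta> z))"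
  unfolding sweedler2_def
  by (rule linear_tensor_lift_param[OF module_axioms module_axioms assms(1-4) comult_closed[OF assms(5)]])

subsection \<open>Convolution\<close>

lemma points_mult:
  "x \<in> carrier A \<Longrightarrow> (f \<otimes>\<^bsub>points K A h R\<^esub> g) x = sweedler2 K h R x (\<lambda>x1 x2. f x1 \<otimes>\<^bsub>R\<^esub> g x2)"
  by (simp add: points_def tensor_pair_def sweedler2_def)

lemma points_mult_eq_compose:
  "f \<otimes>\<^bsub>points K A h R\<^esub> g = compose (carrier A) (tensor_pair K R f g) (comult h)"
  by (simp add: points_def compose_def)

lemma points_one: "x \<in> carrier A \<Longrightarrow> \<one>\<^bsub>points K A h R\<^esub> x = counit h x \<odot>\<^bsub>R\<^esub> \<one>\<^bsub>R\<^esub>"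
  by (simp add: points_def)

lemma points_one_closed: "algebra K R \<Longrightarrow> \<one>\<^bsub>points K A h R\<^esub> \<in> alg_points K A R"
  by (simp add: points_def restrict_alg_points[OF algebra_axioms algebra_hom_counit])

lemma points_mult_closed:
  assumes "algebra K R" "f \<in> alg_points K A R" "g \<in> alg_points K A R"
  shows "f \<otimes>\<^bsub>points K A h R\<^esub> g \<in> alg_points K A R"
  unfolding points_mult_eq_compose compose_def
  by (rule restrict_alg_points[OF algebra_axioms algebra_hom_comp[OF algebra_hom_tensor_pair[OF
            algebra_axioms algebra_axioms assms(1) alg_points_hom[OF assms(2)] alg_points_hom[OF assms(3)]]
          comult_algebra_hom]])

text \<open>The translation from Sweedler notation into products of points. The linear map \<phi>
  absorbs the factors that are constant for this sum, typically those bound by an enclosing sum, so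
  that iterated sums can be translated one level at a time.\<close>

lemma sweedler2_push_points:
  assumes R: "algebra K R" "f \<in> alg_points K A R" "g \<in> alg_points K A R"
    and N: "module K N" "linear_map K R N \<phi>" and x: "x \<in> carrier A"
    and eq: "\<And>x1 x2. \<lbrakk>x1 \<in> carrier A; x2 \<in> carrier A\<rbrakk> \<Longrightarrow> \<beta> x1 x2 = \<phi> (f x1 \<otimes>\<^bsub>R\<^esub> g x2)"
  shows "sweedler2 K h N x \<beta> = \<phi> ((f \<otimes>\<^bsub>points K A h R\<^esub> g) x)"
proof -
  interpret R: algebra K R by fact
  note b = bilinear_pair[OF algebra_axioms algebra_axioms R(1) alg_points_hom[OF R(2)] alg_points_hom[OF R(3)]]
  have "\<phi> ((f \<otimes>\<^bsub>points K A h R\<^esub> g) x) = sweedler2 K h N x (\<lambda>x1 x2. \<phi> (f x1 \<otimes>\<^bsub>R\<^esub> g x2))"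
    unfolding points_mult[OF x] by (rule linear_map_sweedler2[OF R.module_axioms N(1) b N(2) x])
  also have "\<dots> = sweedler2 K h N x \<beta>"
  proof (rule sweedler2_cong[OF N(1) _ x, symmetric])
    show "bilinear_map K A A N (\<lambda>x1 x2. \<phi> (f x1 \<otimes>\<^bsub>R\<^esub> g x2))"
      by (rule bilinear_mapI) (use linear_map_comp[OF N(2)] bilinear_map_left[OF b] bilinear_map_right[OF b] in blast)+
  qed (rule eq)
  finally show ?thesis ..
qed

lemma sweedler2_points:
  assumes "algebra K R" "f \<in> alg_points K A R" "g \<in> alg_points K A R" "x \<in> carrier A"
    and "\<And>x1 x2. \<lbrakk>x1 \<in> carrier A; x2 \<in> carrier A\<rbrakk> \<Longrightarrow> \<beta> x1 x2 = f x1 \<otimes>\<^bsub>R\<^esub> g x2"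
  shows "sweedler2 K h R x \<beta> = (f \<otimes>\<^bsub>points K A h R\<^esub> g) x"
proof -
  interpret R: algebra K R by fact
  show ?thesis
    by (rule sweedler2_push_points[OF assms(1-3) R.module_axioms linear_map_id assms(4,5)])
qed

lemma sweedler3_push_points:
  assumes R: "algebra K R" "f \<in> alg_points K A R" "g \<in> alg_points K A R" "k \<in> alg_points K A R"
    and N: "module K N" "linear_map K R N \<phi>" and x: "x \<in> carrier A"
    and eq: "\<And>x1 x2 x3. \<lbrakk>x1 \<in> carrier A; x2 \<in> carrier A; x3 \<in> carrier A\<rbrakk> \<Longrightarrow>
      \<beta> x1 x2 x3 = \<phi> (f x1 \<otimes>\<^bsub>R\<^esub> (g x2 \<otimes>\<^bsub>R\<^esub> k x3))"
  shows "sweedler3 K h N x \<beta> = \<phi> ((f \<otimes>\<^bsub>points K A h R\<^esub> (g \<otimes>\<^bsub>points K A h R\<^esub> k)) x)"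
  unfolding sweedler3_def
proof (rule sweedler2_push_points[OF R(1,2) points_mult_closed[OF R(1,3,4)] N x])
  fix x1 y assume "x1 \<in> carrier A" "y \<in> carrier A"
  then show "sweedler2 K h N y (\<beta> x1) = \<phi> (f x1 \<otimes>\<^bsub>R\<^esub> (g \<otimes>\<^bsub>points K A h R\<^esub> k) y)"
    using algebra_hom_closed[OF alg_points_hom[OF R(2)]]
    by (intro sweedler2_push_points[OF R(1,3,4) N(1), where \<phi> = "\<lambda>r. \<phi> (f x1 \<otimes>\<^bsub>R\<^esub> r)"]
        linear_map_comp[OF N(2)] linear_map_mult_right[OF R(1) linear_map_id] eq)
qed

lemma sweedler3_points:
  assumes "algebra K R" "f \<in> alg_points K A R" "g \<in> alg_points K A R" "k \<in> alg_points K A R"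
    and "x \<in> carrier A"
    and "\<And>x1 x2 x3. \<lbrakk>x1 \<in> carrier A; x2 \<in> carrier A; x3 \<in> carrier A\<rbrakk> \<Longrightarrow>
      \<beta> x1 x2 x3 = f x1 \<otimes>\<^bsub>R\<^esub> (g x2 \<otimes>\<^bsub>R\<^esub> k x3)"
  shows "sweedler3 K h R x \<beta> = (f \<otimes>\<^bsub>points K A h R\<^esub> (g \<otimes>\<^bsub>points K A h R\<^esub> k)) x"
proof -
  interpret R: algebra K R by fact
  show ?thesis
    by (rule sweedler3_push_points[OF assms(1-4) R.module_axioms linear_map_id assms(5,6)])
qed

lemma sweedler4_points:
  assumes R: "algebra K R" "f \<in> alg_points K A R" "g \<in> alg_points K A R" "k \<in> alg_points K A R"
      "l \<in> alg_points K A R" and x: "x \<in> carrier A"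
    and eq: "\<And>x1 x2 x3 x4. \<lbrakk>x1 \<in> carrier A; x2 \<in> carrier A; x3 \<in> carrier A; x4 \<in> carrier A\<rbrakk> \<Longrightarrow>
      \<beta> x1 x2 x3 x4 = f x1 \<otimes>\<^bsub>R\<^esub> (g x2 \<otimes>\<^bsub>R\<^esub> (k x3 \<otimes>\<^bsub>R\<^esub> l x4))"
  shows "sweedler4 K h R x \<beta> =
    (f \<otimes>\<^bsub>points K A h R\<^esub> (g \<otimes>\<^bsub>points K A h R\<^esub> (k \<otimes>\<^bsub>points K A h R\<^esub> l))) x"
proof -
  interpret R: algebra K R by fact
  show ?thesis
    unfolding sweedler4_def
  proof (rule sweedler2_points[OF R(1,2) points_mult_closed[OF R(1,3) points_mult_closed[OF R(1,4,5)]] x])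
    fix x1 y assume "x1 \<in> carrier A" "y \<in> carrier A"
    then show "sweedler3 K h R y (\<beta> x1) =
        f x1 \<otimes>\<^bsub>R\<^esub> (g \<otimes>\<^bsub>points K A h R\<^esub> (k \<otimes>\<^bsub>points K A h R\<^esub> l)) y"
      using algebra_hom_closed[OF alg_points_hom[OF R(2)]]
      by (intro sweedler3_push_points[OF R(1,3-5) R.module_axioms, where \<phi> = "\<lambda>r. f x1 \<otimes>\<^bsub>R\<^esub> r"]
          linear_map_mult_right[OF R(1) linear_map_id] eq)
  qed
qed

text \<open>Naturality in \<open>R\<close>: a homomorphism out of \<open>R\<close> passes inside the
  convolution sum and splits over the product there. Through it identities at generic points spread
  to all points.\<close>

lemma compose_points_mult:
  assumes R: "algebra K R" "f \<in> alg_points K A R" "g \<in> alg_points K A R"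
    and R': "algebra K R'" and \<phi>: "algebra_hom K R R' \<phi>"
  shows "compose (carrier A) \<phi> (f \<otimes>\<^bsub>points K A h R\<^esub> g) =
    compose (carrier A) \<phi> f \<otimes>\<^bsub>points K A h R'\<^esub> compose (carrier A) \<phi> g"
proof (rule alg_points_eqI)
  note c = compose_alg_points[OF algebra_axioms \<phi>]
  interpret R': algebra K R' by fact
  show "compose (carrier A) \<phi> (f \<otimes>\<^bsub>points K A h R\<^esub> g) \<in> alg_points K A R'"
    by (rule c[OF points_mult_closed[OF R]])
  show "compose (carrier A) \<phi> f \<otimes>\<^bsub>points K A h R'\<^esub> compose (carrier A) \<phi> g \<in> alg_points K A R'"
    by (rule points_mult_closed[OF R' c[OF R(2)] c[OF R(3)]])
  fix x assume x: "x \<in> carrier A"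
  have "sweedler2 K h R' x (\<lambda>x1 x2. compose (carrier A) \<phi> f x1 \<otimes>\<^bsub>R'\<^esub> compose (carrier A) \<phi> g x2) =
      \<phi> ((f \<otimes>\<^bsub>points K A h R\<^esub> g) x)"
    by (rule sweedler2_push_points[OF R R'.module_axioms algebra_hom_linear[OF \<phi>] x])
      (simp add: compose_eq algebra_hom_mult[OF \<phi>] algebra_hom_closed[OF alg_points_hom[OF R(2)]]
        algebra_hom_closed[OF alg_points_hom[OF R(3)]])
  then show "compose (carrier A) \<phi> (f \<otimes>\<^bsub>points K A h R\<^esub> g) x =
      (compose (carrier A) \<phi> f \<otimes>\<^bsub>points K A h R'\<^esub> compose (carrier A) \<phi> g) x"
    by (simp add: compose_eq points_mult x)
qed

lemma compose_points_one:
  assumes "algebra K R" "algebra K R'" "algebra_hom K R R' \<phi>"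
  shows "compose (carrier A) \<phi> \<one>\<^bsub>points K A h R\<^esub> = \<one>\<^bsub>points K A h R'\<^esub>"
proof -
  interpret R: algebra K R by fact
  show ?thesis
    by (rule ext) (simp add: compose_def points_def algebra_hom_smult[OF assms(3)] counit_closed
        algebra_hom_one[OF assms(3)])
qed

lemma compose_points_hom:
  assumes "algebra K R" "algebra K R'" "algebra_hom K R R' \<phi>"
  shows "compose (carrier A) \<phi> \<in> hom (points K A h R) (points K A h R')"
  using compose_points_mult[OF assms(1) _ _ assms(2,3)] compose_alg_points[OF algebra_axioms assms(3)]
  by (intro homI) simp_all

lemma compose_points_inv:
  assumes "algebra K R" "algebra K R'" "algebra_hom K R R' \<phi>"
    and "group (points K A h R)" "group (points K A h R')" "f \<in> alg_points K A R"
  shows "compose (carrier A) \<phi> (inv\<^bsub>points K A h R\<^esub> f) = inv\<^bsub>points K A h R'\<^esub> (compose (carrier A) \<phi> f)"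
proof -
  interpret group_hom "points K A h R" "points K A h R'" "compose (carrier A) \<phi>"
    using assms compose_points_hom by (simp add: group_hom_def group_hom_axioms_def)
  show ?thesis using hom_inv assms(6) by simp
qed

end

section \<open>Commutative Hopf algebras and their groups of points\<close>

text \<open>The generic single point: any point \<open>f\<close>, read as a homomorphism out of
  \<open>A\<close>, carries it to \<open>f\<close>.\<close>

definition point_id :: "('k, 'a, 'n) module_scheme \<Rightarrow> 'a \<Rightarrow> 'a"
  where "point_id A = (\<lambda>x\<in>carrier A. x)"

text \<open>
  Any pair (triple) of points in \<open>R\<close> is the image of the one below under a homomorphism to \<open>R\<close>,
  so a natural identity between points only has to be checked here.
\<close>

context
  fixes K :: "('k, 'm) ring_scheme" and A :: "('k, 'a, 'n) module_scheme"
begin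

definition point2_1 :: "'a \<Rightarrow> ('a, 'a, 'k) tensor"
  where "point2_1 = (\<lambda>x\<in>carrier A. tensor K A A x \<one>\<^bsub>A\<^esub>)"

definition point2_2 :: "'a \<Rightarrow> ('a, 'a, 'k) tensor"
  where "point2_2 = (\<lambda>x\<in>carrier A. tensor K A A \<one>\<^bsub>A\<^esub> x)"

definition point3_1 :: "'a \<Rightarrow> ('a, ('a, 'a, 'k) tensor, 'k) tensor"
  where "point3_1 = (\<lambda>x\<in>carrier A. tensor3 K A x \<one>\<^bsub>A\<^esub> \<one>\<^bsub>A\<^esub>)"

definition point3_2 :: "'a \<Rightarrow> ('a, ('a, 'a, 'k) tensor, 'k) tensor"
  where "point3_2 = (\<lambda>x\<in>carrier A. tensor3 K A \<one>\<^bsub>A\<^esub> x \<one>\<^bsub>A\<^esub>)"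

definition point3_3 :: "'a \<Rightarrow> ('a, ('a, 'a, 'k) tensor, 'k) tensor"
  where "point3_3 = (\<lambda>x\<in>carrier A. tensor3 K A \<one>\<^bsub>A\<^esub> \<one>\<^bsub>A\<^esub> x)"

end

lemma point_id_closed: "algebra K A \<Longrightarrow> point_id A \<in> alg_points K A A"
  unfolding point_id_def by (rule restrict_alg_points[OF _ algebra_hom_id])

lemma compose_point_id: "f \<in> alg_points K A R \<Longrightarrow> compose (carrier A) f (point_id A) = f"
  unfolding alg_points_def compose_def point_id_def by (auto intro: extensionalityI)

lemma point2_closed:
  assumes "algebra K A"
  shows "point2_1 K A \<in> alg_points K A (tensor_algebra K A A)"
    "point2_2 K A \<in> alg_points K A (tensor_algebra K A A)"
  unfolding point2_1_def point2_2_def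
  by (rule restrict_alg_points[OF assms algebra_hom_tensor_left[OF assms assms]])
    (rule restrict_alg_points[OF assms algebra_hom_tensor_right[OF assms assms]])

lemma point2_mult:
  assumes "algebra K A" "x \<in> carrier A" "y \<in> carrier A"
  shows "tensor K A A x y = point2_1 K A x \<otimes>\<^bsub>tensor_algebra K A A\<^esub> point2_2 K A y"
proof -
  interpret A: algebra K A by fact
  show ?thesis
    using assms(2,3) by (simp add: point2_1_def point2_2_def tensor_mult[OF assms(1) assms(1)])
qed

lemma compose_point2:
  assumes A: "algebra K A" and "algebra K R" "f \<in> alg_points K A R" "g \<in> alg_points K A R"
  shows "compose (carrier A) (tensor_pair K R f g) (point2_1 K A) = f"
    "compose (carrier A) (tensor_pair K R f g) (point2_2 K A) = g"
proof -
  note h = A A assms(2) alg_points_hom[OF assms(3)] alg_points_hom[OF assms(4)]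
  note c = compose_alg_points[OF A algebra_hom_tensor_pair[OF h]]
  show "compose (carrier A) (tensor_pair K R f g) (point2_1 K A) = f"
    by (rule alg_points_eqI[OF c[OF point2_closed(1)[OF A]] assms(3)])
      (simp add: compose_eq point2_1_def tensor_pair_left[OF h])
  show "compose (carrier A) (tensor_pair K R f g) (point2_2 K A) = g"
    by (rule alg_points_eqI[OF c[OF point2_closed(2)[OF A]] assms(4)])
      (simp add: compose_eq point2_2_def tensor_pair_right[OF h])
qed

section \<open>Hopf algebra axioms as group laws at generic points\<close>

context pre_bialgebra
begin

lemma algebra_tensor2: "algebra K (tensor_algebra K A A)"
  by (rule algebra_tensor_algebra[OF algebra_axioms algebra_axioms])

lemma algebra_tensor3: "algebra K (tensor_algebra3 K A)"
  unfolding tensor_algebra3_def by (rule algebra_tensor_algebra[OF algebra_axioms algebra_tensor2])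

lemma point3_closed: "point3_1 K A \<in> alg_points K A (tensor_algebra3 K A)"
  "point3_2 K A \<in> alg_points K A (tensor_algebra3 K A)"
  "point3_3 K A \<in> alg_points K A (tensor_algebra3 K A)"
proof -
  let ?AA = "tensor_algebra K A A"
  note l = algebra_hom_tensor_left[OF algebra_axioms algebra_tensor2]
  note r = algebra_hom_tensor_right[OF algebra_axioms algebra_tensor2]
  note l2 = algebra_hom_tensor_left[OF algebra_axioms algebra_axioms]
  note r2 = algebra_hom_tensor_right[OF algebra_axioms algebra_axioms]
  show "point3_1 K A \<in> alg_points K A (tensor_algebra3 K A)"
    unfolding point3_1_def tensor3_def tensor_algebra3_def
    using l by (intro restrict_alg_points[OF algebra_axioms]) (simp add: tensor_algebra_simps(5))
  show "point3_2 K A \<in> alg_points K A (tensor_algebra3 K A)"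
    unfolding point3_2_def tensor3_def tensor_algebra3_def
    by (rule restrict_alg_points[OF algebra_axioms algebra_hom_comp[OF r l2]])
  show "point3_3 K A \<in> alg_points K A (tensor_algebra3 K A)"
    unfolding point3_3_def tensor3_def tensor_algebra3_def
    by (rule restrict_alg_points[OF algebra_axioms algebra_hom_comp[OF r r2]])
qed

lemma point3_mult:
  "\<lbrakk>x \<in> carrier A; y \<in> carrier A; z \<in> carrier A\<rbrakk> \<Longrightarrow>
    tensor3 K A x y z =
      point3_1 K A x \<otimes>\<^bsub>tensor_algebra3 K A\<^esub> (point3_2 K A y \<otimes>\<^bsub>tensor_algebra3 K A\<^esub> point3_3 K A z)"
  by (simp add: point3_1_def point3_2_def point3_3_def tensor3_def tensor_algebra3_def
      tensor_mult[OF algebra_axioms algebra_axioms] tensor_mult[OF algebra_axioms algebra_tensor2]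
      tensor_closed[OF module_axioms module_axioms])

lemma compose_point3:
  fixes R :: "('k, 'r, 'q) module_scheme"
  assumes R: "algebra K R" and f: "f \<in> alg_points K A R" and g: "g \<in> alg_points K A R"
    and k: "k \<in> alg_points K A R"
  defines "\<phi> \<equiv> tensor_pair K R f (tensor_pair K R g k)"
  shows "algebra_hom K (tensor_algebra3 K A) R \<phi>"
    "compose (carrier A) \<phi> (point3_1 K A) = f"
    "compose (carrier A) \<phi> (point3_2 K A) = g"
    "compose (carrier A) \<phi> (point3_3 K A) = k"
proof -
  interpret R: algebra K R by fact
  note h2 = algebra_axioms algebra_axioms R alg_points_hom[OF g] alg_points_hom[OF k]
  note p2 = algebra_hom_tensor_pair[OF h2]
  note h3 = algebra_axioms algebra_tensor2 R alg_points_hom[OF f] p2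
  show hom: "algebra_hom K (tensor_algebra3 K A) R \<phi>"
    unfolding \<phi>_def tensor_algebra3_def by (rule algebra_hom_tensor_pair[OF h3])
  note c = compose_alg_points[OF algebra_axioms hom]
  note tc = tensor_closed[OF module_axioms module_axioms]
  note ev = \<phi>_def tensor3_def tensor_pair_tensor[OF h3] tensor_pair_tensor[OF h2] tc
    algebra_hom_one[OF alg_points_hom[OF f]] algebra_hom_one[OF alg_points_hom[OF g]]
    algebra_hom_one[OF alg_points_hom[OF k]] algebra_hom_closed[OF alg_points_hom[OF f]]
    algebra_hom_closed[OF alg_points_hom[OF g]] algebra_hom_closed[OF alg_points_hom[OF k]]
  show "compose (carrier A) \<phi> (point3_1 K A) = f"
    by (rule alg_points_eqI[OF c[OF point3_closed(1)] f]) (simp add: compose_eq point3_1_def ev)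
  show "compose (carrier A) \<phi> (point3_2 K A) = g"
    by (rule alg_points_eqI[OF c[OF point3_closed(2)] g]) (simp add: compose_eq point3_2_def ev)
  show "compose (carrier A) \<phi> (point3_3 K A) = k"
    by (rule alg_points_eqI[OF c[OF point3_closed(3)] k]) (simp add: compose_eq point3_3_def ev)
qed

text \<open>The Yoneda description of the coproduct: at the generic pair the convolution sum is the
  sum of the \<open>x1 \<otimes> x2\<close>, and lifting \<open>tensor\<close> gives the identity of
  \<open>A \<otimes> A\<close>.\<close>

lemma comult_eq_point2:
  assumes "x \<in> carrier A"
  shows "comult h x = (point2_1 K A \<otimes>\<^bsub>points K A h (tensor_algebra K A A)\<^esub> point2_2 K A) x"
proof -
  let ?AA = "tensor_algebra K A A"
  interpret T: algebra K "?AA" by (rule algebra_tensor2)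
  note b = bilinear_map_tensor[OF module_axioms module_axioms]
  have "sweedler2 K h ?AA x (\<lambda>x1 x2. tensor K A A x1 x2) =
      (point2_1 K A \<otimes>\<^bsub>points K A h ?AA\<^esub> point2_2 K A) x"
    by (rule sweedler2_points[OF algebra_tensor2 point2_closed[OF algebra_axioms] assms point2_mult[OF algebra_axioms]])
  moreover have "sweedler2 K h ?AA x (\<lambda>x1 x2. tensor K A A x1 x2) = comult h x"
    unfolding sweedler2_def
    by (rule linear_map_tensor_eqI[OF module_axioms module_axioms
          linear_tensor_lift[OF module_axioms module_axioms T.module_axioms b] linear_map_id _ comult_closed[OF assms]])
      (rule tensor_lift_tensor[OF module_axioms module_axioms T.module_axioms b])
  ultimately show ?thesis by simp
qed

text \<open>The two sides of coassociativity are the two bracketings of the product of the generic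
  triple; \<open>coassoc_right\<close> treats the other one.\<close>

lemma coassoc_left:
  assumes "x \<in> carrier A"
  shows "sweedler2 K h (tensor_algebra3 K A) x
      (\<lambda>y x3. sweedler2 K h (tensor_algebra3 K A) y (\<lambda>x1 x2. tensor3 K A x1 x2 x3)) =
    ((point3_1 K A \<otimes>\<^bsub>points K A h (tensor_algebra3 K A)\<^esub> point3_2 K A)
      \<otimes>\<^bsub>points K A h (tensor_algebra3 K A)\<^esub> point3_3 K A) x"
proof (rule sweedler2_points[OF algebra_tensor3 points_mult_closed[OF algebra_tensor3 point3_closed(1,2)]
      point3_closed(3) assms])
  interpret T: algebra K "tensor_algebra3 K A" by (rule algebra_tensor3)
  note cl = algebra_hom_closed[OF alg_points_hom[OF point3_closed(1)]]
    algebra_hom_closed[OF alg_points_hom[OF point3_closed(2)]]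
    algebra_hom_closed[OF alg_points_hom[OF point3_closed(3)]]
  fix y x3 assume "y \<in> carrier A" "x3 \<in> carrier A"
  then show "sweedler2 K h (tensor_algebra3 K A) y (\<lambda>x1 x2. tensor3 K A x1 x2 x3) =
      (point3_1 K A \<otimes>\<^bsub>points K A h (tensor_algebra3 K A)\<^esub> point3_2 K A) y \<otimes>\<^bsub>tensor_algebra3 K A\<^esub> point3_3 K A x3"
    by (intro sweedler2_push_points[OF algebra_tensor3 point3_closed(1,2) T.module_axioms,
          where \<phi> = "\<lambda>r. r \<otimes>\<^bsub>tensor_algebra3 K A\<^esub> point3_3 K A x3"]
        linear_map_mult_left[OF algebra_tensor3 linear_map_id])
      (simp_all add: cl point3_mult T.m_assoc)
qed

lemma coassoc_right:
  assumes "x \<in> carrier A"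
  shows "sweedler2 K h (tensor_algebra3 K A) x
      (\<lambda>x1 y. sweedler2 K h (tensor_algebra3 K A) y (\<lambda>x2 x3. tensor3 K A x1 x2 x3)) =
    (point3_1 K A \<otimes>\<^bsub>points K A h (tensor_algebra3 K A)\<^esub>
      (point3_2 K A \<otimes>\<^bsub>points K A h (tensor_algebra3 K A)\<^esub> point3_3 K A)) x"
  using sweedler3_points[OF algebra_tensor3 point3_closed assms point3_mult]
  unfolding sweedler3_def .

text \<open>Coassociativity is associativity at the generic triple, while the counit and antipode
  axioms are the unit and inverse laws at \<open>point_id\<close>. Hence only two groups of points
  appear in the hypotheses.\<close>

lemma hopf_algebraI:
  assumes K: "field K" and S: "algebra_hom K A A (antipode h)"
    and grp3: "group (points K A h (tensor_algebra3 K A))" and grp: "group (points K A h A)"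
    and inv: "inv\<^bsub>points K A h A\<^esub> point_id A = restrict (antipode h) (carrier A)"
  shows "hopf_algebra K A h"
proof (intro hopf_algebra.intro hopf_algebra_axioms.intro)
  let ?P = "points K A h A" and ?S = "restrict (antipode h) (carrier A)"
  interpret P3: group "points K A h (tensor_algebra3 K A)" by (rule grp3)
  interpret P: group "?P" by (rule grp)
  note pid = point_id_closed[OF algebra_axioms]
  have S': "?S \<in> alg_points K A A"
    by (rule restrict_alg_points[OF algebra_axioms S])
  show "assoc_algebra K A" by (rule assoc_algebra_if_algebra[OF K algebra_axioms])
  show "linear_map K A A (antipode h)" by (rule algebra_hom_linear[OF S])
  fix x assume x: "x \<in> carrier A"
  show "sweedler2 K h (tensor_algebra3 K A) x
        (\<lambda>y x3. sweedler2 K h (tensor_algebra3 K A) y (\<lambda>x1 x2. tensor3 K A x1 x2 x3)) =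
      sweedler2 K h (tensor_algebra3 K A) x
        (\<lambda>x1 y. sweedler2 K h (tensor_algebra3 K A) y (\<lambda>x2 x3. tensor3 K A x1 x2 x3))"
    unfolding coassoc_left[OF x] coassoc_right[OF x]
    using P3.m_assoc point3_closed by simp
  have "sweedler2 K h A x (\<lambda>x1 x2. counit h x1 \<odot>\<^bsub>A\<^esub> x2) = (\<one>\<^bsub>?P\<^esub> \<otimes>\<^bsub>?P\<^esub> point_id A) x"
    by (rule sweedler2_points[OF algebra_axioms points_one_closed[OF algebra_axioms] pid x])
      (simp add: points_one point_id_def counit_closed smult_assoc2)
  then show "sweedler2 K h A x (\<lambda>x1 x2. counit h x1 \<odot>\<^bsub>A\<^esub> x2) = x"
    using P.l_one[of "point_id A"] pid x by (simp add: point_id_def)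
  have "sweedler2 K h A x (\<lambda>x1 x2. counit h x2 \<odot>\<^bsub>A\<^esub> x1) = (point_id A \<otimes>\<^bsub>?P\<^esub> \<one>\<^bsub>?P\<^esub>) x"
    by (rule sweedler2_points[OF algebra_axioms pid points_one_closed[OF algebra_axioms] x])
      (simp add: points_one point_id_def counit_closed smult_assoc_right)
  then show "sweedler2 K h A x (\<lambda>x1 x2. counit h x2 \<odot>\<^bsub>A\<^esub> x1) = x"
    using P.r_one[of "point_id A"] pid x by (simp add: point_id_def)
  have "sweedler2 K h A x (\<lambda>x1 x2. antipode h x1 \<otimes>\<^bsub>A\<^esub> x2) =
      (?S \<otimes>\<^bsub>?P\<^esub> point_id A) x"
    by (rule sweedler2_points[OF algebra_axioms S' pid x]) (simp add: point_id_def)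
  then show "sweedler2 K h A x (\<lambda>x1 x2. antipode h x1 \<otimes>\<^bsub>A\<^esub> x2) = counit h x \<odot>\<^bsub>A\<^esub> \<one>\<^bsub>A\<^esub>"
    using P.l_inv[of "point_id A"] pid x by (simp add: inv points_one)
  have "sweedler2 K h A x (\<lambda>x1 x2. x1 \<otimes>\<^bsub>A\<^esub> antipode h x2) =
      (point_id A \<otimes>\<^bsub>?P\<^esub> ?S) x"
    by (rule sweedler2_points[OF algebra_axioms pid S' x]) (simp add: point_id_def)
  then show "sweedler2 K h A x (\<lambda>x1 x2. x1 \<otimes>\<^bsub>A\<^esub> antipode h x2) = counit h x \<odot>\<^bsub>A\<^esub> \<one>\<^bsub>A\<^esub>"
    using P.r_inv[of "point_id A"] pid x by (simp add: inv points_one)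
qed (rule comult_algebra_hom counit_character)+

end

locale comm_hopf = hopf_algebra K A h + cring A
  for K :: "('k, 'm) ring_scheme"
    and A :: "('k, 'a, 'n) module_scheme"
    and h :: "('k, 'a, 's) hopf_scheme"

sublocale comm_hopf \<subseteq> pre: pre_bialgebra K A h
  by (intro pre_bialgebra.intro pre_bialgebra_axioms.intro algebra_if_assoc_algebra
      assoc_algebra_axioms cring_axioms comult_hom counit_hom)

context comm_hopf
begin

text \<open>The axiom is stated for the universal trilinear map \<open>tensor3\<close>. A general
  \<open>T\<close> is \<open>tensor3\<close> followed by a linear map \<open>\<Phi>\<close>, which
  is moved out of the Sweedler sums, past the axiom, and back in.\<close>

lemma coassoc_trilinear:
  fixes M :: "('k, 'c, 'q) module_scheme"
  assumes M: "module K M" and T1: "\<And>x. x \<in> carrier A \<Longrightarrow> bilinear_map K A A M (T x)"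
    and T2: "\<And>y z. \<lbrakk>y \<in> carrier A; z \<in> carrier A\<rbrakk> \<Longrightarrow> linear_map K A M (\<lambda>x. T x y z)"
    and x: "x \<in> carrier A"
  shows "sweedler2 K h M x (\<lambda>u x3. sweedler2 K h M u (\<lambda>x1 x2. T x1 x2 x3)) =
    sweedler2 K h M x (\<lambda>x1 u. sweedler2 K h M u (T x1))"
proof -
  let ?AA = "tensor_algebra K A A" and ?R = "tensor_algebra3 K A"
  note mA = module_axioms
  have mAA: "module K ?AA" by (rule module_tensor_algebra[OF mA mA])
  have mR: "module K ?R" unfolding tensor_algebra3_def by (rule module_tensor_algebra[OF mA mAA])
  define \<Phi> where "\<Phi> = tensor_lift K M (\<lambda>a Y. tensor_lift K M (T a) Y)"
  have b\<Phi>: "bilinear_map K A ?AA M (\<lambda>a Y. tensor_lift K M (T a) Y)"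
    by (intro bilinear_mapI linear_tensor_lift[OF mA mA M T1] linear_tensor_lift_param[OF mA mA M mA T1 T2])
  have \<Phi>: "linear_map K ?R M \<Phi>"
    unfolding \<Phi>_def tensor_algebra3_def by (rule linear_tensor_lift[OF mA mAA M b\<Phi>])
  have \<Phi>3: "\<Phi> (tensor3 K A x1 x2 x3) = T x1 x2 x3"
    if "x1 \<in> carrier A" "x2 \<in> carrier A" "x3 \<in> carrier A" for x1 x2 x3
    unfolding \<Phi>_def tensor3_def using that
    by (simp add: tensor_lift_tensor[OF mA mAA M b\<Phi>] tensor_lift_tensor[OF mA mA M T1]
        tensor_closed[OF mA mA])
  have t3: "linear_map K A ?R (\<lambda>a. tensor3 K A a x2 x3)" "linear_map K A ?R (\<lambda>a. tensor3 K A x2 a x3)"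
    "linear_map K A ?R (\<lambda>a. tensor3 K A x2 x3 a)"
    if "x2 \<in> carrier A" "x3 \<in> carrier A" for x2 x3
    unfolding tensor3_def tensor_algebra3_def
    by (intro linear_map_tensor_left[OF mA mAA] linear_map_tensor_right[OF mA mAA]
        linear_map_tensor_left[OF mA mA] linear_map_tensor_right[OF mA mA] linear_map_id
        tensor_closed[OF mA mA] that)+
  have bT: "bilinear_map K A A M (\<lambda>x1 x2. T x1 x2 x3)" if "x3 \<in> carrier A" for x3
    using that T2 bilinear_map_left[OF T1] by (intro bilinear_mapI) blast+
  have "sweedler2 K h M x (\<lambda>u x3. sweedler2 K h M u (\<lambda>x1 x2. T x1 x2 x3)) =
      sweedler2 K h M x (\<lambda>u x3. \<Phi> (sweedler2 K h ?R u (\<lambda>x1 x2. tensor3 K A x1 x2 x3)))"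
  proof (rule pre.sweedler2_cong[OF M _ x])
    show eq: "sweedler2 K h M u (\<lambda>x1 x2. T x1 x2 x3) =
        \<Phi> (sweedler2 K h ?R u (\<lambda>x1 x2. tensor3 K A x1 x2 x3))"
      if "u \<in> carrier A" "x3 \<in> carrier A" for u x3
    proof -
      have "\<Phi> (sweedler2 K h ?R u (\<lambda>x1 x2. tensor3 K A x1 x2 x3)) =
          sweedler2 K h M u (\<lambda>x1 x2. \<Phi> (tensor3 K A x1 x2 x3))"
        by (rule pre.linear_map_sweedler2[OF mR M _ \<Phi> that(1)]) (intro bilinear_mapI t3 that)
      also have "\<dots> = sweedler2 K h M u (\<lambda>x1 x2. T x1 x2 x3)"
        by (rule pre.sweedler2_cong[OF M bT[OF that(2)] that(1)]) (rule \<Phi>3[OF _ _ that(2)])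
      finally show ?thesis ..
    qed
    show "bilinear_map K A A M (\<lambda>u x3. \<Phi> (sweedler2 K h ?R u (\<lambda>x1 x2. tensor3 K A x1 x2 x3)))"
      by (intro bilinear_mapI linear_map_comp[OF \<Phi>] pre.linear_sweedler2_param[OF mR mA]
          pre.linear_sweedler2[OF mR] t3)
  qed
  also have "\<dots> = \<Phi> (sweedler2 K h ?R x (\<lambda>u x3. sweedler2 K h ?R u (\<lambda>x1 x2. tensor3 K A x1 x2 x3)))"
    by (rule pre.linear_map_sweedler2[OF mR M _ \<Phi> x, symmetric])
      (intro bilinear_mapI pre.linear_sweedler2_param[OF mR mA] pre.linear_sweedler2[OF mR] t3)
  also have "\<dots> = \<Phi> (sweedler2 K h ?R x (\<lambda>x1 u. sweedler2 K h ?R u (\<lambda>x2 x3. tensor3 K A x1 x2 x3)))"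
    by (simp only: coassoc[OF x])
  also have "\<dots> = sweedler2 K h M x (\<lambda>x1 u. \<Phi> (sweedler2 K h ?R u (\<lambda>x2 x3. tensor3 K A x1 x2 x3)))"
    by (rule pre.linear_map_sweedler2[OF mR M _ \<Phi> x])
      (intro bilinear_mapI pre.linear_sweedler2_param[OF mR mA] pre.linear_sweedler2[OF mR] t3)
  also have "\<dots> = sweedler2 K h M x (\<lambda>x1 u. sweedler2 K h M u (T x1))"
  proof (rule pre.sweedler2_cong[OF M _ x])
    show "\<Phi> (sweedler2 K h ?R u (\<lambda>x2 x3. tensor3 K A x1 x2 x3)) = sweedler2 K h M u (T x1)"
      if "x1 \<in> carrier A" "u \<in> carrier A" for x1 u
    proof -
      have "\<Phi> (sweedler2 K h ?R u (\<lambda>x2 x3. tensor3 K A x1 x2 x3)) =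
          sweedler2 K h M u (\<lambda>x2 x3. \<Phi> (tensor3 K A x1 x2 x3))"
        by (rule pre.linear_map_sweedler2[OF mR M _ \<Phi> that(2)]) (intro bilinear_mapI t3 that)
      also have "\<dots> = sweedler2 K h M u (T x1)"
        by (rule pre.sweedler2_cong[OF M T1[OF that(1)] that(2)]) (rule \<Phi>3[OF that(1)])
      finally show ?thesis .
    qed
    show "bilinear_map K A A M (\<lambda>x1 u. sweedler2 K h M u (T x1))"
      by (intro bilinear_mapI pre.linear_sweedler2[OF M T1] pre.linear_sweedler2_param[OF M mA T1 T2])
  qed
  finally show ?thesis .
qed

end

context comm_hopf
begin

text \<open>
  Multiplicativity of the antipode: \<open>x \<otimes> y \<mapsto> x y\<^sub>1 \<otimes> y\<^sub>2\<close> is an algebra endomorphism of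
  \<open>A \<otimes> A\<close> with linear inverse \<open>x \<otimes> y \<mapsto> x S(y\<^sub>1) \<otimes> y\<^sub>2\<close>, so the inverse is multiplicative
  too, and \<open>S\<close> is obtained from it by restricting to \<open>1 \<otimes> y\<close> and applying the counit.
  The two maps are \<open>shear F\<close> for \<open>F\<close> the identity and the antipode.
\<close>

definition shear_right :: "('a \<Rightarrow> 'a) \<Rightarrow> 'a \<Rightarrow> ('a, 'a, 'k) tensor"
  where "shear_right F y = sweedler2 K h (tensor_algebra K A A) y (\<lambda>y1 y2. tensor K A A (F y1) y2)"

definition shear :: "('a \<Rightarrow> 'a) \<Rightarrow> ('a, 'a, 'k) tensor \<Rightarrow> ('a, 'a, 'k) tensor"
  where "shear F = tensor_lift K (tensor_algebra K A A)
    (\<lambda>x y. tensor K A A x \<one>\<^bsub>A\<^esub> \<otimes>\<^bsub>tensor_algebra K A A\<^esub> shear_right F y)"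

lemma bilinear_tensor_left:
  assumes "linear_map K A A F"
  shows "bilinear_map K A A (tensor_algebra K A A) (\<lambda>y1 y2. tensor K A A (F y1) y2)"
  using assms linear_map_closed[OF assms]
  by (intro bilinear_mapI linear_map_tensor_left[OF module_axioms module_axioms]
      linear_map_tensor_right[OF module_axioms module_axioms] linear_map_id)

lemma linear_shear_right:
  assumes "linear_map K A A F"
  shows "linear_map K A (tensor_algebra K A A) (shear_right F)"
  unfolding shear_right_def
  by (rule pre.linear_sweedler2[OF module_tensor_algebra[OF module_axioms module_axioms]
        bilinear_tensor_left[OF assms]])

lemma bilinear_shear:
  assumes "linear_map K A A F"
  shows "bilinear_map K A A (tensor_algebra K A A)
    (\<lambda>x y. tensor K A A x \<one>\<^bsub>A\<^esub> \<otimes>\<^bsub>tensor_algebra K A A\<^esub> shear_right F y)"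
  by (rule bilinear_map_mult[OF pre.algebra_tensor2 _ linear_shear_right[OF assms]])
    (rule linear_map_tensor_left[OF module_axioms module_axioms linear_map_id one_closed])

lemma linear_shear:
  assumes "linear_map K A A F"
  shows "linear_map K (tensor_algebra K A A) (tensor_algebra K A A) (shear F)"
  unfolding shear_def
  by (rule linear_tensor_lift[OF module_axioms module_axioms
        module_tensor_algebra[OF module_axioms module_axioms] bilinear_shear[OF assms]])

lemma shear_tensor:
  assumes "linear_map K A A F" "x \<in> carrier A" "y \<in> carrier A"
  shows "shear F (tensor K A A x y) = tensor K A A x \<one>\<^bsub>A\<^esub> \<otimes>\<^bsub>tensor_algebra K A A\<^esub> shear_right F y"
  unfolding shear_def
  by (rule tensor_lift_tensor[OF module_axioms module_axioms
        module_tensor_algebra[OF module_axioms module_axioms] bilinear_shear[OF assms(1)] assms(2,3)])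

text \<open>Linearity over the left factor reduces a composite of two shears to its values at
  \<open>1 \<otimes> y\<close>.\<close>

lemma shear_mult_left:
  assumes F: "linear_map K A A F" and x: "x \<in> carrier A" and Y: "Y \<in> carrier (tensor_algebra K A A)"
  shows "shear F (tensor K A A x \<one>\<^bsub>A\<^esub> \<otimes>\<^bsub>tensor_algebra K A A\<^esub> Y) =
    tensor K A A x \<one>\<^bsub>A\<^esub> \<otimes>\<^bsub>tensor_algebra K A A\<^esub> shear F Y"
proof -
  let ?AA = "tensor_algebra K A A"
  interpret T: algebra K "?AA" by (rule pre.algebra_tensor2)
  note tc = tensor_closed[OF module_axioms module_axioms]
  note tm = tensor_mult[OF pre.algebra_axioms pre.algebra_axioms]
  show ?thesis
  proof (rule linear_map_tensor_eqI[OF module_axioms module_axioms _ _ _ Y])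
    show "linear_map K ?AA ?AA
        (\<lambda>Y. shear F (tensor K A A x \<one>\<^bsub>A\<^esub> \<otimes>\<^bsub>?AA\<^esub> Y))"
      by (intro linear_map_comp[OF linear_shear[OF F]] linear_map_mult_right[OF pre.algebra_tensor2 linear_map_id]
          tc x one_closed)
    show "linear_map K ?AA ?AA
        (\<lambda>Y. tensor K A A x \<one>\<^bsub>A\<^esub> \<otimes>\<^bsub>?AA\<^esub> shear F Y)"
      by (intro linear_map_mult_right[OF pre.algebra_tensor2 linear_shear[OF F]] tc x one_closed)
    fix a b assume ab: "a \<in> carrier A" "b \<in> carrier A"
    have "tensor K A A x \<one>\<^bsub>A\<^esub> \<otimes>\<^bsub>?AA\<^esub> tensor K A A a b = tensor K A A (x \<otimes>\<^bsub>A\<^esub> a) b"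
      using ab x by (simp add: tm)
    then have "shear F (tensor K A A x \<one>\<^bsub>A\<^esub> \<otimes>\<^bsub>?AA\<^esub> tensor K A A a b) =
        tensor K A A (x \<otimes>\<^bsub>A\<^esub> a) \<one>\<^bsub>A\<^esub> \<otimes>\<^bsub>?AA\<^esub> shear_right F b"
      using ab x by (simp add: shear_tensor[OF F])
    also have "tensor K A A (x \<otimes>\<^bsub>A\<^esub> a) \<one>\<^bsub>A\<^esub> =
        tensor K A A x \<one>\<^bsub>A\<^esub> \<otimes>\<^bsub>?AA\<^esub> tensor K A A a \<one>\<^bsub>A\<^esub>"
      using ab x by (simp add: tm)
    finally show "shear F (tensor K A A x \<one>\<^bsub>A\<^esub> \<otimes>\<^bsub>?AA\<^esub> tensor K A A a b) =
        tensor K A A x \<one>\<^bsub>A\<^esub> \<otimes>\<^bsub>?AA\<^esub> shear F (tensor K A A a b)"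
      using ab x linear_map_closed[OF linear_shear_right[OF F]] by (simp add: shear_tensor[OF F] T.m_assoc tc)
  qed
qed

text \<open>The composite sends \<open>y\<close> to \<open>F(y1) G(y2) \<otimes> y3\<close>.
  Coassociativity groups the first two legs, the hypothesis turns their convolution into the counit,
  and the counit law removes it.\<close>

lemma shear_shear_right:
  assumes F: "linear_map K A A F" and G: "linear_map K A A G"
    and inv: "\<And>u. u \<in> carrier A \<Longrightarrow>
      sweedler2 K h A u (\<lambda>u1 u2. F u1 \<otimes>\<^bsub>A\<^esub> G u2) = counit h u \<odot>\<^bsub>A\<^esub> \<one>\<^bsub>A\<^esub>"
    and y: "y \<in> carrier A"
  shows "shear G (shear_right F y) = tensor K A A \<one>\<^bsub>A\<^esub> y"
proof -
  let ?AA = "tensor_algebra K A A"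
  interpret T: algebra K ?AA by (rule pre.algebra_tensor2)
  note mA = module_axioms and mAA = T.module_axioms
  note tc = tensor_closed[OF module_axioms module_axioms]
  note tm = tensor_mult[OF pre.algebra_axioms pre.algebra_axioms]
  note Fc = linear_map_closed[OF F] and Gc = linear_map_closed[OF G]
  have bFG: "bilinear_map K A A A (\<lambda>u1 u2. F u1 \<otimes>\<^bsub>A\<^esub> G u2)"
    by (rule bilinear_map_mult[OF pre.algebra_axioms F G])
  have T1: "bilinear_map K A A ?AA (\<lambda>y2 y3. tensor K A A (F y1 \<otimes>\<^bsub>A\<^esub> G y2) y3)" if "y1 \<in> carrier A" for y1
    using bilinear_tensor_left[OF linear_map_mult_right[OF pre.algebra_axioms G Fc[OF that]]] .
  have T2: "linear_map K A ?AA (\<lambda>y1. tensor K A A (F y1 \<otimes>\<^bsub>A\<^esub> G y2) y3)"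
    if "y2 \<in> carrier A" "y3 \<in> carrier A" for y2 y3
    using that by (intro linear_map_tensor_left[OF mA mA] linear_map_mult_left[OF pre.algebra_axioms F] Gc)
  have bu: "bilinear_map K A A ?AA (\<lambda>u y3. counit h u \<odot>\<^bsub>?AA\<^esub> tensor K A A \<one>\<^bsub>A\<^esub> y3)"
  proof (rule bilinear_mapI)
    \<comment> \<open>The ground field is only a ring record and cannot be the target of
      \<open>linear_map\<close>; linearity of the counit is used in the form
      \<open>u \<mapsto> \<epsilon>(u) 1\<close>.\<close>
    have e: "linear_map K A ?AA (\<lambda>u. counit h u \<odot>\<^bsub>?AA\<^esub> \<one>\<^bsub>?AA\<^esub>)"
      by (rule algebra_hom_linear[OF pre.algebra_hom_counit[OF pre.algebra_tensor2]])
    fix u assume u: "u \<in> carrier A"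
    show "linear_map K A ?AA (\<lambda>y3. counit h u \<odot>\<^bsub>?AA\<^esub> tensor K A A \<one>\<^bsub>A\<^esub> y3)"
      by (rule linear_map_cong[OF _ mA linear_map_mult_right[OF pre.algebra_tensor2
              linear_map_tensor_right[OF mA mA linear_map_id one_closed] linear_map_closed[OF e u]]])
        (simp add: pre.counit_closed u tc T.smult_assoc2)
    show "linear_map K A ?AA (\<lambda>v. counit h v \<odot>\<^bsub>?AA\<^esub> tensor K A A \<one>\<^bsub>A\<^esub> u)"
      by (rule linear_map_cong[OF _ mA linear_map_mult_left[OF pre.algebra_tensor2 e tc[OF one_closed u]]])
        (simp add: pre.counit_closed u tc T.smult_assoc2)
  qed
  have "shear G (shear_right F y) = sweedler2 K h ?AA y (\<lambda>y1 u. shear G (tensor K A A (F y1) u))"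
    unfolding shear_right_def
    by (rule pre.linear_map_sweedler2[OF mAA mAA bilinear_tensor_left[OF F] linear_shear[OF G] y])
  also have "\<dots> = sweedler2 K h ?AA y (\<lambda>y1 u. sweedler2 K h ?AA u (\<lambda>y2 y3. tensor K A A (F y1 \<otimes>\<^bsub>A\<^esub> G y2) y3))"
  proof (rule pre.sweedler2_cong[OF mAA _ y])
    show "bilinear_map K A A ?AA (\<lambda>y1 u. sweedler2 K h ?AA u (\<lambda>y2 y3. tensor K A A (F y1 \<otimes>\<^bsub>A\<^esub> G y2) y3))"
      by (intro bilinear_mapI pre.linear_sweedler2[OF mAA T1] pre.linear_sweedler2_param[OF mAA mA T1 T2])
    fix y1 u assume y1: "y1 \<in> carrier A" and u: "u \<in> carrier A"
    have "shear G (tensor K A A (F y1) u) = tensor K A A (F y1) \<one>\<^bsub>A\<^esub> \<otimes>\<^bsub>?AA\<^esub> shear_right G u"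
      by (rule shear_tensor[OF G Fc[OF y1] u])
    also have "\<dots> = sweedler2 K h ?AA u (\<lambda>y2 y3. tensor K A A (F y1) \<one>\<^bsub>A\<^esub> \<otimes>\<^bsub>?AA\<^esub> tensor K A A (G y2) y3)"
      unfolding shear_right_def
      by (rule pre.linear_map_sweedler2[OF mAA mAA bilinear_tensor_left[OF G] _ u])
        (rule linear_map_mult_right[OF pre.algebra_tensor2 linear_map_id tc[OF Fc[OF y1] one_closed]])
    also have "\<dots> = sweedler2 K h ?AA u (\<lambda>y2 y3. tensor K A A (F y1 \<otimes>\<^bsub>A\<^esub> G y2) y3)"
      by (rule pre.sweedler2_cong[OF mAA T1[OF y1] u]) (simp add: tm Fc Gc y1)
    finally show "shear G (tensor K A A (F y1) u) =
        sweedler2 K h ?AA u (\<lambda>y2 y3. tensor K A A (F y1 \<otimes>\<^bsub>A\<^esub> G y2) y3)" .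
  qed
  also have "\<dots> = sweedler2 K h ?AA y (\<lambda>u y3. sweedler2 K h ?AA u (\<lambda>y1 y2. tensor K A A (F y1 \<otimes>\<^bsub>A\<^esub> G y2) y3))"
    by (rule coassoc_trilinear[OF mAA T1 T2 y, symmetric])
  also have "\<dots> = sweedler2 K h ?AA y (\<lambda>u y3. counit h u \<odot>\<^bsub>?AA\<^esub> tensor K A A \<one>\<^bsub>A\<^esub> y3)"
  proof (rule pre.sweedler2_cong[OF mAA bu y])
    fix u y3 assume u: "u \<in> carrier A" and y3: "y3 \<in> carrier A"
    have l: "linear_map K A ?AA (\<lambda>a. tensor K A A a y3)"
      by (rule linear_map_tensor_left[OF mA mA linear_map_id y3])
    have "sweedler2 K h ?AA u (\<lambda>y1 y2. tensor K A A (F y1 \<otimes>\<^bsub>A\<^esub> G y2) y3) =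
        tensor K A A (sweedler2 K h A u (\<lambda>y1 y2. F y1 \<otimes>\<^bsub>A\<^esub> G y2)) y3"
      by (rule pre.linear_map_sweedler2[OF mA mAA bFG l u, symmetric])
    then show "sweedler2 K h ?AA u (\<lambda>y1 y2. tensor K A A (F y1 \<otimes>\<^bsub>A\<^esub> G y2) y3) =
        counit h u \<odot>\<^bsub>?AA\<^esub> tensor K A A \<one>\<^bsub>A\<^esub> y3"
      by (simp add: inv u linear_map_smult[OF l] pre.counit_closed)
  qed
  also have "\<dots> = sweedler2 K h ?AA y (\<lambda>u y3. tensor K A A \<one>\<^bsub>A\<^esub> (counit h u \<odot>\<^bsub>A\<^esub> y3))"
  proof (rule pre.sweedler2_cong[OF mAA bu y, symmetric])
    fix u y3 assume "u \<in> carrier A" "y3 \<in> carrier A"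
    then show "tensor K A A \<one>\<^bsub>A\<^esub> (counit h u \<odot>\<^bsub>A\<^esub> y3) = counit h u \<odot>\<^bsub>?AA\<^esub> tensor K A A \<one>\<^bsub>A\<^esub> y3"
      by (intro linear_map_smult[OF linear_map_tensor_right[OF mA mA linear_map_id one_closed]] pre.counit_closed)
  qed
  also have "\<dots> = tensor K A A \<one>\<^bsub>A\<^esub> (sweedler2 K h A y (\<lambda>u y3. counit h u \<odot>\<^bsub>A\<^esub> y3))"
  proof (rule pre.linear_map_sweedler2[OF mA mAA _ linear_map_tensor_right[OF mA mA linear_map_id one_closed] y,
        symmetric], rule bilinear_mapI)
    have e: "linear_map K A A (\<lambda>u. counit h u \<odot>\<^bsub>A\<^esub> \<one>\<^bsub>A\<^esub>)"
      by (rule algebra_hom_linear[OF pre.algebra_hom_counit[OF pre.algebra_axioms]])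
    fix u assume u: "u \<in> carrier A"
    show "linear_map K A A (\<lambda>y3. counit h u \<odot>\<^bsub>A\<^esub> y3)"
      by (rule linear_map_cong[OF _ mA linear_map_mult_right[OF pre.algebra_axioms linear_map_id
              linear_map_closed[OF e u]]]) (simp add: pre.counit_closed u pre.smult_assoc2)
    show "linear_map K A A (\<lambda>v. counit h v \<odot>\<^bsub>A\<^esub> u)"
      by (rule linear_map_cong[OF _ mA linear_map_mult_left[OF pre.algebra_axioms e u]])
        (simp add: pre.counit_closed u pre.smult_assoc2)
  qed
  also have "\<dots> = tensor K A A \<one>\<^bsub>A\<^esub> y" by (simp only: counit_left[OF y])
  finally show ?thesis .
qed

text \<open>One-sided in \<open>F\<close> and \<open>G\<close>; used both ways round, with the two
  antipode axioms as hypotheses, it makes the two shears mutually inverse.\<close>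

lemma shear_inverse:
  assumes F: "linear_map K A A F" and G: "linear_map K A A G"
    and inv: "\<And>u. u \<in> carrier A \<Longrightarrow>
      sweedler2 K h A u (\<lambda>u1 u2. F u1 \<otimes>\<^bsub>A\<^esub> G u2) = counit h u \<odot>\<^bsub>A\<^esub> \<one>\<^bsub>A\<^esub>"
    and X: "X \<in> carrier (tensor_algebra K A A)"
  shows "shear G (shear F X) = X"
proof (rule linear_map_tensor_eqI[OF module_axioms module_axioms
      linear_map_comp[OF linear_shear[OF G] linear_shear[OF F]] linear_map_id _ X])
  fix x y assume xy: "x \<in> carrier A" "y \<in> carrier A"
  show "shear G (shear F (tensor K A A x y)) = tensor K A A x y"
    using xy linear_map_closed[OF linear_shear_right[OF F]]
    by (simp add: shear_tensor[OF F] shear_mult_left[OF G] shear_shear_right[OF F G inv]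
        tensor_mult[OF pre.algebra_axioms pre.algebra_axioms])
qed

lemma antipode_algebra_hom: "algebra_hom K A A (antipode h)"
proof -
  let ?AA = "tensor_algebra K A A" and ?S = "antipode h"
  interpret T: algebra K ?AA by (rule pre.algebra_tensor2)
  note S = antipode_linear
  note Sc = linear_map_closed[OF S]
  note tc = tensor_closed[OF module_axioms module_axioms]
  note tm = tensor_mult[OF pre.algebra_axioms pre.algebra_axioms]
  have id_eq: "shear_right (\<lambda>x. x) y = comult h y" if "y \<in> carrier A" for y
    unfolding shear_right_def pre.comult_eq_point2[OF that]
    by (rule pre.sweedler2_points[OF pre.algebra_tensor2 point2_closed[OF pre.algebra_axioms] that point2_mult[OF pre.algebra_axioms]])
  \<comment> \<open>The shear by the identity is the copairing of two algebra homomorphisms,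
    \<open>x \<mapsto> x \<otimes> 1\<close> and the coproduct. For the shear by the antipode the
    same argument would presuppose the claim, so that shear is handled as the inverse.\<close>
  have eq: "shear (\<lambda>x. x) X = tensor_pair K ?AA (\<lambda>x. tensor K A A x \<one>\<^bsub>A\<^esub>) (comult h) X"
    if X: "X \<in> carrier ?AA" for X
    unfolding tensor_pair_def shear_def
    by (rule tensor_lift_cong[OF module_axioms module_axioms T.module_axioms _ X])
      (rule bilinear_pair[OF pre.algebra_axioms pre.algebra_axioms pre.algebra_tensor2
          algebra_hom_tensor_left[OF pre.algebra_axioms pre.algebra_axioms] comult_hom], simp add: id_eq)
  have hom: "algebra_hom K ?AA ?AA (shear (\<lambda>x. x))"
    by (rule algebra_hom_cong[OF eq pre.algebra_tensor2 algebra_hom_tensor_pair[OF pre.algebra_axioms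
            pre.algebra_axioms pre.algebra_tensor2
            algebra_hom_tensor_left[OF pre.algebra_axioms pre.algebra_axioms] comult_hom]])
  have inv1: "shear ?S (shear (\<lambda>x. x) X) = X" if "X \<in> carrier ?AA" for X
    by (rule shear_inverse[OF linear_map_id S antipode_right that])
  have inv2: "shear (\<lambda>x. x) (shear ?S X) = X" if "X \<in> carrier ?AA" for X
    by (rule shear_inverse[OF S linear_map_id antipode_left that])
  note cl = linear_map_closed[OF linear_shear[OF S]]
  have homS: "algebra_hom K ?AA ?AA (shear ?S)"
  proof (rule algebra_homI[OF linear_shear[OF S]])
    fix X Y assume X: "X \<in> carrier ?AA" and Y: "Y \<in> carrier ?AA"
    have "X \<otimes>\<^bsub>?AA\<^esub> Y = shear (\<lambda>x. x) (shear ?S X \<otimes>\<^bsub>?AA\<^esub> shear ?S Y)"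
      using X Y by (simp add: algebra_hom_mult[OF hom] inv2 cl)
    then show "shear ?S (X \<otimes>\<^bsub>?AA\<^esub> Y) = shear ?S X \<otimes>\<^bsub>?AA\<^esub> shear ?S Y"
      using X Y by (simp add: inv1 cl)
  next
    show "shear ?S \<one>\<^bsub>?AA\<^esub> = \<one>\<^bsub>?AA\<^esub>"
      using inv1[of "\<one>\<^bsub>?AA\<^esub>"] algebra_hom_one[OF hom] by simp
  qed
  note e = pre.algebra_hom_counit[OF pre.algebra_axioms]
  note p = pre.algebra_axioms pre.algebra_axioms pre.algebra_axioms algebra_hom_id e
  \<comment> \<open>\<open>\<pi>\<close> sends \<open>x \<otimes> y\<close> to
    \<open>\<epsilon>(y) x\<close>, so it turns \<open>S(y1) \<otimes> y2\<close>, the shear of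
    \<open>1 \<otimes> y\<close>, into \<open>S(y)\<close>.\<close>
  define \<pi> where "\<pi> = tensor_pair K A (\<lambda>x. x) (\<lambda>x. counit h x \<odot>\<^bsub>A\<^esub> \<one>\<^bsub>A\<^esub>)"
  have \<pi>: "algebra_hom K ?AA A \<pi>" unfolding \<pi>_def by (rule algebra_hom_tensor_pair[OF p])
  show ?thesis
  proof (rule algebra_hom_cong[OF _ pre.algebra_axioms algebra_hom_comp[OF \<pi> algebra_hom_comp[OF homS
            algebra_hom_tensor_right[OF pre.algebra_axioms pre.algebra_axioms]]]])
    fix y assume y: "y \<in> carrier A"
    have b: "bilinear_map K A A A (\<lambda>y1 y2. y1 \<otimes>\<^bsub>A\<^esub> (counit h y2 \<odot>\<^bsub>A\<^esub> \<one>\<^bsub>A\<^esub>))"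
      by (rule bilinear_pair[OF p])
    have "\<pi> (shear ?S (tensor K A A \<one>\<^bsub>A\<^esub> y)) = \<pi> (shear_right ?S y)"
      using y linear_map_closed[OF linear_shear_right[OF S]]
      by (simp add: shear_tensor[OF S]) (metis T.l_one tensor_algebra_simps(5))
    also have "\<dots> = sweedler2 K h A y (\<lambda>y1 y2. \<pi> (tensor K A A (?S y1) y2))"
      unfolding shear_right_def
      by (rule pre.linear_map_sweedler2[OF T.module_axioms module_axioms bilinear_tensor_left[OF S]
            algebra_hom_linear[OF \<pi>] y])
    also have "\<dots> = sweedler2 K h A y (\<lambda>y1 y2. ?S (y1 \<otimes>\<^bsub>A\<^esub> (counit h y2 \<odot>\<^bsub>A\<^esub> \<one>\<^bsub>A\<^esub>)))"
    proof (rule pre.sweedler2_cong[OF module_axioms _ y])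
      show "bilinear_map K A A A (\<lambda>y1 y2. ?S (y1 \<otimes>\<^bsub>A\<^esub> (counit h y2 \<odot>\<^bsub>A\<^esub> \<one>\<^bsub>A\<^esub>)))"
        using linear_map_comp[OF S bilinear_map_right[OF b]] linear_map_comp[OF S bilinear_map_left[OF b]]
        by (rule bilinear_mapI)
      fix y1 y2 assume "y1 \<in> carrier A" "y2 \<in> carrier A"
      then show "\<pi> (tensor K A A (?S y1) y2) = ?S (y1 \<otimes>\<^bsub>A\<^esub> (counit h y2 \<odot>\<^bsub>A\<^esub> \<one>\<^bsub>A\<^esub>))"
        by (simp add: \<pi>_def tensor_pair_tensor[OF p] Sc pre.counit_closed pre.smult_assoc_right
            linear_map_smult[OF S])
    qed
    also have "\<dots> = ?S (sweedler2 K h A y (\<lambda>y1 y2. y1 \<otimes>\<^bsub>A\<^esub> (counit h y2 \<odot>\<^bsub>A\<^esub> \<one>\<^bsub>A\<^esub>)))"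
      by (rule pre.linear_map_sweedler2[OF module_axioms module_axioms b S y, symmetric])
    also have "sweedler2 K h A y (\<lambda>y1 y2. y1 \<otimes>\<^bsub>A\<^esub> (counit h y2 \<odot>\<^bsub>A\<^esub> \<one>\<^bsub>A\<^esub>)) =
        sweedler2 K h A y (\<lambda>y1 y2. counit h y2 \<odot>\<^bsub>A\<^esub> y1)"
      by (rule pre.sweedler2_cong[OF module_axioms b y, symmetric])
        (simp add: pre.counit_closed pre.smult_assoc_right)
    also have "\<dots> = y" by (rule counit_right[OF y])
    finally show "?S y = \<pi> (shear ?S (tensor K A A \<one>\<^bsub>A\<^esub> y))" ..
  qed
qed

lemma antipode_point: "restrict (antipode h) (carrier A) \<in> alg_points K A A"
  by (rule restrict_alg_points[OF pre.algebra_axioms antipode_algebra_hom])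

text \<open>The unit and inverse laws are checked at \<open>point_id\<close>, where they are the
  counit and antipode axioms, and carried to \<open>f\<close> by composing with \<open>f\<close>;
  associativity is carried over from the generic triple. The inverse \<open>f \<circ> S\<close> is a
  point because the antipode is multiplicative.\<close>

lemma
  assumes R: "algebra K R"
  shows group_points: "group (points K A h R)"
    and points_inv: "f \<in> alg_points K A R \<Longrightarrow>
      inv\<^bsub>points K A h R\<^esub> f = compose (carrier A) f (restrict (antipode h) (carrier A))"
proof -
  let ?P = "\<lambda>R. points K A h R" and ?S = "restrict (antipode h) (carrier A)"
  note A = pre.algebra_axioms and id = point_id_closed[OF A]
  have "\<one>\<^bsub>?P A\<^esub> \<otimes>\<^bsub>?P A\<^esub> point_id A = point_id A"
  proof (rule alg_points_eqI[OF pre.points_mult_closed[OF A pre.points_one_closed[OF A] id] id])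
    fix x assume x: "x \<in> carrier A"
    have "sweedler2 K h A x (\<lambda>x1 x2. counit h x1 \<odot>\<^bsub>A\<^esub> x2) = (\<one>\<^bsub>?P A\<^esub> \<otimes>\<^bsub>?P A\<^esub> point_id A) x"
      by (rule pre.sweedler2_points[OF A pre.points_one_closed[OF A] id x])
        (simp add: pre.points_one point_id_def pre.counit_closed pre.smult_assoc2)
    then show "(\<one>\<^bsub>?P A\<^esub> \<otimes>\<^bsub>?P A\<^esub> point_id A) x = point_id A x"
      by (simp add: counit_left x point_id_def)
  qed
  then have l_one: "\<one>\<^bsub>?P R\<^esub> \<otimes>\<^bsub>?P R\<^esub> f = f" if "f \<in> alg_points K A R" for f
    using pre.compose_points_mult[OF A pre.points_one_closed[OF A] id R alg_points_hom[OF that]]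
      pre.compose_points_one[OF A R alg_points_hom[OF that]] by (simp add: compose_point_id[OF that])
  have "?S \<otimes>\<^bsub>?P A\<^esub> point_id A = \<one>\<^bsub>?P A\<^esub>"
  proof (rule alg_points_eqI[OF pre.points_mult_closed[OF A antipode_point id] pre.points_one_closed[OF A]])
    fix x assume x: "x \<in> carrier A"
    have "sweedler2 K h A x (\<lambda>x1 x2. antipode h x1 \<otimes>\<^bsub>A\<^esub> x2) = (?S \<otimes>\<^bsub>?P A\<^esub> point_id A) x"
      by (rule pre.sweedler2_points[OF A antipode_point id x]) (simp add: point_id_def)
    then show "(?S \<otimes>\<^bsub>?P A\<^esub> point_id A) x = \<one>\<^bsub>?P A\<^esub> x"
      by (simp add: antipode_left x pre.points_one)
  qed
  then have l_inv: "compose (carrier A) f ?S \<otimes>\<^bsub>?P R\<^esub> f = \<one>\<^bsub>?P R\<^esub>" if "f \<in> alg_points K A R" for f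
    using pre.compose_points_mult[OF A antipode_point id R alg_points_hom[OF that]]
      pre.compose_points_one[OF A R alg_points_hom[OF that]] by (simp add: compose_point_id[OF that])
  have inv_cl: "compose (carrier A) f ?S \<in> alg_points K A R" if "f \<in> alg_points K A R" for f
    by (rule compose_alg_points[OF A alg_points_hom[OF that] antipode_point])
  have point3_assoc: "(point3_1 K A \<otimes>\<^bsub>?P (tensor_algebra3 K A)\<^esub> point3_2 K A) \<otimes>\<^bsub>?P (tensor_algebra3 K A)\<^esub> point3_3 K A =
      point3_1 K A \<otimes>\<^bsub>?P (tensor_algebra3 K A)\<^esub> (point3_2 K A \<otimes>\<^bsub>?P (tensor_algebra3 K A)\<^esub> point3_3 K A)"
    by (rule alg_points_eqI[where K = K and A = A and R = "tensor_algebra3 K A"])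
      (simp_all add: pre.points_mult_closed pre.algebra_tensor3 pre.point3_closed
        pre.coassoc_left[symmetric] pre.coassoc_right[symmetric] coassoc)
  have assoc: "f \<otimes>\<^bsub>?P R\<^esub> g \<otimes>\<^bsub>?P R\<^esub> k = f \<otimes>\<^bsub>?P R\<^esub> (g \<otimes>\<^bsub>?P R\<^esub> k)"
    if fgk: "f \<in> alg_points K A R" "g \<in> alg_points K A R" "k \<in> alg_points K A R" for f g k
  proof -
    note p3 = pre.compose_point3[OF R fgk]
    note cm = pre.compose_points_mult[OF pre.algebra_tensor3 _ _ R p3(1)]
    show ?thesis
      using arg_cong[OF point3_assoc, of "compose (carrier A) (tensor_pair K R f (tensor_pair K R g k))"]
      by (simp add: cm pre.points_mult_closed pre.algebra_tensor3 pre.point3_closed p3(2-4))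
  qed
  show grp: "group (?P R)"
  proof (rule groupI)
    fix f assume "f \<in> carrier (?P R)"
    then show "\<exists>g\<in>carrier (?P R). g \<otimes>\<^bsub>?P R\<^esub> f = \<one>\<^bsub>?P R\<^esub>"
      by (intro bexI[of _ "compose (carrier A) f ?S"]) (simp_all add: l_inv inv_cl)
  qed (simp_all add: pre.points_mult_closed[OF R] pre.points_one_closed[OF R] assoc l_one)
  show "inv\<^bsub>?P R\<^esub> f = compose (carrier A) f ?S" if "f \<in> alg_points K A R"
    using group.inv_equality[OF grp l_inv[OF that]] inv_cl[OF that] that by simp
qed

end

section \<open>Homomorphisms of Hopf algebras in terms of points\<close>

lemma compose_hom_alg_points:
  assumes "algebra K A" "algebra_hom K A B f" "p \<in> alg_points K B R"
  shows "compose (carrier A) p f \<in> alg_points K A R"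
  unfolding compose_def
  by (rule restrict_alg_points[OF assms(1) algebra_hom_comp[OF alg_points_hom[OF assms(3)] assms(2)]])

text \<open>Precomposition with \<open>f\<close> maps points of \<open>A\<close> to points of
  \<open>B\<close>. Compatibility with the coproducts is multiplicativity of this map at the generic
  pair. As a group homomorphism it preserves inverses, and at \<open>point_id\<close> this is
  compatibility with the antipodes. Multiplicativity is assumed in two instances because the two
  algebras of values have different types.\<close>

lemma hopf_hom_pointsI:
  assumes B: "comm_hopf K B g" and A: "comm_hopf K A h" and f: "algebra_hom K B A f"
    and counit: "\<And>X. X \<in> carrier B \<Longrightarrow> counit h (f X) = counit g X"
    and mult2: "compose (carrier B) (point2_1 K A) f \<otimes>\<^bsub>points K B g (tensor_algebra K A A)\<^esub>
        compose (carrier B) (point2_2 K A) f =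
      compose (carrier B) (point2_1 K A \<otimes>\<^bsub>points K A h (tensor_algebra K A A)\<^esub> point2_2 K A) f"
    and mult: "\<And>p q. \<lbrakk>p \<in> alg_points K A A; q \<in> alg_points K A A\<rbrakk> \<Longrightarrow>
      compose (carrier B) p f \<otimes>\<^bsub>points K B g A\<^esub> compose (carrier B) q f =
      compose (carrier B) (p \<otimes>\<^bsub>points K A h A\<^esub> q) f"
  shows "hopf_hom K B g A h f"
  unfolding hopf_hom_def
proof (intro conjI ballI f)
  let ?AA = "tensor_algebra K A A"
  interpret B: comm_hopf K B g by (rule B)
  interpret A: comm_hopf K A h by (rule A)
  note aA = A.pre.algebra_axioms and aB = B.pre.algebra_axioms
  note fc = algebra_hom_closed[OF f]
  note c = compose_hom_alg_points[OF aB f]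
  fix X assume X: "X \<in> carrier B"
  have "sweedler2 K g ?AA X (\<lambda>x1 x2. tensor K A A (f x1) (f x2)) =
      (compose (carrier B) (point2_1 K A) f \<otimes>\<^bsub>points K B g ?AA\<^esub>
        compose (carrier B) (point2_2 K A) f) X"
    by (rule B.pre.sweedler2_points[OF A.pre.algebra_tensor2 c[OF point2_closed(1)[OF aA]]
          c[OF point2_closed(2)[OF aA]] X])
      (simp add: compose_eq point2_mult[OF aA] fc)
  then show "comult h (f X) = sweedler2 K g ?AA X (\<lambda>x1 x2. tensor K A A (f x1) (f x2))"
    by (simp add: mult2 compose_eq X A.pre.comult_eq_point2 fc)
  show "counit h (f X) = counit g X" by (rule counit[OF X])
  note gA = A.group_points[OF aA] and gB = B.group_points[OF aA]
  interpret F: group_hom "points K A h A" "points K B g A" "\<lambda>p. compose (carrier B) p f"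
    by (intro group_hom.intro group_hom_axioms.intro gA gB homI) (simp_all add: c mult)
  note id = point_id_closed[OF aA]
  have "antipode h (f X) = compose (carrier B) (inv\<^bsub>points K A h A\<^esub> (point_id A)) f X"
    unfolding A.points_inv[OF aA id]
    by (simp add: X fc compose_eq point_id_def algebra_hom_closed[OF A.antipode_algebra_hom])
  also have "compose (carrier B) (inv\<^bsub>points K A h A\<^esub> (point_id A)) f =
      inv\<^bsub>points K B g A\<^esub> (compose (carrier B) (point_id A) f)"
    using F.hom_inv[of "point_id A"] id by simp
  also have "\<dots> X = f (antipode g X)"
    unfolding B.points_inv[OF aA c[OF id]]
    by (simp add: X fc compose_eq point_id_def algebra_hom_closed[OF B.antipode_algebra_hom])
  finally show "antipode h (f X) = f (antipode g X)" .
qed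

section \<open>The skew brace of points of a Hopf co-brace\<close>

locale hopf_pair = bul: comm_hopf K A b + cir: comm_hopf K A c
  for K :: "('k, 'm) ring_scheme" and A :: "('k, 'a, 'n) module_scheme"
    and b :: "('k, 'a, 's) hopf_scheme" and c :: "('k, 'a, 't) hopf_scheme"
begin

abbreviation "bullet_points \<equiv> points K A b"
abbreviation "circ_points \<equiv> points K A c"

text \<open>Together with \<open>cobrace_right\<close>: the two sides of the co-brace axiom are the
  two sides of the skew brace identity at the generic triple.\<close>

lemma cobrace_left:
  assumes x: "x \<in> carrier A"
  shows "sweedler2 K c (tensor_algebra3 K A) x (\<lambda>u v.
        sweedler2 K b (tensor_algebra3 K A) v (\<lambda>v1 v2. tensor3 K A u v1 v2)) =
    (point3_1 K A \<otimes>\<^bsub>circ_points (tensor_algebra3 K A)\<^esub>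
      (point3_2 K A \<otimes>\<^bsub>bullet_points (tensor_algebra3 K A)\<^esub> point3_3 K A)) x"
proof -
  let ?R = "tensor_algebra3 K A"
  note R = bul.pre.algebra_tensor3
  interpret R: algebra K ?R by (rule R)
  note p = bul.pre.point3_closed
  show ?thesis
  proof (rule cir.pre.sweedler2_points[OF R p(1) bul.pre.points_mult_closed[OF R p(2,3)] x])
    fix u v assume "u \<in> carrier A" "v \<in> carrier A"
    then show "sweedler2 K b ?R v (tensor3 K A u) =
        point3_1 K A u \<otimes>\<^bsub>?R\<^esub> (point3_2 K A \<otimes>\<^bsub>bullet_points ?R\<^esub> point3_3 K A) v"
      using algebra_hom_closed[OF alg_points_hom[OF p(1)]]
      by (intro bul.pre.sweedler2_push_points[OF R p(2,3) R.module_axioms,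
            where \<phi> = "\<lambda>r. point3_1 K A u \<otimes>\<^bsub>?R\<^esub> r"] linear_map_mult_right[OF R linear_map_id]
          bul.pre.point3_mult)
  qed
qed

text \<open>The product \<open>y1 S(x2) z1\<close> collects the three occurrences of the first
  generic point. That point is multiplicative, so the product splits, and commutativity moves each
  piece next to its partner.\<close>

lemma cobrace_right:
  assumes x: "x \<in> carrier A"
  shows "sweedler3 K b (tensor_algebra3 K A) x (\<lambda>x1 x2 x3.
        sweedler2 K c (tensor_algebra3 K A) x1 (\<lambda>y1 y2.
          sweedler2 K c (tensor_algebra3 K A) x3 (\<lambda>z1 z2.
            tensor3 K A (y1 \<otimes>\<^bsub>A\<^esub> antipode b x2 \<otimes>\<^bsub>A\<^esub> z1) y2 z2))) =
    ((point3_1 K A \<otimes>\<^bsub>circ_points (tensor_algebra3 K A)\<^esub> point3_2 K A)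
      \<otimes>\<^bsub>bullet_points (tensor_algebra3 K A)\<^esub>
      (inv\<^bsub>bullet_points (tensor_algebra3 K A)\<^esub> (point3_1 K A)
        \<otimes>\<^bsub>bullet_points (tensor_algebra3 K A)\<^esub>
        (point3_1 K A \<otimes>\<^bsub>circ_points (tensor_algebra3 K A)\<^esub> point3_3 K A))) x"
proof -
  let ?R = "tensor_algebra3 K A" and ?p1 = "point3_1 K A" and ?p2 = "point3_2 K A" and ?p3 = "point3_3 K A"
  note R = bul.pre.algebra_tensor3
  interpret R: algebra K ?R by (rule R)
  interpret G: group "bullet_points ?R" by (rule bul.group_points[OF R])
  note p = bul.pre.point3_closed
  note h = alg_points_hom[OF p(1)] alg_points_hom[OF p(2)] alg_points_hom[OF p(3)]
  note cl = h[THEN algebra_hom_closed]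
  note c12 = cir.pre.points_mult_closed[OF R p(1,2)] and c13 = cir.pre.points_mult_closed[OF R p(1,3)]
  note Sc = algebra_hom_closed[OF bul.antipode_algebra_hom]
  have inv: "(inv\<^bsub>bullet_points ?R\<^esub> ?p1) x2 = ?p1 (antipode b x2)" if "x2 \<in> carrier A" for x2
    by (simp add: bul.points_inv[OF R p(1)] compose_eq that)
  have inv_cl: "inv\<^bsub>bullet_points ?R\<^esub> ?p1 \<in> alg_points K A ?R" using G.inv_closed p(1) by simp
  show ?thesis
  proof (rule bul.pre.sweedler3_points[OF R c12 inv_cl c13 x])
    fix x1 x2 x3 assume x123: "x1 \<in> carrier A" "x2 \<in> carrier A" "x3 \<in> carrier A"
    \<comment> \<open>The outer sum is translated with everything coming from \<open>x2\<close> and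
      \<open>x3\<close> as a constant right factor \<open>?E\<close>, the inner one with everything
      else as a constant left factor \<open>?C\<close>.\<close>
    let ?E = "?p1 (antipode b x2) \<otimes>\<^bsub>?R\<^esub> (?p1 \<otimes>\<^bsub>circ_points ?R\<^esub> ?p3) x3"
    have E: "?E \<in> carrier ?R"
      using x123 cl Sc algebra_hom_closed[OF alg_points_hom[OF c13]] by simp
    have "sweedler2 K c ?R x1 (\<lambda>y1 y2. sweedler2 K c ?R x3 (\<lambda>z1 z2.
          tensor3 K A (y1 \<otimes>\<^bsub>A\<^esub> antipode b x2 \<otimes>\<^bsub>A\<^esub> z1) y2 z2)) =
        (?p1 \<otimes>\<^bsub>circ_points ?R\<^esub> ?p2) x1 \<otimes>\<^bsub>?R\<^esub> ?E"
    proof (rule cir.pre.sweedler2_push_points[OF R p(1,2) R.module_axioms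
          linear_map_mult_left[OF R linear_map_id E] x123(1)])
      fix y1 y2 assume y: "y1 \<in> carrier A" "y2 \<in> carrier A"
      let ?C = "(?p1 y1 \<otimes>\<^bsub>?R\<^esub> ?p2 y2) \<otimes>\<^bsub>?R\<^esub> ?p1 (antipode b x2)"
      have C: "?C \<in> carrier ?R" using x123 y cl Sc by simp
      have "sweedler2 K c ?R x3 (\<lambda>z1 z2. tensor3 K A (y1 \<otimes>\<^bsub>A\<^esub> antipode b x2 \<otimes>\<^bsub>A\<^esub> z1) y2 z2) =
          ?C \<otimes>\<^bsub>?R\<^esub> (?p1 \<otimes>\<^bsub>circ_points ?R\<^esub> ?p3) x3"
      proof (rule cir.pre.sweedler2_push_points[OF R p(1,3) R.module_axioms
            linear_map_mult_right[OF R linear_map_id C] x123(3)])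
        fix z1 z2 assume z: "z1 \<in> carrier A" "z2 \<in> carrier A"
        show "tensor3 K A (y1 \<otimes>\<^bsub>A\<^esub> antipode b x2 \<otimes>\<^bsub>A\<^esub> z1) y2 z2 =
            ?C \<otimes>\<^bsub>?R\<^esub> (?p1 z1 \<otimes>\<^bsub>?R\<^esub> ?p3 z2)"
          using x123 y z cl Sc
          by (simp add: bul.pre.point3_mult algebra_hom_mult[OF h(1)] R.m_ac)
      qed
      also have "\<dots> = (?p1 y1 \<otimes>\<^bsub>?R\<^esub> ?p2 y2) \<otimes>\<^bsub>?R\<^esub> ?E"
        using x123 y cl Sc algebra_hom_closed[OF alg_points_hom[OF c13]] by (simp add: R.m_assoc)
      finally show "sweedler2 K c ?R x3 (\<lambda>z1 z2. tensor3 K A (y1 \<otimes>\<^bsub>A\<^esub> antipode b x2 \<otimes>\<^bsub>A\<^esub> z1) y2 z2) =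
        (?p1 y1 \<otimes>\<^bsub>?R\<^esub> ?p2 y2) \<otimes>\<^bsub>?R\<^esub> ?E" .
    qed
    then show "sweedler2 K c ?R x1 (\<lambda>y1 y2. sweedler2 K c ?R x3 (\<lambda>z1 z2.
          tensor3 K A (y1 \<otimes>\<^bsub>A\<^esub> antipode b x2 \<otimes>\<^bsub>A\<^esub> z1) y2 z2)) =
        (?p1 \<otimes>\<^bsub>circ_points ?R\<^esub> ?p2) x1 \<otimes>\<^bsub>?R\<^esub>
          ((inv\<^bsub>bullet_points ?R\<^esub> ?p1) x2 \<otimes>\<^bsub>?R\<^esub> (?p1 \<otimes>\<^bsub>circ_points ?R\<^esub> ?p3) x3)"
      by (simp add: inv x123)
  qed
qed

end

sublocale comm_hopf_cobrace \<subseteq> pair: hopf_pair K A b c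
  by (intro hopf_pair.intro comm_hopf.intro bullet.hopf_algebra_axioms circ.hopf_algebra_axioms cring_axioms)

text \<open>The co-brace axiom is the identity at the generic triple; naturality of both products
  and of inverses carries it to every triple of points.\<close>

lemma (in comm_hopf_cobrace) skew_brace_points:
  assumes R: "algebra K R"
  shows "skew_brace (points K A b R) (points K A c R)"
proof (intro skew_brace.intro skew_brace_axioms.intro pair.bul.group_points[OF R] pair.cir.group_points[OF R])
  let ?b = "points K A b" and ?c = "points K A c"
  let ?R = "tensor_algebra3 K A" and ?p1 = "point3_1 K A" and ?p2 = "point3_2 K A" and ?p3 = "point3_3 K A"
  note R3 = pair.bul.pre.algebra_tensor3
  note p = pair.bul.pre.point3_closed
  note bcl = pair.bul.pre.points_mult_closed[OF R3] and ccl = pair.cir.pre.points_mult_closed[OF R3]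
  interpret G: group "?b ?R" by (rule pair.bul.group_points[OF R3])
  have inv_cl: "inv\<^bsub>?b ?R\<^esub> ?p1 \<in> alg_points K A ?R" using G.inv_closed p(1) by simp
  have univ: "?p1 \<otimes>\<^bsub>?c ?R\<^esub> (?p2 \<otimes>\<^bsub>?b ?R\<^esub> ?p3) =
      (?p1 \<otimes>\<^bsub>?c ?R\<^esub> ?p2) \<otimes>\<^bsub>?b ?R\<^esub>
        (inv\<^bsub>?b ?R\<^esub> ?p1 \<otimes>\<^bsub>?b ?R\<^esub> (?p1 \<otimes>\<^bsub>?c ?R\<^esub> ?p3))"
    by (rule alg_points_eqI[where K = K and A = A and R = ?R])
      (simp_all add: bcl ccl p inv_cl pair.cobrace_left[symmetric] pair.cobrace_right[symmetric] cobrace)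
  fix f g k assume "f \<in> carrier (?b R)" "g \<in> carrier (?b R)" "k \<in> carrier (?b R)"
  then have fgk: "f \<in> alg_points K A R" "g \<in> alg_points K A R" "k \<in> alg_points K A R" by simp_all
  note p3 = pair.bul.pre.compose_point3[OF R fgk]
  note cmb = pair.bul.pre.compose_points_mult[OF R3 _ _ R p3(1)]
  note cmc = pair.cir.pre.compose_points_mult[OF R3 _ _ R p3(1)]
  note cmi = pair.bul.pre.compose_points_inv[OF R3 R p3(1) G.group_axioms pair.bul.group_points[OF R] p(1)]
  show "f \<otimes>\<^bsub>?c R\<^esub> (g \<otimes>\<^bsub>?b R\<^esub> k) =
      (f \<otimes>\<^bsub>?c R\<^esub> g) \<otimes>\<^bsub>?b R\<^esub>
        (inv\<^bsub>?b R\<^esub> f \<otimes>\<^bsub>?b R\<^esub> (f \<otimes>\<^bsub>?c R\<^esub> k))"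
    using arg_cong[OF univ, of "compose (carrier A) (tensor_pair K R f (tensor_pair K R g k))"]
    by (simp add: cmb cmc cmi bcl ccl p inv_cl p3(2-4))
qed simp

text \<open>The two groups of points in \<open>A\<close> have the same unit, which identifies the
  counits up to multiplication by the unit of \<open>A\<close>; applying \<open>counit b\<close>
  recovers the scalars.\<close>

lemma (in comm_hopf_cobrace) counit_eq:
  assumes x: "x \<in> carrier A"
  shows "counit c x = counit b x"
proof -
  note aA = pair.bul.pre.algebra_axioms
  interpret skew_brace "points K A b A" "points K A c A" by (rule skew_brace_points[OF aA])
  have "counit c x \<odot>\<^bsub>A\<^esub> \<one>\<^bsub>A\<^esub> = counit b x \<odot>\<^bsub>A\<^esub> \<one>\<^bsub>A\<^esub>"
    unfolding pair.bul.pre.points_one[OF x, symmetric] pair.cir.pre.points_one[OF x, symmetric] one_eq ..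
  then have "counit b (counit c x \<odot>\<^bsub>A\<^esub> \<one>\<^bsub>A\<^esub>) = counit b (counit b x \<odot>\<^bsub>A\<^esub> \<one>\<^bsub>A\<^esub>)" by simp
  moreover have "counit b (k \<odot>\<^bsub>A\<^esub> \<one>\<^bsub>A\<^esub>) = k" if "k \<in> carrier K" for k
    using that by (simp add: pair.bul.pre.counit_smult pair.bul.pre.counit_one)
  ultimately show ?thesis
    using pair.bul.pre.counit_closed[OF x] pair.cir.pre.counit_closed[OF x] by simp
qed

section \<open>The co-Rota--Baxter Hopf algebra on the tensor square\<close>

context comm_hopf_cobrace
begin

abbreviation "AA \<equiv> tensor_algebra K A A"
abbreviation "semi R \<equiv> brace_semidirect (points K A b R) (points K A c R)"
abbreviation "rb R \<equiv> brace_rota_baxter (points K A b R) (points K A c R)"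

lemma algebra_A: "algebra K A" by (rule pair.bul.pre.algebra_axioms)
lemma algebra_AA: "algebra K AA" by (rule pair.bul.pre.algebra_tensor2)

text \<open>\<open>split_point\<close> and \<open>join_point\<close> are the two directions of the
  bijection by which the tensor square represents \<open>G \<times> G\<close>.\<close>

definition split_point :: "(('a, 'a, 'k) tensor \<Rightarrow> 'c) \<Rightarrow> ('a \<Rightarrow> 'c) \<times> ('a \<Rightarrow> 'c)"
  where "split_point P = (compose (carrier A) P (point2_1 K A), compose (carrier A) P (point2_2 K A))"

definition join_point ::
  "('k, 'c, 'q) module_scheme \<Rightarrow> ('a \<Rightarrow> 'c) \<times> ('a \<Rightarrow> 'c) \<Rightarrow> ('a, 'a, 'k) tensor \<Rightarrow> 'c"
  where "join_point R u = restrict (tensor_pair K R (fst u) (snd u)) (carrier AA)"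

definition push_point :: "('c \<Rightarrow> 'd) \<Rightarrow> ('a \<Rightarrow> 'c) \<times> ('a \<Rightarrow> 'c) \<Rightarrow> ('a \<Rightarrow> 'd) \<times> ('a \<Rightarrow> 'd)"
  where "push_point \<phi> u = (compose (carrier A) \<phi> (fst u), compose (carrier A) \<phi> (snd u))"

lemma carrier_semi: "carrier (semi R) = alg_points K A R \<times> alg_points K A R"
  by (simp add: brace_semidirect_def)

lemma split_closed: "P \<in> alg_points K AA R \<Longrightarrow> split_point P \<in> carrier (semi R)"
  unfolding split_point_def carrier_semi
  using compose_alg_points[OF algebra_A alg_points_hom point2_closed(1)[OF algebra_A]]
    compose_alg_points[OF algebra_A alg_points_hom point2_closed(2)[OF algebra_A]] by blast

lemma join_closed:
  assumes "algebra K R" "u \<in> carrier (semi R)"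
  shows "join_point R u \<in> alg_points K AA R"
  unfolding join_point_def using assms(2)[unfolded carrier_semi]
  by (intro restrict_alg_points[OF algebra_AA] algebra_hom_tensor_pair[OF algebra_A algebra_A assms(1)]
      alg_points_hom) auto

lemma split_join:
  assumes "algebra K R" "u \<in> carrier (semi R)"
  shows "split_point (join_point R u) = u"
proof -
  have u: "fst u \<in> alg_points K A R" "snd u \<in> alg_points K A R"
    using assms(2) by (auto simp: carrier_semi)
  have "compose (carrier A) (join_point R u) p = compose (carrier A) (tensor_pair K R (fst u) (snd u)) p"
    if "p \<in> alg_points K A AA" for p
    using algebra_hom_closed[OF alg_points_hom[OF that]]
    by (auto simp: compose_def join_point_def)
  then show ?thesis
    by (simp add: split_point_def point2_closed[OF algebra_A] compose_point2[OF algebra_A assms(1) u])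
qed

lemma split_inj:
  assumes P: "P \<in> alg_points K AA R" and Q: "Q \<in> alg_points K AA R" and eq: "split_point P = split_point Q"
  shows "P = Q"
proof (rule alg_points_eqI[OF P Q])
  interpret A: algebra K A by (rule algebra_A)
  have e: "compose (carrier A) P (point2_1 K A) = compose (carrier A) Q (point2_1 K A)"
    "compose (carrier A) P (point2_2 K A) = compose (carrier A) Q (point2_2 K A)"
    using eq by (simp_all add: split_point_def)
  have "P (point2_1 K A x) = Q (point2_1 K A x)" "P (point2_2 K A x) = Q (point2_2 K A x)"
    if "x \<in> carrier A" for x
    using fun_cong[OF e(1), of x] fun_cong[OF e(2), of x] that by (simp_all add: compose_eq)
  then show "P X = Q X" if "X \<in> carrier AA" for X
    by (intro algebra_hom_tensor_eqI[OF algebra_A algebra_A alg_points_hom[OF P] alg_points_hom[OF Q] _ _ that])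
      (simp_all add: point2_1_def point2_2_def)
qed

lemma split_compose:
  assumes "P \<in> alg_points K AA R"
  shows "split_point (compose (carrier AA) \<phi> P) = push_point \<phi> (split_point P)"
proof -
  have "compose (carrier A) (compose (carrier AA) \<phi> P) p = compose (carrier A) \<phi> (compose (carrier A) P p)"
    if "p \<in> alg_points K A AA" for p
    using algebra_hom_closed[OF alg_points_hom[OF that]] by (auto simp: compose_def)
  then show ?thesis by (simp add: split_point_def push_point_def point2_closed[OF algebra_A])
qed

context
  fixes R :: "('k, 'd, 'q) module_scheme" and R' :: "('k, 'e, 'q2) module_scheme"
    and \<phi> :: "'d \<Rightarrow> 'e"
  assumes R: "algebra K R" and R': "algebra K R'" and \<phi>: "algebra_hom K R R' \<phi>"
begin

interpretation Rb: skew_brace "points K A b R" "points K A c R" by (rule skew_brace_points[OF R])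
interpretation R'b: skew_brace "points K A b R'" "points K A c R'" by (rule skew_brace_points[OF R'])

lemmas push_rules =
  pair.bul.pre.compose_points_mult[OF R _ _ R' \<phi>] pair.cir.pre.compose_points_mult[OF R _ _ R' \<phi>]
  pair.bul.pre.compose_points_inv[OF R R' \<phi> Rb.G.group_axioms R'b.G.group_axioms]
  pair.cir.pre.compose_points_inv[OF R R' \<phi> Rb.C.group_axioms R'b.C.group_axioms]
  pair.bul.pre.compose_points_one[OF R R' \<phi>]

text \<open>Semidirect multiplication is built from the two products and an inverse, all natural in
  \<open>R\<close>. Because of this a coproduct prescribed at generic points computes the product at
  all points.\<close>

lemma push_mult:
  assumes "u \<in> carrier (semi R)" "v \<in> carrier (semi R)"
  shows "push_point \<phi> (u \<otimes>\<^bsub>semi R\<^esub> v) = push_point \<phi> u \<otimes>\<^bsub>semi R'\<^esub> push_point \<phi> v"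
proof -
  have uv: "fst u \<in> alg_points K A R" "snd u \<in> alg_points K A R"
    "fst v \<in> alg_points K A R" "snd v \<in> alg_points K A R"
    using assms by (auto simp: carrier_semi)
  note cl = pair.bul.pre.points_mult_closed[OF R] pair.cir.pre.points_mult_closed[OF R]
    Rb.G.inv_closed[unfolded carrier_points]
  show ?thesis
    using uv by (simp add: push_point_def brace_semidirect_def brace_lambda_def push_rules cl)
qed

lemma push_rb:
  assumes "u \<in> carrier (semi R)"
  shows "push_point \<phi> (rb R u) = rb R' (push_point \<phi> u)"
proof -
  have u: "fst u \<in> alg_points K A R" "snd u \<in> alg_points K A R"
    using assms by (auto simp: carrier_semi)
  note cl = Rb.C.inv_closed[unfolded carrier_points]
  show ?thesis
    using u by (simp add: push_point_def brace_rota_baxter_def push_rules cl)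
qed

end

text \<open>By Yoneda the coproduct has to be the semidirect product of the generic pair, and the
  antipode the inverse of the generic point. The counit, multiplication followed by \<epsilon>, is
  \<open>\<epsilon> \<otimes> \<epsilon>\<close> and corresponds to the pair of units.\<close>

definition double_bullet :: "('k, ('a, 'a, 'k) tensor) hopf"
  where "double_bullet =
    \<lparr>comult = join_point (tensor_algebra K AA AA)
        (split_point (point2_1 K AA) \<otimes>\<^bsub>semi (tensor_algebra K AA AA)\<^esub> split_point (point2_2 K AA)),
     counit = (\<lambda>X. counit b (tensor_pair K A (\<lambda>x. x) (\<lambda>x. x) X)),
     antipode = join_point AA (inv\<^bsub>semi AA\<^esub> (split_point (point_id AA)))\<rparr>"

text \<open>The value of the operator at the generic point; precomposition with it realises the
  operator on the points in every \<open>R\<close>.\<close>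

definition double_B :: "('a, 'a, 'k) tensor \<Rightarrow> ('a, 'a, 'k) tensor"
  where "double_B = join_point AA (rb AA (split_point (point_id AA)))"

definition double_circ :: "('k, ('a, 'a, 'k) tensor) hopf"
  where "double_circ = descendant K AA double_bullet double_B"

lemma semi_group: "algebra K R \<Longrightarrow> group (semi R)"
  by (rule skew_brace.group_semidirect[OF skew_brace_points])

lemma algebra_AAAA: "algebra K (tensor_algebra K AA AA)"
  by (rule algebra_tensor_algebra[OF algebra_AA algebra_AA])

lemma double_bullet_comult_split:
  "comult double_bullet \<in> alg_points K AA (tensor_algebra K AA AA)"
  "split_point (comult double_bullet) =
    split_point (point2_1 K AA) \<otimes>\<^bsub>semi (tensor_algebra K AA AA)\<^esub> split_point (point2_2 K AA)"
proof -
  let ?R = "tensor_algebra K AA AA" and ?p = "split_point (point2_1 K AA)" and ?q = "split_point (point2_2 K AA)"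
  interpret S: group "semi ?R" by (rule semi_group[OF algebra_AAAA])
  have "?p \<otimes>\<^bsub>semi ?R\<^esub> ?q
      \<in> carrier (semi ?R)"
    using split_closed[OF point2_closed(1)[OF algebra_AA]] split_closed[OF point2_closed(2)[OF algebra_AA]] by simp
  then show "comult double_bullet \<in> alg_points K AA ?R"
    "split_point (comult double_bullet) =
      ?p \<otimes>\<^bsub>semi ?R\<^esub> ?q"
    by (simp_all add: double_bullet_def join_closed[OF algebra_AAAA] split_join[OF algebra_AAAA])
qed

lemma algebra_hom_mult_map: "algebra_hom K AA A (tensor_pair K A (\<lambda>x. x) (\<lambda>x. x))"
  by (rule algebra_hom_tensor_pair[OF algebra_A algebra_A algebra_A algebra_hom_id algebra_hom_id])

lemma pre_double_bullet: "pre_bialgebra K AA double_bullet"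
proof (intro pre_bialgebra.intro algebra_AA pre_bialgebra_axioms.intro)
  show "algebra_hom K AA (tensor_algebra K AA AA) (comult double_bullet)"
    by (rule alg_points_hom[OF double_bullet_comult_split(1)])
  note m = algebra_hom_mult_map
  have "counit b \<circ> tensor_pair K A (\<lambda>x. x) (\<lambda>x. x) \<in> ring_hom AA K"
    using pair.bul.pre.counit_character m unfolding algebra_character_def algebra_hom_def
    by (blast intro: ring_hom_trans)
  then show "algebra_character K AA (counit double_bullet)"
    unfolding algebra_character_def
    by (simp add: double_bullet_def comp_def algebra_hom_smult[OF m] algebra_hom_closed[OF m]
        pair.bul.pre.counit_smult)
qed

interpretation db: pre_bialgebra K AA double_bullet by (rule pre_double_bullet)

text \<open>The pair \<open>P\<close>, \<open>Q\<close> is the image of the generic pair under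
  \<open>tensor_pair K R P Q\<close>, so naturality of the semidirect product extends the defining
  case to all points.\<close>

lemma split_mult:
  assumes R: "algebra K R" and P: "P \<in> alg_points K AA R" and Q: "Q \<in> alg_points K AA R"
  shows "split_point (P \<otimes>\<^bsub>points K AA double_bullet R\<^esub> Q) = split_point P \<otimes>\<^bsub>semi R\<^esub> split_point Q"
proof -
  let ?\<phi> = "tensor_pair K R P Q"
  have \<phi>: "algebra_hom K (tensor_algebra K AA AA) R ?\<phi>"
    by (rule algebra_hom_tensor_pair[OF algebra_AA algebra_AA R alg_points_hom[OF P] alg_points_hom[OF Q]])
  note p = point2_closed[OF algebra_AA]
  have "split_point (P \<otimes>\<^bsub>points K AA double_bullet R\<^esub> Q) = push_point ?\<phi> (split_point (comult double_bullet))"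
    unfolding db.points_mult_eq_compose by (rule split_compose[OF double_bullet_comult_split(1)])
  also have "\<dots> = push_point ?\<phi> (split_point (point2_1 K AA)) \<otimes>\<^bsub>semi R\<^esub> push_point ?\<phi> (split_point (point2_2 K AA))"
    unfolding double_bullet_comult_split(2)
    by (rule push_mult[OF algebra_AAAA R \<phi> split_closed[OF p(1)] split_closed[OF p(2)]])
  also have "\<dots> = split_point P \<otimes>\<^bsub>semi R\<^esub> split_point Q"
    unfolding split_compose[OF p(1), symmetric] split_compose[OF p(2), symmetric]
      compose_point2[OF algebra_AA R P Q] ..
  finally show ?thesis .
qed

lemma split_one:
  assumes R: "algebra K R"
  shows "split_point \<one>\<^bsub>points K AA double_bullet R\<^esub> = \<one>\<^bsub>semi R\<^esub>"
proof -
  interpret A: algebra K A by (rule algebra_A)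
  interpret Rb: skew_brace "points K A b R" "points K A c R" by (rule skew_brace_points[OF R])
  note t = tensor_pair_tensor[OF algebra_A algebra_A algebra_A algebra_hom_id algebra_hom_id]
  note tc = tensor_closed[OF bullet.module_axioms bullet.module_axioms]
  have "compose (carrier A) \<one>\<^bsub>points K AA double_bullet R\<^esub> (point2_1 K A) = \<one>\<^bsub>points K A b R\<^esub>"
    "compose (carrier A) \<one>\<^bsub>points K AA double_bullet R\<^esub> (point2_2 K A) = \<one>\<^bsub>points K A b R\<^esub>"
    by (rule ext, simp add: compose_def points_def point2_1_def point2_2_def double_bullet_def t tc)+
  then show ?thesis by (simp add: split_point_def brace_semidirect_def)
qed

lemma split_image:
  assumes "algebra K R"
  shows "split_point ` alg_points K AA R = carrier (semi R)"
proof
  show "split_point ` alg_points K AA R \<subseteq> carrier (semi R)" by (rule image_subsetI, rule split_closed)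
  show "carrier (semi R) \<subseteq> split_point ` alg_points K AA R"
    using split_join[OF assms] join_closed[OF assms] by (metis image_eqI subsetI)
qed

text \<open>The group laws come from the semidirect product through the bijection with pairs; the
  Hopf axioms are read off from them afterwards.\<close>

lemma group_double_bullet:
  assumes R: "algebra K R"
  shows "group (points K AA double_bullet R)"
proof (rule group_transport[OF semi_group[OF R], where \<Psi> = split_point])
  show "inj_on split_point (carrier (points K AA double_bullet R))"
    unfolding carrier_points by (rule inj_onI, rule split_inj)
qed (simp_all add: split_image[OF R] split_mult[OF R] split_one[OF R] db.points_mult_closed[OF R]
    db.points_one_closed[OF R])

lemma split_inv:
  assumes R: "algebra K R" and P: "P \<in> alg_points K AA R"
  shows "split_point (inv\<^bsub>points K AA double_bullet R\<^esub> P) = inv\<^bsub>semi R\<^esub> (split_point P)"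
proof -
  interpret group_hom "points K AA double_bullet R" "semi R" split_point
    by (intro group_hom.intro group_hom_axioms.intro group_double_bullet[OF R] semi_group[OF R] homI)
      (simp_all add: split_mult[OF R] split_closed)
  show ?thesis using hom_inv[of P] P by simp
qed

lemma hopf_double_bullet: "hopf_algebra K AA double_bullet"
proof -
  let ?P = "points K AA double_bullet AA"
  note id = point_id_closed[OF algebra_AA]
  interpret S: group "semi AA" by (rule semi_group[OF algebra_AA])
  interpret P: group "?P" by (rule group_double_bullet[OF algebra_AA])
  have a: "antipode double_bullet = join_point AA (inv\<^bsub>semi AA\<^esub> (split_point (point_id AA)))"
    by (simp add: double_bullet_def)
  have cl: "inv\<^bsub>semi AA\<^esub> (split_point (point_id AA)) \<in> carrier (semi AA)"
    using split_closed[OF id] by simp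
  have S: "antipode double_bullet \<in> alg_points K AA AA"
    unfolding a by (rule join_closed[OF algebra_AA cl])
  show ?thesis
  proof (rule db.hopf_algebraI[OF _ alg_points_hom[OF S]])
    show "field K" by (rule bullet.field_axioms)
    show "group (points K AA double_bullet (tensor_algebra3 K AA))"
      by (rule group_double_bullet[OF db.algebra_tensor3])
    show "group ?P" by (rule group_double_bullet[OF algebra_AA])
    have "inv\<^bsub>?P\<^esub> (point_id AA) = antipode double_bullet"
    proof (rule split_inj[OF _ S])
      show "inv\<^bsub>?P\<^esub> (point_id AA) \<in> alg_points K AA AA"
        using P.inv_closed id by simp
      show "split_point (inv\<^bsub>?P\<^esub> (point_id AA)) = split_point (antipode double_bullet)"
        unfolding split_inv[OF algebra_AA id] a split_join[OF algebra_AA cl] ..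
    qed
    then show "inv\<^bsub>?P\<^esub> (point_id AA) = restrict (antipode double_bullet) (carrier AA)"
      by (simp add: alg_points_eq_restrict[OF S])
  qed
qed

lemma cring_AA: "cring AA"
  by (rule algebra.M_cring[OF algebra_AA])

lemma comm_hopf_double_bullet: "comm_hopf K AA double_bullet"
  by (rule comm_hopf.intro[OF hopf_double_bullet cring_AA])

end

section \<open>Rota--Baxter operators on the groups of points\<close>

context comm_hopf
begin

context
  fixes B :: "'a \<Rightarrow> 'a"
  assumes B: "B \<in> alg_points K A A"
begin

text \<open>The endomorphism \<open>B\<close> acts by precomposition on the points of every
  \<open>R\<close> at once; this is the operator whose descendant is formed.\<close>

abbreviation "desc_points R \<equiv> descendant_group (points K A h R) (\<lambda>P. compose (carrier A) P B)"

lemma B_point_closed: "P \<in> alg_points K A R \<Longrightarrow> compose (carrier A) P B \<in> alg_points K A R"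
  by (rule compose_alg_points[OF pre.algebra_axioms alg_points_hom B])

lemma inv_point_closed:
  assumes "algebra K R" "P \<in> alg_points K A R"
  shows "inv\<^bsub>points K A h R\<^esub> P \<in> alg_points K A R"
  using group.inv_closed[OF group_points[OF assms(1)]] assms(2) by simp

lemma inv_point_apply:
  assumes "algebra K R" "P \<in> alg_points K A R" "x \<in> carrier A"
  shows "(inv\<^bsub>points K A h R\<^esub> P) x = P (antipode h x)"
  by (simp add: points_inv[OF assms(1,2)] compose_eq assms(3))

lemma desc_mult_closed:
  "\<lbrakk>algebra K R; P \<in> alg_points K A R; Q \<in> alg_points K A R\<rbrakk> \<Longrightarrow>
    P \<otimes>\<^bsub>desc_points R\<^esub> Q \<in> alg_points K A R"
  by (simp add: descendant_group_def pre.points_mult_closed B_point_closed inv_point_closed)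

text \<open>Stated for any \<open>\<beta>\<close> of this shape because it serves twice: the
  descendant coproduct contains \<open>B(x2) B(S(x4))\<close> and the co-Rota--Baxter identity
  \<open>B(x2 S(x4))\<close>, and both reduce to the form given.\<close>

lemma descendant_formula:
  assumes x: "x \<in> carrier A"
    and eq: "\<And>x1 x2 x3 x4. \<lbrakk>x1 \<in> carrier A; x2 \<in> carrier A; x3 \<in> carrier A; x4 \<in> carrier A\<rbrakk> \<Longrightarrow>
      \<beta> x1 x2 x3 x4 = tensor K A A (x1 \<otimes>\<^bsub>A\<^esub> (B x2 \<otimes>\<^bsub>A\<^esub> B (antipode h x4))) x3"
  shows "sweedler4 K h (tensor_algebra K A A) x \<beta> =
    (point2_1 K A \<otimes>\<^bsub>desc_points (tensor_algebra K A A)\<^esub> point2_2 K A) x"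
proof -
  let ?AA = "tensor_algebra K A A"
  note aA = pre.algebra_axioms and aAA = pre.algebra_tensor2
  interpret AA: algebra K ?AA by (rule aAA)
  note p = point2_closed[OF aA]
  note h1 = alg_points_hom[OF p(1)] and h2 = alg_points_hom[OF p(2)]
  note Bc = algebra_hom_closed[OF alg_points_hom[OF B]]
  note Sc = algebra_hom_closed[OF antipode_algebra_hom]
  note Bp = B_point_closed[OF p(1)]
  show ?thesis
    unfolding descendant_group_def monoid.simps
  proof (rule pre.sweedler4_points[OF aAA p(1) Bp p(2) inv_point_closed[OF aAA Bp] x])
    fix x1 x2 x3 x4 assume "x1 \<in> carrier A" "x2 \<in> carrier A" "x3 \<in> carrier A" "x4 \<in> carrier A"
    then show "\<beta> x1 x2 x3 x4 = point2_1 K A x1 \<otimes>\<^bsub>?AA\<^esub> (compose (carrier A) (point2_1 K A) B x2 \<otimes>\<^bsub>?AA\<^esub>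
        (point2_2 K A x3 \<otimes>\<^bsub>?AA\<^esub> (inv\<^bsub>points K A h ?AA\<^esub> (compose (carrier A) (point2_1 K A) B)) x4))"
      by (simp add: eq inv_point_apply[OF aAA Bp] compose_eq point2_mult[OF aA] Bc Sc algebra_hom_mult[OF h1]
          algebra_hom_closed[OF h1] algebra_hom_closed[OF h2] AA.m_ac)
  qed
qed

lemma comult_descendant:
  assumes "x \<in> carrier A"
  shows "comult (descendant K A h B) x =
    (point2_1 K A \<otimes>\<^bsub>desc_points (tensor_algebra K A A)\<^esub> point2_2 K A) x"
  unfolding descendant_def hopf.simps
  by (rule descendant_formula[OF assms])
    (simp add: m_assoc algebra_hom_closed[OF alg_points_hom[OF B]] algebra_hom_closed[OF antipode_algebra_hom])

lemma pre_bialgebra_descendant: "pre_bialgebra K A (descendant K A h B)"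
proof (intro pre_bialgebra.intro pre.algebra_axioms pre_bialgebra_axioms.intro)
  show "algebra_hom K A (tensor_algebra K A A) (comult (descendant K A h B))"
    by (rule algebra_hom_cong[OF comult_descendant pre.algebra_axioms])
      (assumption, rule alg_points_hom[OF desc_mult_closed[OF pre.algebra_tensor2
          point2_closed[OF pre.algebra_axioms]]])
  show "algebra_character K A (counit (descendant K A h B))"
    using counit_hom by (simp add: descendant_def)
qed

lemma compose_desc_mult:
  assumes R: "algebra K R" and R': "algebra K R'" and \<phi>: "algebra_hom K R R' \<phi>"
    and PQ: "P \<in> alg_points K A R" "Q \<in> alg_points K A R"
  shows "compose (carrier A) \<phi> (P \<otimes>\<^bsub>desc_points R\<^esub> Q) =
    compose (carrier A) \<phi> P \<otimes>\<^bsub>desc_points R'\<^esub> compose (carrier A) \<phi> Q"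
proof -
  have "compose (carrier A) \<phi> (compose (carrier A) P B) = compose (carrier A) (compose (carrier A) \<phi> P) B"
    using algebra_hom_closed[OF alg_points_hom[OF B]] by (auto simp: compose_def)
  then show ?thesis
    by (simp add: descendant_group_def pre.compose_points_mult[OF R _ _ R' \<phi>]
        pre.compose_points_inv[OF R R' \<phi> group_points[OF R] group_points[OF R']]
        pre.points_mult_closed[OF R] inv_point_closed[OF R] B_point_closed PQ)
qed

text \<open>\<open>comult_descendant\<close> is the case of the generic pair, and the descendant
  product is natural in \<open>R\<close>.\<close>

lemma points_descendant_mult:
  assumes R: "algebra K R" and PQ: "P \<in> alg_points K A R" "Q \<in> alg_points K A R"
  shows "P \<otimes>\<^bsub>points K A (descendant K A h B) R\<^esub> Q = P \<otimes>\<^bsub>desc_points R\<^esub> Q"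
proof -
  note aA = pre.algebra_axioms
  let ?\<phi> = "tensor_pair K R P Q"
  have \<phi>: "algebra_hom K (tensor_algebra K A A) R ?\<phi>"
    by (rule algebra_hom_tensor_pair[OF aA aA R alg_points_hom[OF PQ(1)] alg_points_hom[OF PQ(2)]])
  have "P \<otimes>\<^bsub>points K A (descendant K A h B) R\<^esub> Q =
      compose (carrier A) ?\<phi> (point2_1 K A \<otimes>\<^bsub>desc_points (tensor_algebra K A A)\<^esub> point2_2 K A)"
    by (rule ext) (simp add: points_def compose_def comult_descendant)
  also have "\<dots> = P \<otimes>\<^bsub>desc_points R\<^esub> Q"
    by (simp only: compose_desc_mult[OF pre.algebra_tensor2 R \<phi> point2_closed[OF aA]] compose_point2[OF aA R PQ])
  finally show ?thesis .
qed

lemma points_descendant_one: "\<one>\<^bsub>points K A (descendant K A h B) R\<^esub> = \<one>\<^bsub>desc_points R\<^esub>"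
  by (simp add: points_def descendant_group_def descendant_def)

lemma
  assumes R: "algebra K R"
    and rb: "rota_baxter_group (points K A h R) (\<lambda>P. compose (carrier A) P B)"
  shows group_points_descendant: "group (points K A (descendant K A h B) R)"
    and points_descendant_inv: "P \<in> alg_points K A R \<Longrightarrow>
      inv\<^bsub>points K A (descendant K A h B) R\<^esub> P = inv\<^bsub>desc_points R\<^esub> P"
proof -
  interpret RB: rota_baxter_group "points K A h R" "\<lambda>P. compose (carrier A) P B" by (rule rb)
  interpret D: group "desc_points R" by (rule RB.group_descendant)
  have c: "carrier (desc_points R) = alg_points K A R" by (simp add: descendant_group_def)
  show grp: "group (points K A (descendant K A h B) R)"
    by (rule group_transport[OF D.group_axioms, where \<Psi> = "\<lambda>P. P"])
      (use D.one_closed in \<open>simp_all add: c points_descendant_mult[OF R] points_descendant_one desc_mult_closed[OF R]\<close>)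
  show "inv\<^bsub>points K A (descendant K A h B) R\<^esub> P = inv\<^bsub>desc_points R\<^esub> P" if "P \<in> alg_points K A R"
    by (rule group.inv_equality[OF grp])
      (use that D.inv_closed[unfolded c] D.l_inv[unfolded c] in
        \<open>simp_all add: points_descendant_mult[OF R] points_descendant_one\<close>)
qed

lemma hopf_descendant:
  assumes rb3: "rota_baxter_group (points K A h (tensor_algebra3 K A)) (\<lambda>P. compose (carrier A) P B)"
    and rb: "rota_baxter_group (points K A h A) (\<lambda>P. compose (carrier A) P B)"
  shows "hopf_algebra K A (descendant K A h B)"
proof -
  let ?D = "descendant K A h B" and ?P = "points K A h A"
  interpret D: pre_bialgebra K A "?D" by (rule pre_bialgebra_descendant)
  interpret RB: rota_baxter_group "?P" "\<lambda>P. compose (carrier A) P B" by (rule rb)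
  note aA = pre.algebra_axioms
  note id = point_id_closed[OF aA]
  \<comment> \<open>At the generic point the operator takes the value \<open>B\<close>, so the
    inverse in the descendant group becomes the defining expression of \<open>S_B\<close>.\<close>
  have Bid: "compose (carrier A) (point_id A) B = B"
    by (rule alg_points_eqI[OF B_point_closed[OF id] B])
      (simp add: compose_eq point_id_def algebra_hom_closed[OF alg_points_hom[OF B]])
  note Bc = algebra_hom_closed[OF alg_points_hom[OF B]]
  have inv: "inv\<^bsub>points K A ?D A\<^esub> (point_id A) =
      inv\<^bsub>?P\<^esub> B \<otimes>\<^bsub>?P\<^esub> (inv\<^bsub>?P\<^esub> (point_id A) \<otimes>\<^bsub>?P\<^esub> B)"
    using points_descendant_inv[OF aA rb id] RB.inv_descendant[of "point_id A"] id by (simp add: Bid)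
  have S: "antipode ?D x = (inv\<^bsub>points K A ?D A\<^esub> (point_id A)) x"
    if x: "x \<in> carrier A" for x
    unfolding inv unfolding descendant_def hopf.simps
  proof (rule pre.sweedler3_points[OF aA inv_point_closed[OF aA B] inv_point_closed[OF aA id] B x])
    fix x1 x2 x3 assume "x1 \<in> carrier A" "x2 \<in> carrier A" "x3 \<in> carrier A"
    then show "B (antipode h x1) \<otimes>\<^bsub>A\<^esub> antipode h x2 \<otimes>\<^bsub>A\<^esub> B x3 =
        (inv\<^bsub>?P\<^esub> B) x1 \<otimes>\<^bsub>A\<^esub> ((inv\<^bsub>?P\<^esub> (point_id A)) x2 \<otimes>\<^bsub>A\<^esub> B x3)"
      using algebra_hom_closed[OF antipode_algebra_hom]
      by (simp add: inv_point_apply[OF aA B] inv_point_apply[OF aA id])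
        (simp add: point_id_def Bc m_assoc)
  qed
  have inv_cl: "inv\<^bsub>points K A ?D A\<^esub> (point_id A) \<in> alg_points K A A"
    using group.inv_closed[OF group_points_descendant[OF aA rb]] id by simp
  show ?thesis
  proof (rule D.hopf_algebraI[OF field_axioms _ group_points_descendant[OF pre.algebra_tensor3 rb3]
        group_points_descendant[OF aA rb]])
    show "algebra_hom K A A (antipode ?D)"
      by (rule algebra_hom_cong[OF S aA alg_points_hom[OF inv_cl]])
    show "inv\<^bsub>points K A ?D A\<^esub> (point_id A) =
        restrict (antipode ?D) (carrier A)"
      using alg_points_eq_restrict[OF inv_cl] by (auto simp: S cong: restrict_cong)
  qed
qed

text \<open>The descendant makes a skew brace of the points in the tensor cube; its identity at the
  generic triple is the co-brace axiom, by the translation of both sides read backwards.\<close>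

lemma comm_hopf_cobrace_descendant:
  assumes rb3: "rota_baxter_group (points K A h (tensor_algebra3 K A)) (\<lambda>P. compose (carrier A) P B)"
    and rb: "rota_baxter_group (points K A h A) (\<lambda>P. compose (carrier A) P B)"
  shows "comm_hopf_cobrace K A h (descendant K A h B)"
proof -
  let ?D = "descendant K A h B"
  let ?R = "tensor_algebra3 K A"
  note R = pre.algebra_tensor3
  have hD: "hopf_algebra K A ?D" by (rule hopf_descendant[OF rb3 rb])
  interpret pr: hopf_pair K A h "?D"
    by (intro hopf_pair.intro comm_hopf_axioms comm_hopf.intro hD cring_axioms)
  interpret RB: rota_baxter_group "points K A h ?R" "\<lambda>P. compose (carrier A) P B" by (rule rb3)
  interpret sk: skew_brace "points K A h ?R" "desc_points ?R" by (rule RB.skew_brace_descendant)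
  note p = pre.point3_closed
  note cl = pre.points_mult_closed[OF R] inv_point_closed[OF R]
  show ?thesis
  proof (intro comm_hopf_cobrace.intro hopf_cobrace.intro hopf_cobrace_axioms.intro
      hopf_algebra_axioms hD cring_axioms)
    fix x assume x: "x \<in> carrier A"
    show "sweedler2 K ?D ?R x (\<lambda>u v.
          sweedler2 K h ?R v (\<lambda>v1 v2. tensor3 K A u v1 v2)) =
        sweedler3 K h ?R x (\<lambda>x1 x2 x3.
          sweedler2 K ?D ?R x1 (\<lambda>y1 y2.
            sweedler2 K ?D ?R x3 (\<lambda>z1 z2.
              tensor3 K A (y1 \<otimes>\<^bsub>A\<^esub> antipode h x2 \<otimes>\<^bsub>A\<^esub> z1) y2 z2)))"
      unfolding pr.cobrace_left[OF x] pr.cobrace_right[OF x]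
      using sk.brace[of "point3_1 K A" "point3_2 K A" "point3_3 K A"] p
      by (simp add: points_descendant_mult[OF R] cl)
  qed
qed

text \<open>This is the Rota--Baxter identity at the generic pair: the right-hand side is the
  descendant product of that pair, evaluated at \<open>B x\<close>.\<close>

lemma co_rota_baxterI:
  assumes rb2: "rota_baxter_group (points K A h (tensor_algebra K A A)) (\<lambda>P. compose (carrier A) P B)"
  shows "co_rota_baxter K A h B"
proof (intro co_rota_baxter.intro co_rota_baxter_axioms.intro hopf_algebra_axioms cring_axioms alg_points_hom[OF B])
  let ?AA = "tensor_algebra K A A"
  interpret RB: rota_baxter_group "points K A h ?AA" "\<lambda>P. compose (carrier A) P B" by (rule rb2)
  note aA = pre.algebra_axioms and aAA = pre.algebra_tensor2
  note p = point2_closed[OF aA]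
  note Bh = alg_points_hom[OF B]
  note Bc = algebra_hom_closed[OF Bh]
  fix x assume x: "x \<in> carrier A"
  have "sweedler2 K h ?AA x (\<lambda>x1 x2. tensor K A A (B x1) (B x2)) =
      (compose (carrier A) (point2_1 K A) B \<otimes>\<^bsub>points K A h ?AA\<^esub> compose (carrier A) (point2_2 K A) B) x"
    by (rule pre.sweedler2_points[OF aAA B_point_closed[OF p(1)] B_point_closed[OF p(2)] x])
      (simp add: compose_eq point2_mult[OF aA] Bc)
  also have "\<dots> = compose (carrier A) (point2_1 K A \<otimes>\<^bsub>desc_points ?AA\<^esub> point2_2 K A) B x"
    using RB.rota_baxter[of "point2_1 K A" "point2_2 K A"] p by (simp add: descendant_group_def)
  also have "\<dots> = (point2_1 K A \<otimes>\<^bsub>desc_points ?AA\<^esub> point2_2 K A) (B x)"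
    using x by (simp add: compose_eq)
  also have "\<dots> = sweedler4 K h ?AA (B x) (\<lambda>y1 y2 y3 y4.
      tensor K A A (y1 \<otimes>\<^bsub>A\<^esub> B (y2 \<otimes>\<^bsub>A\<^esub> antipode h y4)) y3)"
    by (rule descendant_formula[OF Bc[OF x], symmetric])
      (simp add: algebra_hom_mult[OF Bh] algebra_hom_closed[OF antipode_algebra_hom])
  finally show "sweedler2 K h ?AA x (\<lambda>x1 x2. tensor K A A (B x1) (B x2)) =
    sweedler4 K h ?AA (B x) (\<lambda>y1 y2 y3 y4. tensor K A A (y1 \<otimes>\<^bsub>A\<^esub> B (y2 \<otimes>\<^bsub>A\<^esub> antipode h y4)) y3)" .
qed

end

end

section \<open>The Rota--Baxter operator on the tensor square\<close>

context comm_hopf_cobrace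
begin

interpretation db: comm_hopf K AA double_bullet by (rule comm_hopf_double_bullet)

lemma double_B_closed: "double_B \<in> alg_points K AA AA"
  unfolding double_B_def
  by (rule join_closed[OF algebra_AA skew_brace.rota_baxter_closed[OF skew_brace_points[OF algebra_AA]
          split_closed[OF point_id_closed[OF algebra_AA]]]])

text \<open>The definition of \<open>double_B\<close> is the case of the generic point, which
  \<open>P\<close> carries to \<open>P\<close>; since \<open>rb\<close> is natural in
  \<open>R\<close>, the general case follows.\<close>

lemma split_B:
  assumes R: "algebra K R" and P: "P \<in> alg_points K AA R"
  shows "split_point (compose (carrier AA) P double_B) = rb R (split_point P)"
proof -
  note id = point_id_closed[OF algebra_AA]
  have "split_point (compose (carrier AA) P double_B) = push_point P (rb AA (split_point (point_id AA)))"
    unfolding split_compose[OF double_B_closed]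
    unfolding double_B_def
    by (subst split_join[OF algebra_AA]) (rule skew_brace.rota_baxter_closed[OF skew_brace_points[OF algebra_AA]
          split_closed[OF id]], rule refl)
  also have "\<dots> = rb R (push_point P (split_point (point_id AA)))"
    by (rule push_rb[OF algebra_AA R alg_points_hom[OF P] split_closed[OF id]])
  also have "\<dots> = rb R (split_point P)"
    unfolding split_compose[OF id, symmetric] compose_point_id[OF P] ..
  finally show ?thesis .
qed

text \<open>The identity is checked after \<open>split_point\<close>, which is injective and turns
  products, inverses and \<open>double_B\<close> into those of the semidirect product.\<close>

lemma rota_baxter_points:
  assumes R: "algebra K R"
  shows "rota_baxter_group (points K AA double_bullet R) (\<lambda>P. compose (carrier AA) P double_B)"
proof (intro rota_baxter_group.intro rota_baxter_group_axioms.intro group_double_bullet[OF R])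
  interpret S: rota_baxter_group "semi R" "rb R"
    by (rule skew_brace.rota_baxter_semidirect[OF skew_brace_points[OF R]])
  note cl = db.pre.points_mult_closed[OF R] db.inv_point_closed[OF double_B_closed R]
    db.B_point_closed[OF double_B_closed]
  show "compose (carrier AA) P double_B \<in> carrier (points K AA double_bullet R)"
    if "P \<in> carrier (points K AA double_bullet R)" for P
    using that cl(3) by simp
  fix P Q assume "P \<in> carrier (points K AA double_bullet R)" "Q \<in> carrier (points K AA double_bullet R)"
  then have PQ: "P \<in> alg_points K AA R" "Q \<in> alg_points K AA R" by simp_all
  show "compose (carrier AA) P double_B \<otimes>\<^bsub>points K AA double_bullet R\<^esub> compose (carrier AA) Q double_B =
    compose (carrier AA) (P \<otimes>\<^bsub>points K AA double_bullet R\<^esub> (compose (carrier AA) P double_B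
      \<otimes>\<^bsub>points K AA double_bullet R\<^esub> (Q \<otimes>\<^bsub>points K AA double_bullet R\<^esub>
        inv\<^bsub>points K AA double_bullet R\<^esub> (compose (carrier AA) P double_B)))) double_B"
    by (rule split_inj[where R = R])
      (simp_all add: cl PQ split_mult[OF R] split_inv[OF R] split_B[OF R] split_closed S.rota_baxter)
qed

lemma cobrace_double: "comm_hopf_cobrace K AA double_bullet double_circ"
  unfolding double_circ_def
  by (rule db.comm_hopf_cobrace_descendant[OF double_B_closed rota_baxter_points[OF db.pre.algebra_tensor3]
        rota_baxter_points[OF algebra_AA]])

lemma arises_double: "arises_from_co_rota_baxter K AA double_bullet double_circ"
  unfolding arises_from_co_rota_baxter_def double_circ_def hopf_eq_def
  using db.co_rota_baxterI[OF double_B_closed rota_baxter_points[OF db.pre.algebra_tensor2]] by blast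

end

section \<open>The projection onto the original co-brace\<close>

context comm_hopf_cobrace
begin

interpretation db: comm_hopf K AA double_bullet by (rule comm_hopf_double_bullet)

abbreviation "proj \<equiv> tensor_lift K A (\<lambda>x y. counit b x \<odot>\<^bsub>A\<^esub> y)"

text \<open>As the copairing of the trivial point and the identity, \<open>proj\<close> is an
  algebra homomorphism; the two forms differ only in \<open>\<epsilon>(x) y\<close> against
  \<open>(\<epsilon>(x) 1) y\<close>.\<close>

lemma proj_eq_pair:
  assumes "X \<in> carrier AA"
  shows "proj X = tensor_pair K A (\<lambda>x. counit b x \<odot>\<^bsub>A\<^esub> \<one>\<^bsub>A\<^esub>) (\<lambda>x. x) X"
  unfolding tensor_pair_def
  by (rule tensor_lift_cong[OF bullet.module_axioms bullet.module_axioms bullet.module_axioms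
        bilinear_pair[OF algebra_A algebra_A algebra_A pair.bul.pre.algebra_hom_counit[OF algebra_A]
          algebra_hom_id] assms])
    (simp add: pair.bul.pre.counit_closed pair.bul.pre.smult_assoc2)

lemmas proj_homs = algebra_A algebra_A algebra_A pair.bul.pre.algebra_hom_counit[OF algebra_A] algebra_hom_id

lemma algebra_hom_proj: "algebra_hom K AA A proj"
  by (rule algebra_hom_cong[OF proj_eq_pair algebra_AA algebra_hom_tensor_pair[OF proj_homs]])

lemma proj_tensor:
  "\<lbrakk>x \<in> carrier A; y \<in> carrier A\<rbrakk> \<Longrightarrow> proj (tensor K A A x y) = counit b x \<odot>\<^bsub>A\<^esub> y"
  by (simp add: proj_eq_pair tensor_closed[OF bullet.module_axioms bullet.module_axioms]
      tensor_pair_tensor[OF proj_homs] pair.bul.pre.counit_closed pair.bul.pre.smult_assoc2)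

text \<open>On points \<open>proj\<close> is the embedding \<open>x \<mapsto> (1, x)\<close>, so
  compatibility with both coproducts reduces to the embedding lemmas for skew braces.\<close>

lemma split_proj:
  assumes R: "algebra K R" and p: "p \<in> alg_points K A R"
  shows "split_point (compose (carrier AA) p proj) = (\<one>\<^bsub>points K A b R\<^esub>, p)"
proof -
  interpret R: algebra K R by (rule R)
  note h = alg_points_hom[OF p]
  note tc = tensor_closed[OF bullet.module_axioms bullet.module_axioms]
  have "compose (carrier A) (compose (carrier AA) p proj) (point2_1 K A) = \<one>\<^bsub>points K A b R\<^esub>"
    by (rule ext) (simp add: compose_def points_def point2_1_def tc proj_tensor
        pair.bul.pre.counit_closed algebra_hom_smult[OF h] algebra_hom_one[OF h])
  moreover have "compose (carrier A) (compose (carrier AA) p proj) (point2_2 K A) = p"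
    by (rule alg_points_eqI[OF compose_alg_points[OF algebra_A
            alg_points_hom[OF compose_hom_alg_points[OF algebra_AA algebra_hom_proj p]]
            point2_closed(2)[OF algebra_A]] p])
      (simp add: compose_def point2_2_def tc proj_tensor pair.bul.pre.counit_one)
  ultimately show ?thesis by (simp add: split_point_def)
qed

lemma split_descendant_mult:
  assumes R: "algebra K R" and PQ: "P \<in> alg_points K AA R" "Q \<in> alg_points K AA R"
  shows "split_point (P \<otimes>\<^bsub>points K AA double_circ R\<^esub> Q) =
    split_point P \<otimes>\<^bsub>descendant_group (semi R) (rb R)\<^esub> split_point Q"
  unfolding double_circ_def db.points_descendant_mult[OF double_B_closed R PQ]
  by (simp add: descendant_group_def split_mult[OF R] split_inv[OF R] split_B[OF R] PQ
      db.pre.points_mult_closed[OF R] db.inv_point_closed[OF double_B_closed R]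
      db.B_point_closed[OF double_B_closed])

lemma proj_mult_bullet:
  assumes R: "algebra K R" and pq: "p \<in> alg_points K A R" "q \<in> alg_points K A R"
  shows "compose (carrier AA) p proj \<otimes>\<^bsub>points K AA double_bullet R\<^esub> compose (carrier AA) q proj =
    compose (carrier AA) (p \<otimes>\<^bsub>points K A b R\<^esub> q) proj"
proof -
  note c = compose_hom_alg_points[OF algebra_AA algebra_hom_proj]
  note m = pair.bul.pre.points_mult_closed[OF R pq]
  show ?thesis
    by (rule split_inj[OF db.pre.points_mult_closed[OF R c[OF pq(1)] c[OF pq(2)]] c[OF m]])
      (simp add: split_mult[OF R c[OF pq(1)] c[OF pq(2)]] split_proj[OF R] pq m
        skew_brace.embedding_semidirect[OF skew_brace_points[OF R]])
qed

lemma proj_mult_circ: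
  assumes R: "algebra K R" and pq: "p \<in> alg_points K A R" "q \<in> alg_points K A R"
  shows "compose (carrier AA) p proj \<otimes>\<^bsub>points K AA double_circ R\<^esub> compose (carrier AA) q proj =
    compose (carrier AA) (p \<otimes>\<^bsub>points K A c R\<^esub> q) proj"
proof -
  note c = compose_hom_alg_points[OF algebra_AA algebra_hom_proj]
  note m = pair.cir.pre.points_mult_closed[OF R pq]
  have pre: "pre_bialgebra K AA double_circ"
    unfolding double_circ_def by (rule db.pre_bialgebra_descendant[OF double_B_closed])
  show ?thesis
    by (rule split_inj[OF pre_bialgebra.points_mult_closed[OF pre R c[OF pq(1)] c[OF pq(2)]] c[OF m]])
      (simp add: split_descendant_mult[OF R c[OF pq(1)] c[OF pq(2)]] split_proj[OF R] pq m
        skew_brace.embedding_descendant[OF skew_brace_points[OF R]])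
qed

text \<open>On a pure tensor both sides are \<open>\<epsilon>(x) \<epsilon>(y)\<close>, and both are
  additive.\<close>

lemma counit_proj:
  assumes "X \<in> carrier AA"
  shows "counit b (proj X) = counit double_bullet X"
  using assms
proof (induction X rule: tensor_induct[OF bullet.module_axioms bullet.module_axioms,
      consumes 1, case_names tensor add])
  case (tensor x y)
  then show ?case
    by (simp add: double_bullet_def proj_tensor pair.bul.pre.counit_smult pair.bul.pre.counit_mult
        pair.bul.pre.counit_closed
        tensor_pair_tensor[OF algebra_A algebra_A algebra_A algebra_hom_id algebra_hom_id])
next
  case (add X Y)
  then show ?case
    by (simp add: double_bullet_def algebra_hom_add[OF algebra_hom_proj] algebra_hom_add[OF algebra_hom_mult_map]
        algebra_hom_closed[OF algebra_hom_proj] algebra_hom_closed[OF algebra_hom_mult_map]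
        pair.bul.pre.counit_add)
qed

lemma hopf_cobrace_hom_proj: "hopf_cobrace_hom K AA double_bullet double_circ A b c proj"
  unfolding hopf_cobrace_hom_def
proof
  note p = point2_closed[OF algebra_A]
  show "hopf_hom K AA double_bullet A b proj"
    by (rule hopf_hom_pointsI[OF comm_hopf_double_bullet pair.bul.comm_hopf_axioms algebra_hom_proj counit_proj
          proj_mult_bullet[OF algebra_AA p] proj_mult_bullet[OF algebra_A]])
  have "comm_hopf K AA double_circ"
    by (rule comm_hopf.intro[OF hopf_cobrace.axioms(2)[OF comm_hopf_cobrace.axioms(1)[OF cobrace_double]] cring_AA])
  \<comment> \<open>The descendant keeps the counit of \<open>double_bullet\<close>, which
    \<open>counit_proj\<close> compares with \<open>counit b\<close>; \<open>counit_eq\<close> is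
    the passage to \<open>counit c\<close>.\<close>
  then show "hopf_hom K AA double_circ A c proj"
    by (rule hopf_hom_pointsI[OF _ pair.cir.comm_hopf_axioms algebra_hom_proj _
          proj_mult_circ[OF algebra_AA p] proj_mult_circ[OF algebra_A]])
      (simp add: counit_eq algebra_hom_closed[OF algebra_hom_proj] counit_proj double_circ_def descendant_def)
qed

end

theorem proposition5p5:
  fixes K :: "('k, 'm) ring_scheme"
    and H :: "('k, 'a, 'n) module_scheme"
    and b c :: "('k, 'a) hopf"
  assumes "comm_hopf_cobrace K H b c"
  shows "\<exists>b' c' :: ('k, ('a, 'a, 'k) tensor) hopf.
    comm_hopf_cobrace K (tensor_algebra K H H) b' c' \<and>
    arises_from_co_rota_baxter K (tensor_algebra K H H) b' c' \<and>
    hopf_cobrace_hom K (tensor_algebra K H H) b' c' H b c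
      (tensor_lift K H (\<lambda>x y. counit b x \<odot>\<^bsub>H\<^esub> y))"
proof -
  interpret comm_hopf_cobrace K H b c by (rule assms)
  show ?thesis using cobrace_double arises_double hopf_cobrace_hom_proj by blast
qed

end
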